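(* Let $\xi$ be a boundedly exchangeable graph process on $S$ directed by $\nu$. For every bounded Borel set $B\subseteq S$ with $\mathbb{P}(\nu(B)=0)<1$ there exists an infinite jointly exchangeable random matrix $A^B\in\mathbb{R}^{\mathbb{N}\times\mathbb{N}}$ such that the adjacency matrix $(A,N)$ of any i.i.d. representation of the restriction $\xi|_B$ satisfies, for all $n\ge 1$, $$A \mid (N=n) \;\overset{d}{=}\; A^B[n].$$ Moreover, the distribution of $A^B$ is unique.
   Context: $\mathbb{N}=\{1,2,\dots\}$. Let $(S,d)$ be a complete separable metric space; "bounded" means bounded for $d$. A measure is locally finite if it is finite on bounded Borel sets, and simple if it is a locally finite countable sum of distinct unit point masses. All random elements live on a common probability space assumed rich enough to support any additional independent uniform variables needed. An adjacency measure on $S$ is a simple measure $\xi$ on $S^2\times\{0,1\}$ such that there is a simple measure $\nu$ on $S$ with $\xi(C\times\{0,1\})=\nu^{\otimes2}(C)$ for all Borel $C\subseteq S^2$, and $\xi$ is invariant under $(x,y,a)\mapsto(y,x,a)$; $\xi$ is said to be directed by the (unique) $\nu$. For Borel $B$, the restriction $\xi|_B$ is the restriction of $\xi$ to $B\times B\times\{0,1\}$. A random adjacency measure is a random measure that is a.s. an adjacency measure. It always has representations $$\xi\overset{a.s.}{=}\sum_{i,j\le N}\delta_{(S_i,S_j,A_{ij})}\qquad(\ast)$$ with $N$ a random variable in $\{0,1,\dots\}\cup\{\infty\}$, $(S_i)_{i\le N}$ a.s. distinct random elements of $S$, and $A=(A_{ij})_{i,j\le N}$ a symmetric $\{0,1\}$-valued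 array, called the adjacency matrix of the representation (written $(A,N)$ to stress its random dimension). A connection kernel is a symmetric measurable $W:S^2\to[0,1]$. A random adjacency measure $\xi$ is a graph process (connected by $W$) if it admits a representation $(\ast)$ in which, conditionally on $(N,(S_k))$, $A_{ii}=0$, the $A_{ij}$, $i<j$, are independent $\mathrm{Bernoulli}(W(S_i,S_j))$, and $A_{ji}=A_{ij}$. Such a representation is an i.i.d. representation if in addition the $(S_k)$ are i.i.d. from some probability measure on $S$ and $N$ is independent of $(S_k)$. The restriction of a graph process to a Borel set is again a graph process. A mixed binomial process is a point process equal in law to $\sum_{i\le N}\delta_{S_i}$ with $N$ an a.s. finite $\{0,1,\dots\}$-valued random variable independent of an i.i.d. sequence $(S_i)$. A mixed Poisson process based on a random variable $\delta\ge0$ and a locally finite $\mu$ is a point process that, conditionally on $\delta$, is Poisson with intensity measure $\delta\mu$. A graph process $\xi$ is boundedly exchangeable if it is directed by a mixed Poisson or mixed binomial process $\nu$ and, for every bounded Borel $B$ with $\mathbb{P}(\nu(B)=0)<1$, one has $\mathbb{P}(\nu(B)=n)>0$ for all $n\in\mathbb{N}$. For a matrix $X$, $X[n]=(X_{ij})_{i,j\le n}$. A random matrix $(X_{ij})_{i,j\ge1}$ is jointly exchangeable if for all $n$ and all permutations $\pi$ of $\{1,\dots,n\}$, $(X_{ij})_{i,j\le n}\overset{d}{=}(X_{\pi(i)\pi(j)})_{i,j\le n}$. *)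

theory Defs
  imports "HOL-Probability.Probability" "HOL-Combinatorics.Permutations"
begin

text \<open>
  Conventions. The state space is a type of class \<open>polish_space\<close>, and ``bounded'' refers to its
  metric. Point and matrix indices start at 0, so the indices \<open>i \<le> N\<close> of the usual 1-based notation
  become \<open>i < N\<close>. The mark space \<open>{0,1}\<close> is embedded in the reals: a measure on
  \<open>S\<^sup>2 \<times> {0,1}\<close> is a Borel measure on \<open>S \<times> S \<times> \<real>\<close> that does not charge the
  complement of \<open>S \<times> S \<times> {0,1}\<close>.
\<close>


section \<open>Simple measures and adjacency measures\<close>

definition locally_finite :: "'b::metric_space measure \<Rightarrow> bool" where
  "locally_finite \<mu> \<longleftrightarrow> sets \<mu> = sets borel \<and>
     (\<forall>B\<in>sets borel. bounded B \<longrightarrow> emeasure \<mu> B < \<infinity>)"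

text \<open>
  The sum of the unit point masses at \<open>f i\<close>, \<open>i \<in> I\<close> (with multiplicity), as the image of counting
  measure on \<open>I\<close>; every \<open>f\<close> is measurable on \<open>count_space I\<close>.
\<close>

definition point_sum :: "'i set \<Rightarrow> ('i \<Rightarrow> 'b::topological_space) \<Rightarrow> 'b measure" where
  "point_sum I f = distr (count_space I) borel f"

definition simple_measure :: "'b::metric_space measure \<Rightarrow> bool" where
  "simple_measure \<mu> \<longleftrightarrow> locally_finite \<mu> \<and> (\<exists>D. countable D \<and> \<mu> = point_sum D (\<lambda>x. x))"

definition adjacency_directed_by ::
    "('a::polish_space \<times> 'a \<times> real) measure \<Rightarrow> 'a measure \<Rightarrow> bool" where
  "adjacency_directed_by \<xi> \<nu> \<longleftrightarrow>
     simple_measure \<xi> \<and> emeasure \<xi> (- (UNIV \<times> UNIV \<times> {0, 1})) = 0 \<and>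
     simple_measure \<nu> \<and>
     (\<forall>C\<in>sets (borel :: ('a \<times> 'a) measure).
        emeasure \<xi> {(x, y, a). (x, y) \<in> C \<and> a \<in> {0, 1}} = emeasure (\<nu> \<Otimes>\<^sub>M \<nu>) C) \<and>
     distr \<xi> borel (\<lambda>(x, y, a). (y, x, a)) = \<xi>"

definition adjacency_measure :: "('a::polish_space \<times> 'a \<times> real) measure \<Rightarrow> bool" where
  "adjacency_measure \<xi> \<longleftrightarrow> (\<exists>\<nu>. adjacency_directed_by \<xi> \<nu>)"

definition adjacency_restrict ::
    "('a::polish_space \<times> 'a \<times> real) measure \<Rightarrow> 'a set \<Rightarrow> ('a \<times> 'a \<times> real) measure" where
  "adjacency_restrict \<xi> B = density \<xi> (indicator (B \<times> B \<times> UNIV))"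


section \<open>Random measures\<close>

text \<open>
  The space of all measures on \<open>K\<close> with the \<open>\<sigma>\<close>-algebra generated by the evaluations
  \<open>\<mu> \<mapsto> \<mu>(A)\<close>, as for \<^const>\<open>subprob_algebra\<close>. The law of a random measure \<open>\<xi>\<close> is
  \<open>distr M (measure_algebra K) \<xi>\<close>.
\<close>

definition measure_algebra :: "'b measure \<Rightarrow> 'b measure measure" where
  "measure_algebra K =
     (SUP A \<in> sets K. vimage_algebra {\<mu>. sets \<mu> = sets K} (\<lambda>\<mu>. emeasure \<mu> A) borel)"

definition random_adjacency_measure ::
    "'w measure \<Rightarrow> ('w \<Rightarrow> ('a::polish_space \<times> 'a \<times> real) measure) \<Rightarrow> bool" where
  "random_adjacency_measure M \<xi> \<longleftrightarrow>
     \<xi> \<in> M \<rightarrow>\<^sub>M measure_algebra borel \<and> (AE \<omega> in M. adjacency_measure (\<xi> \<omega>))"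

definition iid :: "'w measure \<Rightarrow> 'b measure \<Rightarrow> ('w \<Rightarrow> nat \<Rightarrow> 'b) \<Rightarrow> bool" where
  "iid M \<mu> X \<longleftrightarrow> prob_space.indep_vars M (\<lambda>_. \<mu>) (\<lambda>k \<omega>. X \<omega> k) UNIV \<and>
     (\<forall>k. distr M \<mu> (\<lambda>\<omega>. X \<omega> k) = \<mu>)"

text \<open>The library's \<open>indep_var\<close> requires both variables to have the same type.\<close>

definition independent ::
    "'w measure \<Rightarrow> 'b measure \<Rightarrow> ('w \<Rightarrow> 'b) \<Rightarrow> 'c measure \<Rightarrow> ('w \<Rightarrow> 'c) \<Rightarrow> bool" where
  "independent M K X L Y \<longleftrightarrow> X \<in> M \<rightarrow>\<^sub>M K \<and> Y \<in> M \<rightarrow>\<^sub>M L \<and>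
     prob_space.indep_set M (sets (vimage_algebra (space M) X K)) (sets (vimage_algebra (space M) Y L))"

text \<open>
  The probability space carries additional randomization variables: an i.i.d. sequence of
  uniform variables on the unit interval that is independent of the random measure \<open>\<xi>\<close>.
\<close>

definition supports_uniforms :: "'w measure \<Rightarrow> ('w \<Rightarrow> 'b::topological_space measure) \<Rightarrow> bool" where
  "supports_uniforms M \<xi> \<longleftrightarrow>
     (\<exists>U. iid M (uniform_measure lborel {0..1::real}) U \<and>
          independent M (measure_algebra borel) \<xi> (\<Pi>\<^sub>M k\<in>UNIV. borel) U)"


section \<open>Representations and graph processes\<close>

abbreviation indices :: "enat \<Rightarrow> nat set" where
  "indices N \<equiv> {k. enat k < N}"

text \<open>
  The points \<open>S\<close> and the matrix \<open>A\<close> are total, but their entries outside \<open>indices N\<close> are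
  arbitrary: only the points and entries with index below \<open>N\<close> belong to the representation.
\<close>

definition representation ::
    "'w measure \<Rightarrow> ('w \<Rightarrow> ('a::polish_space \<times> 'a \<times> real) measure) \<Rightarrow>
     ('w \<Rightarrow> enat) \<Rightarrow> ('w \<Rightarrow> nat \<Rightarrow> 'a) \<Rightarrow> ('w \<Rightarrow> nat \<times> nat \<Rightarrow> real) \<Rightarrow> bool" where
  "representation M \<xi> N S A \<longleftrightarrow>
     N \<in> M \<rightarrow>\<^sub>M count_space UNIV \<and>
     S \<in> M \<rightarrow>\<^sub>M (\<Pi>\<^sub>M k\<in>UNIV. borel) \<and>
     A \<in> M \<rightarrow>\<^sub>M (\<Pi>\<^sub>M p\<in>UNIV. borel) \<and>
     (AE \<omega> in M.
        inj_on (S \<omega>) (indices (N \<omega>)) \<and>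
        (\<forall>i\<in>indices (N \<omega>). \<forall>j\<in>indices (N \<omega>).
           A \<omega> (i, j) \<in> {0, 1} \<and> A \<omega> (j, i) = A \<omega> (i, j)) \<and>
        \<xi> \<omega> = point_sum (indices (N \<omega>) \<times> indices (N \<omega>)) (\<lambda>(i, j). (S \<omega> i, S \<omega> j, A \<omega> (i, j))))"

definition connection_kernel :: "('a::polish_space \<Rightarrow> 'a \<Rightarrow> real) \<Rightarrow> bool" where
  "connection_kernel W \<longleftrightarrow>
     (\<lambda>(x, y). W x y) \<in> borel_measurable borel \<and>
     (\<forall>x y. W x y \<in> {0..1}) \<and> (\<forall>x y. W x y = W y x)"

text \<open>The \<open>\<sigma>\<close>-algebra generated by \<open>N\<close> and \<open>(S\<^sub>k)\<^sub>k\<^sub><\<^sub>N\<close>; entries of \<open>S\<close> with index \<open>\<ge> N\<close> do not contribute.\<close>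

definition points_algebra ::
    "'w measure \<Rightarrow> ('w \<Rightarrow> enat) \<Rightarrow> ('w \<Rightarrow> nat \<Rightarrow> 'a::polish_space) \<Rightarrow> 'w measure" where
  "points_algebra M N S = sigma (space M)
     (range (\<lambda>n. {\<omega>\<in>space M. N \<omega> = n}) \<union>
      {{\<omega>\<in>space M. enat k < N \<omega> \<and> S \<omega> k \<in> C} | k C. C \<in> sets borel})"

text \<open>
  The conditional joint law of the edges \<open>A\<^sub>i\<^sub>j\<close>, \<open>i < j\<close>, given the points is specified through
  the conditional probability, on \<open>m \<le> N\<close>, of each 0-1 pattern \<open>a\<close> of the pairs \<open>i < j < m\<close>,
  for all finite \<open>m\<close>, which also covers the event \<open>N = \<infinity>\<close>. Symmetry of \<open>A\<close> is part of
  \<open>representation\<close>.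
\<close>

definition graph_representation ::
    "'w measure \<Rightarrow> ('a::polish_space \<Rightarrow> 'a \<Rightarrow> real) \<Rightarrow>
     ('w \<Rightarrow> ('a \<times> 'a \<times> real) measure) \<Rightarrow>
     ('w \<Rightarrow> enat) \<Rightarrow> ('w \<Rightarrow> nat \<Rightarrow> 'a) \<Rightarrow> ('w \<Rightarrow> nat \<times> nat \<Rightarrow> real) \<Rightarrow> bool" where
  "graph_representation M W \<xi> N S A \<longleftrightarrow>
     representation M \<xi> N S A \<and>
     (AE \<omega> in M. \<forall>i\<in>indices (N \<omega>). A \<omega> (i, i) = 0) \<and>
     (\<forall>m a. AE \<omega> in M.
        real_cond_exp M (points_algebra M N S)
          (indicator {\<omega>\<in>space M. enat m \<le> N \<omega> \<and> (\<forall>j<m. \<forall>i<j. A \<omega> (i, j) = of_bool (a i j))}) \<omega>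
        = (if enat m \<le> N \<omega>
           then \<Prod>j<m. \<Prod>i<j. pmf (bernoulli_pmf (W (S \<omega> i) (S \<omega> j))) (a i j)
           else 0))"

definition graph_process ::
    "'w measure \<Rightarrow> ('w \<Rightarrow> ('a::polish_space \<times> 'a \<times> real) measure) \<Rightarrow> bool" where
  "graph_process M \<xi> \<longleftrightarrow> random_adjacency_measure M \<xi> \<and>
     (\<exists>W N S A. connection_kernel W \<and> graph_representation M W \<xi> N S A)"

definition iid_representation ::
    "'w measure \<Rightarrow> ('w \<Rightarrow> ('a::polish_space \<times> 'a \<times> real) measure) \<Rightarrow>
     ('w \<Rightarrow> enat) \<Rightarrow> ('w \<Rightarrow> nat \<Rightarrow> 'a) \<Rightarrow> ('w \<Rightarrow> nat \<times> nat \<Rightarrow> real) \<Rightarrow> bool" where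
  "iid_representation M \<xi> N S A \<longleftrightarrow>
     (\<exists>W. connection_kernel W \<and> graph_representation M W \<xi> N S A) \<and>
     (\<exists>\<mu>. prob_space \<mu> \<and> sets \<mu> = sets borel \<and> iid M \<mu> S) \<and>
     independent M (count_space UNIV) N (\<Pi>\<^sub>M k\<in>UNIV. borel) S"


section \<open>Mixed binomial and mixed Poisson processes\<close>

text \<open>
  Equality in law with \<open>\<Sum>\<^sub>i\<^sub><\<^sub>N \<delta>(S\<^sub>i)\<close>, where the pair of \<open>N\<close> and \<open>(S\<^sub>i)\<close> is realized on its
  canonical product space.
\<close>

definition mixed_binomial :: "'w measure \<Rightarrow> ('w \<Rightarrow> 'a::polish_space measure) \<Rightarrow> bool" where
  "mixed_binomial M \<nu> \<longleftrightarrow>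
     \<nu> \<in> M \<rightarrow>\<^sub>M measure_algebra borel \<and>
     (\<exists>(p :: nat pmf) \<mu>. prob_space \<mu> \<and> sets \<mu> = sets borel \<and>
        distr M (measure_algebra borel) \<nu> =
        distr (measure_pmf p \<Otimes>\<^sub>M (\<Pi>\<^sub>M i\<in>UNIV. \<mu>)) (measure_algebra borel)
          (\<lambda>(n, s). point_sum {..<n} s))"

text \<open>Unlike \<^const>\<open>poisson_pmf\<close>, this allows the rate to be 0.\<close>

definition poisson_prob :: "real \<Rightarrow> nat \<Rightarrow> real" where
  "poisson_prob r n = r ^ n / fact n * exp (- r)"

definition mixed_poisson :: "'w measure \<Rightarrow> ('w \<Rightarrow> 'a::polish_space measure) \<Rightarrow> bool" where
  "mixed_poisson M \<nu> \<longleftrightarrow>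
     \<nu> \<in> M \<rightarrow>\<^sub>M measure_algebra borel \<and>
     (\<exists>\<delta> \<mu>. \<delta> \<in> borel_measurable M \<and> (AE \<omega> in M. \<delta> \<omega> \<ge> 0) \<and> locally_finite \<mu> \<and>
        (\<forall>(k::nat) B n.
           (\<forall>i<k. B i \<in> sets borel \<and> bounded (B i)) \<and> disjoint_family_on B {..<k} \<longrightarrow>
           (AE \<omega> in M.
              real_cond_exp M (vimage_algebra (space M) \<delta> borel)
                (indicator {\<omega>\<in>space M. \<forall>i<k. emeasure (\<nu> \<omega>) (B i) = of_nat (n i)}) \<omega>
              = (\<Prod>i<k. poisson_prob (\<delta> \<omega> * measure \<mu> (B i)) (n i)))))"

definition boundedly_exchangeable ::
    "'w measure \<Rightarrow> ('w \<Rightarrow> ('a::polish_space \<times> 'a \<times> real) measure) \<Rightarrow> ('w \<Rightarrow> 'a measure) \<Rightarrow> bool" where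
  "boundedly_exchangeable M \<xi> \<nu> \<longleftrightarrow>
     (AE \<omega> in M. adjacency_directed_by (\<xi> \<omega>) (\<nu> \<omega>)) \<and>
     (mixed_poisson M \<nu> \<or> mixed_binomial M \<nu>) \<and>
     (\<forall>B\<in>sets borel. bounded B \<and> measure M {\<omega>\<in>space M. emeasure (\<nu> \<omega>) B = 0} < 1 \<longrightarrow>
        (\<forall>n\<ge>1. measure M {\<omega>\<in>space M. emeasure (\<nu> \<omega>) B = of_nat n} > 0))"


section \<open>Random matrices\<close>

abbreviation corner_space :: "nat \<Rightarrow> (nat \<times> nat \<Rightarrow> real) measure" where
  "corner_space n \<equiv> \<Pi>\<^sub>M p\<in>{..<n} \<times> {..<n}. borel"

definition corner :: "nat \<Rightarrow> (nat \<times> nat \<Rightarrow> real) \<Rightarrow> nat \<times> nat \<Rightarrow> real" where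
  "corner n x = restrict x ({..<n} \<times> {..<n})"

abbreviation random_matrix :: "'w measure \<Rightarrow> ('w \<Rightarrow> nat \<times> nat \<Rightarrow> real) \<Rightarrow> bool" where
  "random_matrix M X \<equiv> X \<in> M \<rightarrow>\<^sub>M (\<Pi>\<^sub>M p\<in>UNIV. borel)"

definition jointly_exchangeable :: "'w measure \<Rightarrow> ('w \<Rightarrow> nat \<times> nat \<Rightarrow> real) \<Rightarrow> bool" where
  "jointly_exchangeable M X \<longleftrightarrow>
     (\<forall>n \<pi>. \<pi> permutes {..<n} \<longrightarrow>
        distr M (corner_space n) (\<lambda>\<omega>. corner n (X \<omega>)) =
        distr M (corner_space n) (\<lambda>\<omega>. corner n (\<lambda>(i, j). X \<omega> (\<pi> i, \<pi> j))))"

text \<open>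
  \<open>X\<close> is an infinite jointly exchangeable matrix whose \<open>n\<close>-th corner has the conditional law of
  the adjacency matrix given \<open>N = n\<close>, for every i.i.d. representation. Conditioning on the event
  \<open>N = n\<close> is elementary; were it a null set, \<^const>\<open>uniform_measure\<close> would be the null
  measure and the equation would fail.
\<close>

definition exchangeable_adjacency_limit ::
    "'w measure \<Rightarrow> ('w \<Rightarrow> ('a::polish_space \<times> 'a \<times> real) measure) \<Rightarrow>
     ('w \<Rightarrow> nat \<times> nat \<Rightarrow> real) \<Rightarrow> bool" where
  "exchangeable_adjacency_limit M \<xi> X \<longleftrightarrow>
     random_matrix M X \<and> jointly_exchangeable M X \<and>
     (\<forall>N S A. iid_representation M \<xi> N S A \<longrightarrow>
        (\<forall>n\<ge>1. distr (uniform_measure M {\<omega>\<in>space M. N \<omega> = enat n}) (corner_space n) (\<lambda>\<omega>. corner n (A \<omega>))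
               = distr M (corner_space n) (\<lambda>\<omega>. corner n (X \<omega>))))"

end

theory Submission
  imports Defs
begin

text \<open>
  Everything rests on one i.i.d. representation \<open>(N, S, A)\<close> of \<open>\<xi>|\<^sub>B\<close> for which \<open>N = n\<close> has positive
  probability for every \<open>n \<ge> 1\<close>.

  Given such a representation, with point law \<open>\<mu>\<close> and kernel \<open>W\<close>, put \<open>X\<^sub>i\<^sub>j = 1\<close> if \<open>i \<noteq> j\<close> and
  \<open>Z\<^sub>i\<^sub>j < W(V\<^sub>i, V\<^sub>j)\<close>, and \<open>X\<^sub>i\<^sub>j = 0\<close> otherwise, for i.i.d. points \<open>V\<^sub>i\<close> of law \<open>\<mu>\<close> and independent
  uniform variables \<open>Z\<^sub>i\<^sub>j = Z\<^sub>j\<^sub>i\<close>. This matrix is jointly exchangeable, and given \<open>N = n\<close> the matrix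
  \<open>A\<close> has the law of the corner \<open>X[n]\<close>, since \<open>N\<close> is independent of \<open>S\<close>. It is unique in law because
  the corners determine the law of an infinite matrix (\<open>distr_eq_if_corners_eq\<close>).

  The same \<open>X\<close> serves every other i.i.d. representation, although that one may use another kernel
  and another point law. Two representations of one measure differ, outcome by outcome, by a
  relabelling of the points only (\<open>AE_representations_isomorphic\<close>). Given \<open>N = n\<close>, the adjacency matrix
  of an i.i.d. representation is exchangeable, so \<open>n!\<close> times the probability of an edge pattern is
  the expected number of relabellings that show this pattern, and this number is the same for both
  representations (\<open>iid_representations_same_law\<close>).

  An i.i.d. representation of \<open>\<xi>|\<^sub>B\<close> results from listing the points in \<open>B\<close> in uniformly random order.
  For a partition of \<open>B\<close> into \<open>D\<^sub>0, \<dots>, D\<^sub>k\<^sub>-\<^sub>1\<close> and a colouring \<open>c\<close> of \<open>{0, \<dots>, n - 1}\<close> that uses the colour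
  \<open>j\<close> exactly \<open>n\<^sub>j\<close> times, mixed Poisson and mixed binomial processes satisfy
  \<open>\<Prod>\<^sub>j n\<^sub>j! \<cdot> P(\<nu>(D\<^sub>j) = n\<^sub>j for all j) = K\<^sub>n \<cdot> \<Prod>\<^sub>i \<mu>(D\<^bsub>c(i)\<^esub>)\<close>
  with \<open>K\<^sub>n\<close> independent of the partition and of \<open>c\<close> (\<open>colour_counts\<close>). The left-hand side is the
  expected number of orders in which the point at position \<open>i\<close> has colour \<open>c(i)\<close>, because \<open>\<Prod>\<^sub>j n\<^sub>j!\<close>
  is the number of bijections that match the colours (\<open>card_colour_bijections\<close>). So in random order the
  points are i.i.d. given their number, with a law that does not depend on the number
  (\<open>ordered_points_law\<close>, \<open>points_law\<close>).

  One point needs care: the additional uniform variables are independent of the random measure \<open>\<xi>\<close>,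
  not of the representation that comes with the graph process. The random order must therefore
  act on an enumeration of the points that is a measurable function of \<open>\<xi>\<close> alone. A Borel injection
  of the Polish space into the reals (\<open>borel_real_code\<close>) yields one, namely the points in \<open>B\<close> in
  increasing order of their codes. The enumeration is determined by the points, so the edges
  keep their conditional law when they are listed along it (\<open>sorted_representation_pattern\<close>).
\<close>


section \<open>Colour-preserving bijections\<close>

text \<open>
  Extensional functions, so that two members are equal iff they agree on \<open>I\<close> and the set of all of
  them is finite.
\<close>

definition bijections :: "'i set \<Rightarrow> 'j set \<Rightarrow> ('i \<Rightarrow> 'j) set" where
  "bijections I J = {f \<in> I \<rightarrow>\<^sub>E J. bij_betw f I J}"

lemma finite_bijections: "finite I \<Longrightarrow> finite J \<Longrightarrow> finite (bijections I J)"
  unfolding bijections_def by (rule finite_subset[of _ "I \<rightarrow>\<^sub>E J"]) (auto intro: finite_PiE)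

lemma bijections_insert:
  assumes "x \<notin> I"
  shows "bijections (insert x I) J = (\<Union>y\<in>J. (\<lambda>f. f(x := y)) ` bijections I (J - {y}))"
proof (intro equalityI subsetI)
  fix f assume f: "f \<in> bijections (insert x I) J"
  then have b: "bij_betw f (insert x I) J" and e: "f \<in> extensional (insert x I)"
    by (auto simp: bijections_def PiE_def)
  from b have y: "f x \<in> J" by (auto simp: bij_betw_def)
  have "bij_betw f I (J - {f x})"
    using b assms unfolding bij_betw_def by (auto simp: inj_on_def)
  then have "bij_betw (f(x := undefined)) I (J - {f x})"
    using assms by (subst bij_betw_cong[of _ _ f]) auto
  then have "f(x := undefined) \<in> bijections I (J - {f x})"
    using e bij_betwE[OF \<open>bij_betw (f(x := undefined)) I (J - {f x})\<close>]
    unfolding bijections_def PiE_def extensional_def Pi_def by (simp del: fun_upd_apply) simp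
  moreover have "f = (f(x := undefined))(x := f x)" by auto
  ultimately show "f \<in> (\<Union>y\<in>J. (\<lambda>f. f(x := y)) ` bijections I (J - {y}))"
    using y by blast
next
  fix f assume "f \<in> (\<Union>y\<in>J. (\<lambda>f. f(x := y)) ` bijections I (J - {y}))"
  then obtain y g where y: "y \<in> J" and g: "g \<in> bijections I (J - {y})" and f: "f = g(x := y)"
    by auto
  from g have b: "bij_betw g I (J - {y})" and e: "g \<in> extensional I"
    by (auto simp: bijections_def PiE_def)
  from b have "bij_betw (g(x := y)) I (J - {y})"
    using assms by (subst bij_betw_cong[of _ _ g]) auto
  then have "bij_betw (g(x := y)) (insert x I) J"
    using assms y notIn_Un_bij_betw[of x I "g(x := y)" "J - {y}"] by (simp add: insert_absorb)
  moreover from this have "g(x := y) \<in> insert x I \<rightarrow> J" by (rule bij_betw_imp_funcset)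
  ultimately show "f \<in> bijections (insert x I) J"
    using e unfolding f bijections_def PiE_def extensional_def by auto
qed

lemma card_fibre_insert:
  assumes "finite I" "x \<notin> I"
  shows "card {i\<in>insert x I. c i = k} = card {i\<in>I. c i = k} + of_bool (c x = k)"
proof -
  have "{i\<in>insert x I. c i = k} = (if c x = k then insert x {i\<in>I. c i = k} else {i\<in>I. c i = k})"
    by auto
  then show ?thesis using assms by simp
qed

lemma card_fibre_remove:
  assumes "finite J" "y \<in> J"
  shows "card {j\<in>J. d j = k} = card {j\<in>J - {y}. d j = k} + of_bool (d y = k)"
  using card_fibre_insert[of "J - {y}" y d k] assms by (simp add: insert_absorb)

text \<open>
  The points of each colour are matched among themselves, in \<open>n\<^sub>k!\<close> ways for the colour \<open>k\<close>. Removing one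
  point \<open>x\<close> and its partner, which has the colour of \<open>x\<close>, gives an induction on \<open>I\<close>.
\<close>

lemma card_colour_bijections:
  assumes "finite I" "finite J" "finite K" "c ` I \<subseteq> K"
  shows "card {f \<in> bijections I J. \<forall>i\<in>I. d (f i) = c i} =
    (if \<forall>k. card {i\<in>I. c i = k} = card {j\<in>J. d j = k}
     then \<Prod>k\<in>K. fact (card {i\<in>I. c i = k}) else 0)"
  using assms(1,2,4)
proof (induction I arbitrary: J rule: finite_induct)
  case empty
  have *: "bijections {} J = (if J = {} then {\<lambda>_. undefined} else {})"
    by (auto simp: bijections_def bij_betw_def)
  have "(\<forall>k. card {j\<in>J. d j = k} = 0) \<longleftrightarrow> J = {}"
    using empty by auto
  then show ?case by (auto simp: *)
next
  case (insert x I)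
  let ?F = "\<lambda>I J. {f \<in> bijections I J. \<forall>i\<in>I. d (f i) = c i}"
  let ?n = "\<lambda>k. card {i\<in>I. c i = k}"
  let ?ok = "\<lambda>I J. \<forall>k. card {i\<in>I. c i = k} = card {j\<in>J. d j = k}"
  let ?Y = "{y\<in>J. d y = c x}"
  have split: "?F (insert x I) J = (\<Union>y\<in>?Y. (\<lambda>f. f(x := y)) ` ?F I (J - {y}))"
    unfolding bijections_insert[OF insert.hyps(2)] using insert.hyps(2)
    by (auto simp: image_iff split: if_splits intro!: bexI) (metis fun_upd_other)
  have inj: "inj_on (\<lambda>f. f(x := y)) (?F I (J - {y}))" for y
  proof (rule inj_onI)
    fix f g assume f: "f \<in> ?F I (J - {y})" "g \<in> ?F I (J - {y})" "f(x := y) = g(x := y)"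
    have "f x = g x"
      using f(1,2) insert.hyps(2) by (auto simp: bijections_def PiE_def extensional_def)
    then show "f = g" using f(3) by (metis fun_upd_triv fun_upd_upd)
  qed
  have fin: "finite (?F I (J - {y}))" for y
    using finite_bijections[of I "J - {y}"] insert by auto
  have "card (?F (insert x I) J) = (\<Sum>y\<in>?Y. card (?F I (J - {y})))"
    unfolding split
  proof (subst card_UN_disjoint)
    show "\<forall>y\<in>?Y. \<forall>z\<in>?Y. y \<noteq> z \<longrightarrow>
      (\<lambda>f. f(x := y)) ` ?F I (J - {y}) \<inter> (\<lambda>f. f(x := z)) ` ?F I (J - {z}) = {}"
      by (auto dest!: fun_cong[of _ _ x])
  qed (use insert fin inj in \<open>auto simp: card_image\<close>)
  also have "\<dots> = (\<Sum>y\<in>?Y. if ?ok (insert x I) J then \<Prod>k\<in>K. fact (?n k) else 0)"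
  proof (intro sum.cong refl)
    fix y assume y: "y \<in> ?Y"
    have "?ok I (J - {y}) \<longleftrightarrow> ?ok (insert x I) J"
      using y card_fibre_remove[of J y d] insert.prems card_fibre_insert[OF insert.hyps(1,2), of c]
      by auto
    then show "card (?F I (J - {y})) = (if ?ok (insert x I) J then \<Prod>k\<in>K. fact (?n k) else 0)"
      using insert by simp
  qed
  also have "\<dots> = (if ?ok (insert x I) J then card ?Y * (\<Prod>k\<in>K. fact (?n k)) else 0)"
    by simp
  also have "\<dots> = (if ?ok (insert x I) J
      then \<Prod>k\<in>K. fact (card {i\<in>insert x I. c i = k}) else 0)"
  proof -
    have cx: "c x \<in> K" using insert.prems by auto
    have "card ?Y * (\<Prod>k\<in>K. fact (?n k)) = (\<Prod>k\<in>K. fact (card {i\<in>insert x I. c i = k}))"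
      if "?ok (insert x I) J"
    proof -
      have "card ?Y = Suc (?n (c x))"
        using that[rule_format, of "c x"] card_fibre_insert[OF insert.hyps(1,2), of c "c x"] by simp
      moreover have "(\<Prod>k\<in>K - {c x}. fact (?n k)) =
          (\<Prod>k\<in>K - {c x}. (fact (card {i\<in>insert x I. c i = k}) :: nat))"
        using card_fibre_insert[OF insert.hyps(1,2), of c] by (intro prod.cong) auto
      ultimately show ?thesis
        using card_fibre_insert[OF insert.hyps(1,2), of c "c x"] cx \<open>finite K\<close>
        by (simp add: prod.remove[of K "c x"] algebra_simps)
    qed
    then show ?thesis by simp
  qed
  finally show ?case .
qed

lemma bijections_nonempty: "bijections {..<n} {..<n::nat} \<noteq> {}"
proof -
  have "restrict id {..<n} \<in> bijections {..<n} {..<n}"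
    by (auto simp: bijections_def bij_betw_def inj_on_def)
  then show ?thesis by blast
qed


section \<open>Borel coding of a Polish space by real numbers\<close>

text \<open>
  Digit number \<open>i\<close> after the point in base 4. Only the digits 0 and 1 are used for coding, so that a
  tail of an expansion contributes less than one unit of the preceding digit and an expansion is
  decoded without ambiguity.
\<close>

definition digit :: "nat \<Rightarrow> real \<Rightarrow> int" where
  "digit i r = \<lfloor>4 ^ Suc i * r\<rfloor> mod 4"

lemma digit_measurable [measurable]: "digit i \<in> borel \<rightarrow>\<^sub>M count_space UNIV"
  unfolding digit_def by measurable

lemma digit_of_expansion:
  assumes b: "\<And>i. b i \<in> {0, 1::nat}"
  shows "summable (\<lambda>i. real (b i) / 4 ^ Suc i)"
    and "digit i (\<Sum>k. real (b k) / 4 ^ Suc k) = int (b i)"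
proof -
  have geo: "(\<lambda>k. (1/4) ^ Suc k :: real) sums (1/3)"
    using sums_mult[OF geometric_sums[of "1/4 :: real"], of "1/4"] by simp
  have le: "real (b k) / 4 ^ Suc k \<le> (1/4) ^ Suc k" "0 \<le> real (b k) / 4 ^ Suc k" for k
    using b[of k] by (auto simp: field_simps)
  show S: "summable (\<lambda>i. real (b i) / 4 ^ Suc i)"
    by (rule summable_comparison_test'[OF sums_summable[OF geo], of 0]) (use le in auto)
  let ?f = "\<lambda>k. real (b k) / 4 ^ Suc k"
  define t where "t = (\<Sum>k. real (b (k + Suc i)) / 4 ^ Suc k)"
  have le': "real (b (k + Suc i)) / 4 ^ Suc k \<le> (1/4) ^ Suc k" "0 \<le> real (b (k + Suc i)) / 4 ^ Suc k" for k
    using b[of "k + Suc i"] by (auto simp: field_simps)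
  have S': "summable (\<lambda>k. real (b (k + Suc i)) / 4 ^ Suc k)"
    by (rule summable_comparison_test'[OF sums_summable[OF geo], of 0])
       (use le' in auto)
  have t: "0 \<le> t" "t < 1"
  proof -
    show "0 \<le> t" unfolding t_def by (intro suminf_nonneg S') auto
    have "t \<le> (\<Sum>k. (1/4) ^ Suc k)" unfolding t_def
      by (intro suminf_le S' le' sums_summable[OF geo])
    then show "t < 1" using sums_unique[OF geo] by simp
  qed
  have "(\<Sum>k. ?f k) = (\<Sum>k. ?f (k + Suc i)) + (\<Sum>k<Suc i. ?f k)"
    by (rule suminf_split_initial_segment[OF S])
  also have "(\<Sum>k. ?f (k + Suc i)) = t / 4 ^ Suc i"
    unfolding t_def by (subst suminf_divide[OF S', symmetric]) (simp add: power_add mult_ac)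
  (* multiplied by \<open>4 ^ Suc i\<close>, the expansion is the tail \<open>t \<in> [0, 1)\<close> plus an integer that is
     congruent to \<open>b i\<close> modulo 4 *)
  finally have "4 ^ Suc i * (\<Sum>k. ?f k) = t + (\<Sum>k<Suc i. 4 ^ Suc i * ?f k)"
    by (simp add: distrib_left sum_distrib_left)
  also have "(\<Sum>k<Suc i. 4 ^ Suc i * ?f k) = (\<Sum>k<Suc i. real_of_int (int (b k) * 4 ^ (i - k)))"
  proof (intro sum.cong refl)
    fix k assume "k \<in> {..<Suc i}"
    then have "(4::real) ^ Suc i = 4 ^ (i - k) * 4 ^ Suc k" by (simp flip: power_add)
    then show "4 ^ Suc i * ?f k = real_of_int (int (b k) * 4 ^ (i - k))" by simp
  qed
  also have "\<dots> = real_of_int (\<Sum>k<Suc i. int (b k) * 4 ^ (i - k))"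
    by simp
  finally have "\<lfloor>4 ^ Suc i * (\<Sum>k. ?f k)\<rfloor> = (\<Sum>k<Suc i. int (b k) * 4 ^ (i - k))"
    using t by (simp only:) linarith
  also have "\<dots> = (\<Sum>k<i. int (b k) * 4 ^ (i - k)) + int (b i)" by simp
  also have "4 dvd (\<Sum>k<i. int (b k) * 4 ^ (i - k))"
    by (intro dvd_sum dvd_mult) (auto simp: dvd_power)
  then have "((\<Sum>k<i. int (b k) * 4 ^ (i - k)) + int (b i)) mod 4 = int (b i) mod 4"
    by (metis add.commute mod_add_right_eq add.right_neutral dvd_eq_mod_eq_0)
  also have "\<dots> = int (b i)" using b[of i] by auto
  finally show "digit i (\<Sum>k. ?f k) = int (b i)" unfolding digit_def .
qed

text \<open>
  A point \<open>x\<close> is determined by the sequence of the first members of a countable dense set within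
  distance \<open>1 / 2 ^ m\<close> of \<open>x\<close>. These indices depend measurably on \<open>x\<close>; written in unary, they form a
  0-1 sequence, which is packed into the digits of a real number. Decoding reads the indices off the
  digits and takes the limit, which exists in a complete space when the approximations are Cauchy.
\<close>

lemma borel_real_code:
  obtains e :: "'a::polish_space \<Rightarrow> real" and d :: "real \<Rightarrow> 'a"
  where "e \<in> borel_measurable borel" "d \<in> borel_measurable borel" "\<And>x. d (e x) = x"
proof -
  obtain D :: "'a set" where D: "countable D" "\<And>X. open X \<Longrightarrow> X \<noteq> {} \<Longrightarrow> \<exists>d\<in>D. d \<in> X"
    by (rule countable_dense_setE) blast
  then have "D \<noteq> {}" using D(2)[of UNIV] by auto
  define q where "q = from_nat_into D"
  have q: "\<exists>k. dist x (q k) < 1 / 2 ^ m" for x m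
  proof -
    have "\<exists>y\<in>D. y \<in> ball x (1 / 2 ^ m)" by (rule D(2)) (auto simp: not_le)
    then obtain y where "y \<in> D" "y \<in> ball x (1 / 2 ^ m)" by blast
    then show ?thesis
      using from_nat_into_surj[OF D(1), of y] unfolding q_def by auto
  qed
  define near where "near m x = (LEAST k. dist x (q k) < 1 / 2 ^ m)" for m x
  have near: "dist x (q (near m x)) < 1 / 2 ^ m" for m x
    unfolding near_def by (rule LeastI_ex[OF q])
  have [measurable]: "near m \<in> borel \<rightarrow>\<^sub>M count_space UNIV" for m
    unfolding near_def by measurable
  define bit :: "nat \<Rightarrow> 'a \<Rightarrow> nat" where
    "bit i x = (case prod_decode i of (m, k) \<Rightarrow> of_bool (near m x = k))" for i x
  have [measurable]: "(\<lambda>x. real (bit i x)) \<in> borel_measurable borel" for i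
    unfolding bit_def by (cases "prod_decode i") (simp add: of_bool_def)
  have bit: "bit i x \<in> {0, 1}" for i x
    unfolding bit_def by (cases "prod_decode i") auto
  define e where "e x = (\<Sum>i. real (bit i x) / 4 ^ Suc i)" for x
  (* the approximation of order \<open>m\<close> that is encoded in \<open>r\<close>; on reals that are no codes, \<open>app\<close> may
     fail to converge, and \<open>d\<close> takes an arbitrary value *)
  define app where "app m r = q (LEAST k. digit (prod_encode (m, k)) r = 1)" for m r
  define d where "d r = (if Cauchy (\<lambda>m. app m r) then lim (\<lambda>m. app m r) else q 0)" for r
  have e[measurable]: "e \<in> borel_measurable borel" unfolding e_def by measurable
  have [measurable]: "app m \<in> borel_measurable borel" for m
  proof -
    have "(\<lambda>r. LEAST k. digit (prod_encode (m, k)) r = 1) \<in> borel \<rightarrow>\<^sub>M count_space UNIV"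
      by measurable
    then show ?thesis unfolding app_def by (rule measurable_compose) simp
  qed
  have d: "d \<in> borel_measurable borel"
  proof (rule borel_measurable_LIMSEQ_metric)
    show "(\<lambda>r. if Cauchy (\<lambda>m. app m r) then app i r else q 0) \<in> borel_measurable borel" for i
      by (rule measurable_If) (auto simp: pred_def intro: sets_Collect_Cauchy)
    show "(\<lambda>i. if Cauchy (\<lambda>m. app m r) then app i r else q 0) \<longlonglongrightarrow> d r" for r
    proof (cases "Cauchy (\<lambda>m. app m r)")
      case True
      then have "(\<lambda>m. app m r) \<longlonglongrightarrow> lim (\<lambda>m. app m r)"
        by (simp add: Cauchy_convergent_iff convergent_LIMSEQ_iff)
      with True show ?thesis by (simp add: d_def)
    qed (simp add: d_def)
  qed
  have "d (e x) = x" for x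
  proof -
    have "digit (prod_encode (m, k)) (e x) = int (of_bool (near m x = k))" for m k
      using digit_of_expansion(2)[of "\<lambda>i. bit i x" "prod_encode (m, k)"] bit
      by (simp add: e_def) (simp add: bit_def)
    then have "app m (e x) = q (near m x)" for m
      unfolding app_def by (auto intro!: arg_cong[where f = q] Least_equality split: if_splits)
    moreover have "(\<lambda>m. q (near m x)) \<longlonglongrightarrow> x"
    proof (rule metric_LIMSEQ_I)
      fix r :: real assume "0 < r"
      then obtain N where N: "1 / 2 ^ N < r"
        using real_arch_pow_inv[of r "1/2"] by (auto simp: power_one_over)
      have "dist (q (near m x)) x < r" if "m \<ge> N" for m
      proof -
        have "(1::real) / 2 ^ m \<le> 1 / 2 ^ N" using that by (intro divide_left_mono) auto
        then show ?thesis using near[of x m] N by (simp add: dist_commute)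
      qed
      then show "\<exists>N. \<forall>m\<ge>N. dist (q (near m x)) x < r" by blast
    qed
    ultimately have "(\<lambda>m. app m (e x)) \<longlonglongrightarrow> x" by simp
    from LIMSEQ_imp_Cauchy[OF this] limI[OF this] show ?thesis unfolding d_def by simp
  qed
  with e d show ?thesis by (rule that)
qed


section \<open>Randomization by uniform variables\<close>

abbreviation unif :: "real measure" where
  "unif \<equiv> uniform_measure lborel {0..1}"

lemma prob_space_unif: "prob_space unif"
  by (rule prob_space_uniform_measure) auto

lemma emeasure_unif_less: "0 \<le> p \<Longrightarrow> p \<le> 1 \<Longrightarrow> emeasure unif {..<p} = ennreal p"
proof -
  assume p: "0 \<le> p" "p \<le> 1"
  have eq: "{0..1} \<inter> {..<p} = {0..<p}" using p by (intro set_eqI) (simp, linarith)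
  have "emeasure unif {..<p} = emeasure lborel ({0..1} \<inter> {..<p}) / emeasure lborel {0..1::real}"
    by (rule emeasure_uniform_measure) auto
  also have "\<dots> = ennreal p" unfolding eq using p by (simp add: divide_ennreal_def)
  finally show ?thesis .
qed

text \<open>
  On the real line the quantile function transports the uniform law; the Borel code reduces a Polish
  space to that case.
\<close>

lemma unif_quantile:
  fixes \<mu> :: "'a::polish_space measure"
  assumes "prob_space \<mu>" "sets \<mu> = sets borel"
  obtains f where "f \<in> borel_measurable borel" "distr unif borel f = \<mu>"
proof -
  obtain e :: "'a \<Rightarrow> real" and d where e: "e \<in> borel_measurable borel" and d[measurable]: "d \<in> borel_measurable borel"
    and de: "\<And>x. d (e x) = x" by (rule borel_real_code) blast
  have e'[measurable]: "e \<in> borel_measurable \<mu>" using e assms(2) by (simp cong: measurable_cong_sets)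
  interpret \<mu>: prob_space \<mu> by fact
  interpret real_distribution "distr \<mu> borel e"
    by (intro real_distribution.intro real_distribution_axioms.intro \<mu>.prob_space_distr) auto
  interpret Q: cdf_distribution "distr \<mu> borel e" by unfold_locales
  let ?\<Omega> = "restrict_space lborel {0<..<1::real}"
  (* the quantile function is defined on the open unit interval; the endpoints are null *)
  define g where "g x = (if x \<in> {0<..<1} then Q.I x else 0)" for x
  have g[measurable]: "g \<in> borel_measurable borel"
  proof -
    have "(\<lambda>x. if x \<in> {0<..<1::real} then Q.I x else 0) \<in> borel_measurable borel"
      by (subst measurable_If_restrict_space_iff) (use Q.measurable_CI in \<open>simp_all del: greaterThanLessThan_iff\<close>)
    then show ?thesis unfolding g_def .
  qed
  have "distr unif borel g = distr ?\<Omega> borel Q.I"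
  proof (rule measure_eqI)
    fix A assume "A \<in> sets (distr unif borel g)"
    then have A[measurable]: "A \<in> sets borel" by simp
    have QI: "Q.I \<in> borel_measurable ?\<Omega>"
      using Q.measurable_CI by (simp cong: measurable_cong_sets sets_restrict_space_cong)
    have "g -` A \<in> sets borel" using measurable_sets[OF g A] by simp
    then have "emeasure (distr unif borel g) A = emeasure lborel ({0..1} \<inter> (g -` A))"
      by (simp add: emeasure_distr divide_ennreal_def)
    also have "\<dots> = emeasure lborel ({0<..<1} \<inter> (g -` A))"
    proof (rule emeasure_eq_AE)
      show "AE x in lborel. (x \<in> {0..1} \<inter> g -` A) = (x \<in> {0<..<1} \<inter> g -` A)"
        using AE_lborel_singleton[of 0] AE_lborel_singleton[of 1] by eventually_elim auto
    qed auto
    also have "{0<..<1} \<inter> (g -` A) = Q.I -` A \<inter> {0<..<1}" by (auto simp: g_def)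
    also have "emeasure lborel \<dots> = emeasure (distr ?\<Omega> borel Q.I) A"
      using measurable_sets[OF QI A]
      by (simp add: emeasure_distr[OF QI] emeasure_restrict_space space_restrict_space)
    finally show "emeasure (distr unif borel g) A = emeasure (distr ?\<Omega> borel Q.I) A" .
  qed simp
  then have *: "distr unif borel g = distr \<mu> borel e" using Q.distr_I_eq_M by simp
  have "distr unif borel (\<lambda>u. d (g u)) = distr (distr unif borel g) borel d"
    by (subst distr_distr) (auto simp: comp_def)
  also have "\<dots> = distr \<mu> borel (\<lambda>x. x)"
    unfolding * by (subst distr_distr) (auto simp: comp_def de)
  also have "\<dots> = \<mu>" using assms(2) by (intro distr_id2) auto
  finally show ?thesis by (intro that[of "\<lambda>u. d (g u)"]) auto
qed


section \<open>Laws of random measures and of independent pairs\<close>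

lemma space_measure_algebra: "space (measure_algebra K) = {\<mu>. sets \<mu> = sets K}"
  unfolding measure_algebra_def by (subst space_Sup_eq_UN) (auto intro: sets.top)

lemma measurable_measure_algebra:
  "(\<And>\<omega>. \<omega> \<in> space M \<Longrightarrow> sets (f \<omega>) = sets K) \<Longrightarrow>
   (\<And>A. A \<in> sets K \<Longrightarrow> (\<lambda>\<omega>. emeasure (f \<omega>) A) \<in> borel_measurable M) \<Longrightarrow>
   f \<in> M \<rightarrow>\<^sub>M measure_algebra K"
  by (auto intro!: measurable_Sup2 measurable_vimage_algebra2 simp: measure_algebra_def)

lemma measurable_emeasure_measure_algebra [measurable]:
  "A \<in> sets K \<Longrightarrow> (\<lambda>\<mu>. emeasure \<mu> A) \<in> borel_measurable (measure_algebra K)"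
  by (auto intro!: measurable_Sup1 measurable_vimage_algebra1 simp: measure_algebra_def)

lemma distr_independent:
  assumes "prob_space M" "independent M K X L Y"
  shows "distr M (K \<Otimes>\<^sub>M L) (\<lambda>\<omega>. (X \<omega>, Y \<omega>)) = distr M K X \<Otimes>\<^sub>M distr M L Y"
proof -
  interpret prob_space M by fact
  have X[measurable]: "X \<in> M \<rightarrow>\<^sub>M K" and Y[measurable]: "Y \<in> M \<rightarrow>\<^sub>M L"
    and ind: "indep_set (sets (vimage_algebra (space M) X K)) (sets (vimage_algebra (space M) Y L))"
    using assms(2) by (auto simp: independent_def)
  interpret X: prob_space "distr M K X" by (rule prob_space_distr) fact
  interpret Y: prob_space "distr M L Y" by (rule prob_space_distr) fact
  show ?thesis
  proof (rule pair_measure_eqI[symmetric])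
    fix A B assume "A \<in> sets (distr M K X)" "B \<in> sets (distr M L Y)"
    then have A[measurable]: "A \<in> sets K" and B[measurable]: "B \<in> sets L" by auto
    have "prob ((X -` A \<inter> space M) \<inter> (Y -` B \<inter> space M)) =
        prob (X -` A \<inter> space M) * prob (Y -` B \<inter> space M)"
      by (rule indep_setD[OF ind]) (auto intro: in_vimage_algebra A B)
    moreover have "(X -` A \<inter> space M) \<inter> (Y -` B \<inter> space M) =
        (\<lambda>\<omega>. (X \<omega>, Y \<omega>)) -` (A \<times> B) \<inter> space M" by auto
    ultimately show "emeasure (distr M K X) A * emeasure (distr M L Y) B =
        emeasure (distr M (K \<Otimes>\<^sub>M L) (\<lambda>\<omega>. (X \<omega>, Y \<omega>))) (A \<times> B)"
      by (simp add: emeasure_distr emeasure_eq_measure flip: ennreal_mult)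
  qed (auto simp: X.sigma_finite_measure_axioms Y.sigma_finite_measure_axioms)
qed

lemma sets_PiM_UNIV_borel_cong:
  "(\<And>i. sets (\<mu> i) = sets borel) \<Longrightarrow> sets (\<Pi>\<^sub>M i\<in>UNIV. \<mu> i) = sets (\<Pi>\<^sub>M i\<in>UNIV. borel)"
  by (rule sets_PiM_cong) auto

lemma iid_iff_distr:
  assumes "prob_space M" "prob_space \<mu>"
  shows "iid M \<mu> X \<longleftrightarrow> X \<in> M \<rightarrow>\<^sub>M (\<Pi>\<^sub>M k\<in>UNIV. \<mu>) \<and> distr M (\<Pi>\<^sub>M k\<in>UNIV. \<mu>) X = (\<Pi>\<^sub>M k\<in>UNIV. \<mu>)"
proof -
  interpret prob_space M by fact
  have *: "iid M \<mu> X \<longleftrightarrow> distr M (\<Pi>\<^sub>M k\<in>UNIV. \<mu>) X = (\<Pi>\<^sub>M k\<in>UNIV. \<mu>)"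
    if rv: "\<And>k. (\<lambda>\<omega>. X \<omega> k) \<in> M \<rightarrow>\<^sub>M \<mu>"
  proof -
    have "X \<in> M \<rightarrow>\<^sub>M (\<Pi>\<^sub>M k\<in>UNIV. \<mu>)"
      using measurable_PiM_single'[of UNIV "\<lambda>k \<omega>. X \<omega> k" M "\<lambda>_. \<mu>"] rv measurable_space[OF rv] by (auto simp: eta_contract_eq)
    have c: "distr M \<mu> (\<lambda>\<omega>. X \<omega> k) = \<mu>"
      if d: "distr M (\<Pi>\<^sub>M k\<in>UNIV. \<mu>) X = (\<Pi>\<^sub>M k\<in>UNIV. \<mu>)" for k
    proof -
      have "distr M \<mu> (\<lambda>\<omega>. X \<omega> k) = distr (distr M (\<Pi>\<^sub>M k\<in>UNIV. \<mu>) X) \<mu> (\<lambda>x. x k)"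
        using \<open>X \<in> _\<close> by (subst distr_distr) (auto simp: comp_def)
      also have "\<dots> = \<mu>" unfolding d by (rule distr_PiM_component) (use assms in auto)
      finally show ?thesis .
    qed
    show ?thesis
      unfolding iid_def by (subst indep_vars_iff_distr_eq_PiM) (use rv c in \<open>auto simp: restrict_UNIV\<close>)
  qed
  have "(\<lambda>\<omega>. X \<omega> k) \<in> M \<rightarrow>\<^sub>M \<mu>" if "iid M \<mu> X" for k
    using that by (auto simp: iid_def indep_vars_def)
  moreover have "(\<lambda>\<omega>. X \<omega> k) \<in> M \<rightarrow>\<^sub>M \<mu>" if "X \<in> M \<rightarrow>\<^sub>M (\<Pi>\<^sub>M k\<in>UNIV. \<mu>)" for k
    using that by (rule measurable_compose) simp
  moreover have "X \<in> M \<rightarrow>\<^sub>M (\<Pi>\<^sub>M k\<in>UNIV. \<mu>)" if "\<And>k. (\<lambda>\<omega>. X \<omega> k) \<in> M \<rightarrow>\<^sub>M \<mu>"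
    using measurable_PiM_single'[of UNIV "\<lambda>k \<omega>. X \<omega> k" M "\<lambda>_. \<mu>"] that measurable_space[OF that] by auto
  ultimately show ?thesis using * by blast
qed

text \<open>
  Two of the uniform variables are turned into independent variables with prescribed laws. In the
  applications one of the laws is that of a whole sequence or array, as these spaces are Polish too.
  The law of the triple expresses that the two variables are independent of \<open>\<xi>\<close> as well.
\<close>

lemma supports_uniforms_transfer:
  fixes \<mu>\<^sub>1 :: "'b::polish_space measure" and \<mu>\<^sub>2 :: "'c::polish_space measure"
  assumes M: "prob_space M" and sup: "supports_uniforms M \<xi>"
    and \<mu>\<^sub>1: "prob_space \<mu>\<^sub>1" "sets \<mu>\<^sub>1 = sets borel" and \<mu>\<^sub>2: "prob_space \<mu>\<^sub>2" "sets \<mu>\<^sub>2 = sets borel"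
  obtains Z\<^sub>1 Z\<^sub>2 where "Z\<^sub>1 \<in> borel_measurable M" "Z\<^sub>2 \<in> borel_measurable M"
    "distr M (borel \<Otimes>\<^sub>M borel) (\<lambda>\<omega>. (Z\<^sub>1 \<omega>, Z\<^sub>2 \<omega>)) = \<mu>\<^sub>1 \<Otimes>\<^sub>M \<mu>\<^sub>2"
    "distr M (measure_algebra borel \<Otimes>\<^sub>M (borel \<Otimes>\<^sub>M borel)) (\<lambda>\<omega>. (\<xi> \<omega>, Z\<^sub>1 \<omega>, Z\<^sub>2 \<omega>)) =
     distr M (measure_algebra borel) \<xi> \<Otimes>\<^sub>M (\<mu>\<^sub>1 \<Otimes>\<^sub>M \<mu>\<^sub>2)"
proof -
  interpret prob_space M by fact
  interpret unif: prob_space unif by (rule prob_space_unif)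
  let ?P = "\<Pi>\<^sub>M k\<in>(UNIV :: nat set). unif" and ?B = "\<Pi>\<^sub>M k\<in>(UNIV :: nat set). (borel :: real measure)"
  interpret seq: sequence_space unif by unfold_locales
  have sP: "sets ?P = sets ?B" by (rule sets_PiM_UNIV_borel_cong) simp
  obtain U where U: "iid M unif U" and ind: "independent M (measure_algebra borel) \<xi> ?B U"
    using sup by (auto simp: supports_uniforms_def)
  have \<xi>[measurable]: "\<xi> \<in> M \<rightarrow>\<^sub>M measure_algebra borel" and UB[measurable]: "U \<in> M \<rightarrow>\<^sub>M ?B"
    using ind by (auto simp: independent_def)
  have "distr M ?P U = ?P" using U iid_iff_distr[OF M prob_space_unif] by simp
  then have Ul: "distr M ?B U = ?P" using sP by (simp cong: distr_cong)
  then have law: "distr M (measure_algebra borel \<Otimes>\<^sub>M ?B) (\<lambda>\<omega>. (\<xi> \<omega>, U \<omega>)) =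
      distr M (measure_algebra borel) \<xi> \<Otimes>\<^sub>M ?P"
    using distr_independent[OF M ind] by simp
  obtain f where f: "f \<in> borel_measurable borel" "distr unif borel f = \<mu>\<^sub>1"
    using unif_quantile[OF \<mu>\<^sub>1] by blast
  obtain g where g: "g \<in> borel_measurable borel" "distr unif borel g = \<mu>\<^sub>2"
    using unif_quantile[OF \<mu>\<^sub>2] by blast
  note [measurable] = f(1) g(1)
  have cu: "(\<lambda>u. u k) \<in> ?P \<rightarrow>\<^sub>M borel" for k
    using measurable_component_singleton[of k UNIV "\<lambda>_. unif"] by (simp cong: measurable_cong_sets)
  have [measurable]: "(\<lambda>u. f (u 0)) \<in> ?P \<rightarrow>\<^sub>M borel" "(\<lambda>u. g (u k)) \<in> ?P \<rightarrow>\<^sub>M borel"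
      "(\<lambda>u. f (u 0)) \<in> ?B \<rightarrow>\<^sub>M borel" "(\<lambda>u. g (u k)) \<in> ?B \<rightarrow>\<^sub>M borel" for k
    using measurable_compose[OF cu f(1)] measurable_compose[OF cu g(1)] by auto
  have f'[measurable]: "f \<in> unif \<rightarrow>\<^sub>M borel" by simp
  have "distr ?P (borel \<Otimes>\<^sub>M borel) (\<lambda>u. (f (u 0), g (u 1))) =
      distr (distr (unif \<Otimes>\<^sub>M ?P) ?P (\<lambda>(s, u). case_nat s u)) (borel \<Otimes>\<^sub>M borel) (\<lambda>u. (f (u 0), g (u 1)))"
    by (subst seq.PiM_iter) simp
  also have "\<dots> = distr (unif \<Otimes>\<^sub>M ?P) (borel \<Otimes>\<^sub>M borel) (\<lambda>(s, u). (f s, g (u 0)))"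
    by (subst distr_distr) (auto simp: comp_def split_beta' intro!: distr_cong)
  also have "\<dots> = distr unif borel f \<Otimes>\<^sub>M distr ?P borel (\<lambda>u. g (u 0))"
    by (intro pair_measure_distr[symmetric] prob_space_imp_sigma_finite seq.P.prob_space_distr) auto
  also have "distr ?P borel (\<lambda>u. g (u 0)) = distr (distr ?P unif (\<lambda>u. u 0)) borel g"
    by (subst distr_distr) (auto simp: comp_def)
  also have "distr ?P unif (\<lambda>u. u 0) = unif"
    by (rule distr_PiM_component) (auto intro: prob_space_unif)
  finally have fg: "distr ?P (borel \<Otimes>\<^sub>M borel) (\<lambda>u. (f (u 0), g (u 1))) = \<mu>\<^sub>1 \<Otimes>\<^sub>M \<mu>\<^sub>2"
    using f g by simp
  interpret \<mu>12: prob_space "\<mu>\<^sub>1 \<Otimes>\<^sub>M \<mu>\<^sub>2" by (intro prob_space_pair \<mu>\<^sub>1 \<mu>\<^sub>2)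
  have "distr M (measure_algebra borel \<Otimes>\<^sub>M (borel \<Otimes>\<^sub>M borel)) (\<lambda>\<omega>. (\<xi> \<omega>, f (U \<omega> 0), g (U \<omega> 1))) =
     distr (distr M (measure_algebra borel \<Otimes>\<^sub>M ?B) (\<lambda>\<omega>. (\<xi> \<omega>, U \<omega>)))
       (measure_algebra borel \<Otimes>\<^sub>M (borel \<Otimes>\<^sub>M borel)) (\<lambda>(x, u). (x, f (u 0), g (u 1)))"
    by (subst distr_distr) (auto simp: comp_def)
  also have "\<dots> = distr (distr M (measure_algebra borel) \<xi> \<Otimes>\<^sub>M ?P)
      (measure_algebra borel \<Otimes>\<^sub>M (borel \<Otimes>\<^sub>M borel)) (\<lambda>(x, u). (x, f (u 0), g (u 1)))"
    unfolding law ..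
  also have "\<dots> = distr (distr M (measure_algebra borel) \<xi>) (measure_algebra borel) (\<lambda>x. x) \<Otimes>\<^sub>M
      distr ?P (borel \<Otimes>\<^sub>M borel) (\<lambda>u. (f (u 0), g (u 1)))"
    by (rule pair_measure_distr[symmetric]) (auto intro!: prob_space_imp_sigma_finite seq.P.prob_space_distr)
  also have "\<dots> = distr M (measure_algebra borel) \<xi> \<Otimes>\<^sub>M (\<mu>\<^sub>1 \<Otimes>\<^sub>M \<mu>\<^sub>2)"
    unfolding fg by (subst distr_id2) auto
  finally have joint: "distr M (measure_algebra borel \<Otimes>\<^sub>M (borel \<Otimes>\<^sub>M borel)) (\<lambda>\<omega>. (\<xi> \<omega>, f (U \<omega> 0), g (U \<omega> 1))) =
     distr M (measure_algebra borel) \<xi> \<Otimes>\<^sub>M (\<mu>\<^sub>1 \<Otimes>\<^sub>M \<mu>\<^sub>2)" .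
  have "distr M (borel \<Otimes>\<^sub>M borel) (\<lambda>\<omega>. (f (U \<omega> 0), g (U \<omega> 1))) =
      distr (distr M ?B U) (borel \<Otimes>\<^sub>M borel) (\<lambda>u. (f (u 0), g (u 1)))"
    by (subst distr_distr) (auto simp: comp_def)
  also have "\<dots> = \<mu>\<^sub>1 \<Otimes>\<^sub>M \<mu>\<^sub>2" unfolding Ul by (rule fg)
  finally show ?thesis
    using joint by (intro that[of "\<lambda>\<omega>. f (U \<omega> 0)" "\<lambda>\<omega>. g (U \<omega> 1)"])
       (auto intro: measurable_compose[OF UB])
qed

text \<open>
  The quantile transform gives a uniform index almost surely; \<open>idx\<close> sends the exceptional values to
  index 0, so that the result lies in \<open>F\<close> for every argument.
\<close>

lemma unif_choice:
  assumes F: "finite F" "F \<noteq> {}"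
  obtains h :: "real \<Rightarrow> 'x" where "h \<in> borel \<rightarrow>\<^sub>M count_space UNIV" "\<And>u. h u \<in> F"
    "\<And>x. x \<in> F \<Longrightarrow> emeasure unif (h -` {x}) = 1 / of_nat (card F)"
proof -
  let ?n = "card F" and ?p = "pmf_of_set {..<card F}"
  have n: "?n > 0" using F by (auto simp: card_gt_0_iff)
  then have n': "{..<?n} \<noteq> {}" by (metis empty_iff lessThan_iff)
  obtain b where b: "bij_betw b {..<?n} F" using ex_bij_betw_nat_finite[OF F(1)] by (auto simp: atLeast0LessThan)
  obtain f where f[measurable]: "f \<in> borel_measurable borel" and fl: "distr unif borel f = distr (measure_pmf ?p) borel real"
    by (rule unif_quantile[of "distr (measure_pmf ?p) borel real"]) (auto intro: measure_pmf.prob_space_distr)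
  define idx :: "real \<Rightarrow> nat" where "idx r = (if nat \<lfloor>r\<rfloor> < ?n then nat \<lfloor>r\<rfloor> else 0)" for r
  have [measurable]: "idx \<in> borel \<rightarrow>\<^sub>M count_space UNIV" unfolding idx_def by measurable
  have idx: "idx r < ?n" for r using n by (auto simp: idx_def)
  show ?thesis
  proof (rule that[of "\<lambda>u. b (idx (f u))"])
    show "(\<lambda>u. b (idx (f u))) \<in> borel \<rightarrow>\<^sub>M count_space UNIV"
      by (rule measurable_compose[of _ _ "count_space UNIV" b]) auto
    show "b (idx (f u)) \<in> F" for u using b idx by (auto simp: bij_betw_def)
    fix x assume "x \<in> F"
    then obtain j where j: "j < ?n" "x = b j" using b by (auto simp: bij_betw_def)
    have "b (idx r) = x \<longleftrightarrow> idx r = j" for r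
      using b idx[of r] j by (auto simp: bij_betw_def inj_on_def)
    then have "(\<lambda>u. b (idx (f u))) -` {x} = f -` (idx -` {j}) \<inter> space unif" by auto
    moreover have I[measurable]: "idx -` {j} \<in> sets borel"
      using measurable_sets[of idx borel "count_space UNIV" "{j}"] by auto
    ultimately have "emeasure unif ((\<lambda>u. b (idx (f u))) -` {x}) = emeasure (distr unif borel f) (idx -` {j})"
      by (subst emeasure_distr) auto
    also have "\<dots> = emeasure (measure_pmf ?p) {k. idx (real k) = j}"
      unfolding fl by (subst emeasure_distr) (auto simp: vimage_def)
    also have "\<dots> = emeasure (measure_pmf ?p) {j}"
      using n n' j by (intro emeasure_eq_AE) (auto simp: AE_measure_pmf_iff idx_def)
    also have "\<dots> = ennreal (1 / real ?n)" using n n' j by (simp add: emeasure_pmf_single)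
    also have "\<dots> = 1 / of_nat ?n"
      using n by (simp add: ennreal_of_nat_eq_real_of_nat flip: divide_ennreal)
    finally show "emeasure unif ((\<lambda>u. b (idx (f u))) -` {x}) = 1 / of_nat (card F)" .
  qed
qed


section \<open>Edge probabilities along injections\<close>

text \<open>
  The probability that a random graph with vertices \<open>s 0, \<dots>, s (m - 1)\<close> and kernel \<open>W\<close> has
  the edges prescribed by \<open>a\<close>.
\<close>

definition edge_prob :: "('a \<Rightarrow> 'a \<Rightarrow> real) \<Rightarrow> (nat \<Rightarrow> 'a) \<Rightarrow> nat \<Rightarrow> (nat \<Rightarrow> nat \<Rightarrow> bool) \<Rightarrow> real" where
  "edge_prob W s m a = (\<Prod>j<m. \<Prod>i<j. pmf (bernoulli_pmf (W (s i) (s j))) (a i j))"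

definition upairs :: "nat \<Rightarrow> (nat \<times> nat) set" where
  "upairs m = {(i, j). i < j \<and> j < m}"

lemma finite_upairs [simp]: "finite (upairs m)"
  by (rule finite_subset[of _ "{..<m} \<times> {..<m}"]) (auto simp: upairs_def)

lemma edge_prob_upairs:
  "edge_prob W s m a = (\<Prod>(i, j)\<in>upairs m. pmf (bernoulli_pmf (W (s i) (s j))) (a i j))"
proof -
  have "edge_prob W s m a = (\<Prod>(j, i)\<in>Sigma {..<m} (\<lambda>j. {..<j}). pmf (bernoulli_pmf (W (s i) (s j))) (a i j))"
    unfolding edge_prob_def by (subst prod.Sigma) auto
  also have "\<dots> = (\<Prod>(i, j)\<in>upairs m. pmf (bernoulli_pmf (W (s i) (s j))) (a i j))"
    by (rule prod.reindex_bij_witness[of _ prod.swap prod.swap]) (auto simp: upairs_def)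
  finally show ?thesis .
qed

lemma edge_prob_nonneg: "0 \<le> edge_prob W s m a"
  unfolding edge_prob_def by (intro prod_nonneg) auto

lemma edge_prob_le_1: "edge_prob W s m a \<le> 1"
  unfolding edge_prob_def by (intro prod_le_1) (auto intro!: prod_nonneg prod_le_1 pmf_le_1)

lemma edge_prob_cong:
  "(\<And>i. i < m \<Longrightarrow> s i = s' i) \<Longrightarrow> (\<And>i j. i < j \<Longrightarrow> j < m \<Longrightarrow> a i j = a' i j) \<Longrightarrow>
   edge_prob W s m a = edge_prob W s' m a'"
  unfolding edge_prob_def by (intro prod.cong refl) auto

text \<open>
  The vertices \<open>i\<close> and \<open>j\<close> go to \<open>l i\<close> and \<open>l j\<close>; as \<open>l\<close> need not be monotone, the image of the pair is
  sorted to be an unordered pair in the sense of \<open>upairs\<close> again.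
\<close>

definition ordered :: "(nat \<Rightarrow> nat) \<Rightarrow> nat \<times> nat \<Rightarrow> nat \<times> nat" where
  "ordered l = (\<lambda>(i, j). (min (l i) (l j), max (l i) (l j)))"

lemma ordered_upairs:
  assumes "inj_on l {..<m}" "l ` {..<m} \<subseteq> {..<m'}"
  shows "inj_on (ordered l) (upairs m)" "ordered l ` upairs m \<subseteq> upairs m'"
proof -
  have l: "l i = l j \<longleftrightarrow> i = j" "l i < m'" if "i < m" "j < m" for i j
    using assms that by (auto simp: inj_on_def)
  show "inj_on (ordered l) (upairs m)"
  proof (rule inj_onI)
    fix p p' assume p: "p \<in> upairs m" "p' \<in> upairs m" and eq: "ordered l p = ordered l p'"
    obtain i j i' j' where ij: "p = (i, j)" "p' = (i', j')" by (cases p; cases p')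
    then have a: "i < j" "j < m" "i' < j'" "j' < m" using p by (auto simp: upairs_def)
    from eq have "l i = l i' \<and> l j = l j' \<or> l i = l j' \<and> l j = l i'"
      by (auto simp: ij ordered_def min_def max_def split: if_splits)
    then show "p = p'" using a l unfolding ij by (metis order.strict_trans order.asym)
  qed
  show "ordered l ` upairs m \<subseteq> upairs m'"
  proof (rule image_subsetI)
    fix p assume p: "p \<in> upairs m"
    obtain i j where ij: "p = (i, j)" by (cases p)
    then have "i < j" "j < m" "i < m" using p by (auto simp: upairs_def)
    with l[of i j] l[of j i] show "ordered l p \<in> upairs m'"
      by (auto simp: ij ordered_def upairs_def min_def max_def)
  qed
qed

text \<open>
  Under the product law of the edges, the pairs outside the image of \<open>l\<close> are summed out, which leaves
  the law of the graph that is induced on the vertices \<open>l 0, \<dots>, l (m - 1)\<close>. Symmetry of the kernel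
  makes up for the pairs whose order \<open>l\<close> reverses.
\<close>

lemma sum_edge_prob_marginal:
  fixes W :: "'a \<Rightarrow> 'a \<Rightarrow> real"
  assumes sym: "\<And>x y. W x y = W y x" and W: "\<And>x y. W x y \<in> {0..1}"
    and l: "inj_on l {..<m}" "l ` {..<m} \<subseteq> {..<m'}"
  shows "(\<Sum>b\<in>{b \<in> upairs m' \<rightarrow>\<^sub>E UNIV. \<forall>(i, j)\<in>upairs m. b (ordered l (i, j)) = a i j}.
            edge_prob W s m' (\<lambda>i j. b (i, j))) = edge_prob W (\<lambda>i. s (l i)) m a"
proof -
  note o = ordered_upairs[OF l]
  define p where "p q = bernoulli_pmf (case q of (i, j) \<Rightarrow> W (s i) (s j))" for q
  define B where "B q = {v. \<forall>(i, j)\<in>upairs m. ordered l (i, j) = q \<longrightarrow> v = a i j}" for q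
  have "{b \<in> upairs m' \<rightarrow>\<^sub>E UNIV. \<forall>(i, j)\<in>upairs m. b (ordered l (i, j)) = a i j} = PiE (upairs m') B"
    using o(2) by (fastforce simp: B_def PiE_iff)
  then have "(\<Sum>b\<in>{b \<in> upairs m' \<rightarrow>\<^sub>E UNIV. \<forall>(i, j)\<in>upairs m. b (ordered l (i, j)) = a i j}.
            edge_prob W s m' (\<lambda>i j. b (i, j))) = (\<Sum>b\<in>PiE (upairs m') B. \<Prod>q\<in>upairs m'. pmf (p q) (b q))"
    by (simp add: edge_prob_upairs p_def split_beta')
  also have "\<dots> = (\<Prod>q\<in>upairs m'. \<Sum>v\<in>B q. pmf (p q) v)"
    by (rule prod_sum_PiE[symmetric]) auto
  also have "\<dots> = (\<Prod>q\<in>ordered l ` upairs m. \<Sum>v\<in>B q. pmf (p q) v)"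
  proof (rule prod.mono_neutral_right)
    show "\<forall>q\<in>upairs m' - ordered l ` upairs m. (\<Sum>v\<in>B q. pmf (p q) v) = 1"
    proof
      fix q assume "q \<in> upairs m' - ordered l ` upairs m"
      then have "B q = UNIV" by (fastforce simp: B_def)
      then show "(\<Sum>v\<in>B q. pmf (p q) v) = 1" by (simp add: sum_pmf_eq_1)
    qed
  qed (use o in auto)
  also have "\<dots> = (\<Prod>q\<in>upairs m. \<Sum>v\<in>B (ordered l q). pmf (p (ordered l q)) v)"
    by (simp add: prod.reindex[OF o(1)])
  also have "\<dots> = (\<Prod>(i, j)\<in>upairs m. pmf (bernoulli_pmf (W (s (l i)) (s (l j)))) (a i j))"
  proof (intro prod.cong refl)
    fix q assume q: "q \<in> upairs m"
    obtain i j where ij: "q = (i, j)" by (cases q)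
    have "B (ordered l q) = {a i j}"
      using q o(1) by (auto simp: B_def ij inj_on_def)
    moreover have "p (ordered l q) = bernoulli_pmf (W (s (l i)) (s (l j)))"
      by (auto simp: p_def ordered_def ij min_def max_def sym)
    ultimately show "(\<Sum>v\<in>B (ordered l q). pmf (p (ordered l q)) v) =
       (case q of (i, j) \<Rightarrow> pmf (bernoulli_pmf (W (s (l i)) (s (l j)))) (a i j))"
      by (simp add: ij)
  qed
  finally show ?thesis by (simp add: edge_prob_upairs)
qed

lemma measurable_edge_prob:
  fixes W :: "'a::polish_space \<Rightarrow> 'a \<Rightarrow> real"
  assumes W: "connection_kernel W" and s: "\<And>i. i < m \<Longrightarrow> (\<lambda>\<omega>. s \<omega> i) \<in> M \<rightarrow>\<^sub>M borel"
  shows "(\<lambda>\<omega>. edge_prob W (s \<omega>) m a) \<in> borel_measurable M"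
proof -
  have W': "(\<lambda>(x, y). W x y) \<in> borel_measurable borel" using W by (simp add: connection_kernel_def)
  have "(\<lambda>\<omega>. pmf (bernoulli_pmf (W (s \<omega> i) (s \<omega> j))) b) \<in> borel_measurable M" if "i < m" "j < m" for i j b
  proof -
    have "(\<lambda>\<omega>. (s \<omega> i, s \<omega> j)) \<in> M \<rightarrow>\<^sub>M borel"
      using s that by (intro borel_measurable_Pair) auto
    from measurable_compose[OF this W'] have [measurable]: "(\<lambda>\<omega>. W (s \<omega> i) (s \<omega> j)) \<in> borel_measurable M"
      by simp
    have "0 \<le> W x y \<and> W x y \<le> 1" for x y using W by (simp add: connection_kernel_def)
    then have "(\<lambda>\<omega>. pmf (bernoulli_pmf (W (s \<omega> i) (s \<omega> j))) b) =
        (\<lambda>\<omega>. if b then W (s \<omega> i) (s \<omega> j) else 1 - W (s \<omega> i) (s \<omega> j))"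
      by (cases b) auto
    then show ?thesis by simp
  qed
  then show ?thesis unfolding edge_prob_def by (intro borel_measurable_prod) auto
qed

lemma disjoint_edge_patterns:
  fixes Y :: "'w \<Rightarrow> nat \<times> nat \<Rightarrow> real"
  shows "disjoint_family_on (\<lambda>b. {\<omega>\<in>G. \<forall>j<n. \<forall>i<j. Y \<omega> (i, j) = of_bool (b (i, j))}) (upairs n \<rightarrow>\<^sub>E UNIV)"
    (is "disjoint_family_on ?E _")
  unfolding disjoint_family_on_def
proof (intro ballI impI)
  fix b c assume bc: "b \<in> upairs n \<rightarrow>\<^sub>E (UNIV :: bool set)" "c \<in> upairs n \<rightarrow>\<^sub>E (UNIV :: bool set)" "b \<noteq> c"
  have "\<exists>p\<in>upairs n. b p \<noteq> c p"
  proof (rule ccontr)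
    assume "\<not> ?thesis"
    then have "b = c" by (intro PiE_ext[OF bc(1,2)]) auto
    with bc show False by simp
  qed
  then obtain i j where ij: "i < j" "j < n" "b (i, j) \<noteq> c (i, j)" by (auto simp: upairs_def)
  have False if "\<omega> \<in> ?E b" "\<omega> \<in> ?E c" for \<omega>
  proof -
    have "Y \<omega> (i, j) = of_bool (b (i, j))" "Y \<omega> (i, j) = of_bool (c (i, j))"
      using that ij(1,2) by blast+
    then have "of_bool (b (i, j)) = (of_bool (c (i, j)) :: real)" by (rule trans[OF sym])
    then show False using ij(3) by (cases "b (i, j)"; cases "c (i, j)") simp_all
  qed
  then show "?E b \<inter> ?E c = {}" by blast
qed


section \<open>Graph representations\<close>

lemma representation_measurable:
  assumes "representation M \<xi> N S A"
  shows "N \<in> M \<rightarrow>\<^sub>M count_space UNIV" "(\<lambda>\<omega>. S \<omega> k) \<in> M \<rightarrow>\<^sub>M borel" "(\<lambda>\<omega>. A \<omega> p) \<in> M \<rightarrow>\<^sub>M borel"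
  using assms unfolding representation_def
  by (auto intro: measurable_compose[OF _ measurable_component_singleton])

lemma points_algebra:
  assumes "N \<in> M \<rightarrow>\<^sub>M count_space UNIV" "\<And>k. (\<lambda>\<omega>. S \<omega> k) \<in> M \<rightarrow>\<^sub>M borel"
  shows "subalgebra M (points_algebra M N S)" "space (points_algebra M N S) = space M"
    "{\<omega>\<in>space M. N \<omega> = n} \<in> sets (points_algebra M N S)"
    "C \<in> sets borel \<Longrightarrow> {\<omega>\<in>space M. enat k < N \<omega> \<and> S \<omega> k \<in> C} \<in> sets (points_algebra M N S)"
proof -
  let ?G = "range (\<lambda>n. {\<omega>\<in>space M. N \<omega> = n}) \<union>
      {{\<omega>\<in>space M. enat k < N \<omega> \<and> S \<omega> k \<in> C} | k C. C \<in> sets borel}"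
  note [measurable] = assms
  have G: "?G \<subseteq> sets M" by auto
  then have G': "?G \<subseteq> Pow (space M)" using sets.space_closed by blast
  show sp: "space (points_algebra M N S) = space M"
    unfolding points_algebra_def using G' by (rule space_measure_of)
  have "sets (points_algebra M N S) = sigma_sets (space M) ?G"
    unfolding points_algebra_def using G' by (rule sets_measure_of)
  then show "{\<omega>\<in>space M. N \<omega> = n} \<in> sets (points_algebra M N S)"
    "C \<in> sets borel \<Longrightarrow> {\<omega>\<in>space M. enat k < N \<omega> \<and> S \<omega> k \<in> C} \<in> sets (points_algebra M N S)"
    by auto
  show "subalgebra M (points_algebra M N S)"
    unfolding subalgebra_def sp using \<open>sets (points_algebra M N S) = _\<close> sets.sigma_sets_subset[OF G] by simp
qed

text \<open>
  The conditional probability in the definition of a graph representation, integrated over an event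
  of the points algebra.
\<close>

lemma graph_representation_base:
  fixes \<xi> :: "'w \<Rightarrow> ('a::polish_space \<times> 'a \<times> real) measure"
  assumes M: "prob_space M" and gr: "graph_representation M W \<xi> N S A" and W: "connection_kernel W"
    and G: "G \<in> sets (points_algebra M N S)" and GN: "\<And>\<omega>. \<omega> \<in> G \<Longrightarrow> enat m \<le> N \<omega>"
  shows "emeasure M {\<omega>\<in>G. \<forall>j<m. \<forall>i<j. A \<omega> (i, j) = of_bool (a i j)} =
     (\<integral>\<^sup>+\<omega>. ennreal (edge_prob W (S \<omega>) m a) * indicator G \<omega> \<partial>M)"
proof -
  interpret prob_space M by fact
  have rep: "representation M \<xi> N S A" using gr by (simp add: graph_representation_def)
  note [measurable] = representation_measurable[OF rep]
  note pa = points_algebra[of N M S, OF representation_measurable(1,2)[OF rep]]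
  interpret finite_measure_subalgebra M "points_algebra M N S"
    by standard (rule pa(1))
  have G'[measurable]: "G \<in> sets M" using pa(1) G by (auto simp: subalgebra_def)
  have [measurable]: "(\<lambda>\<omega>. edge_prob W (S \<omega>) m a) \<in> borel_measurable M"
    by (rule measurable_edge_prob[OF W]) simp
  define E where "E = {\<omega>\<in>space M. enat m \<le> N \<omega> \<and> (\<forall>j<m. \<forall>i<j. A \<omega> (i, j) = of_bool (a i j))}"
  have E[measurable]: "E \<in> sets M" unfolding E_def by measurable
  have ce: "AE \<omega> in M. real_cond_exp M (points_algebra M N S) (indicator E) \<omega> =
      (if enat m \<le> N \<omega> then edge_prob W (S \<omega>) m a else 0)"
    using gr unfolding graph_representation_def E_def edge_prob_def by simp
  have eq: "{\<omega>\<in>G. \<forall>j<m. \<forall>i<j. A \<omega> (i, j) = of_bool (a i j)} = E \<inter> G"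
    using GN sets.sets_into_space[OF G'] by (auto simp: E_def)
  have "measure M (E \<inter> G) = (\<integral>\<omega>\<in>G. indicator E \<omega> \<partial>M)"
    by (simp add: set_lebesgue_integral_def mult.commute flip: indicator_inter_arith)
  also have "\<dots> = (\<integral>\<omega>\<in>G. real_cond_exp M (points_algebra M N S) (indicator E) \<omega> \<partial>M)"
    by (rule real_cond_exp_intA) (auto simp: G less_top[symmetric])
  also have "\<dots> = (\<integral>\<omega>. edge_prob W (S \<omega>) m a * indicator G \<omega> \<partial>M)"
    unfolding set_lebesgue_integral_def
  proof (rule integral_cong_AE)
    show "AE \<omega> in M. indicat_real G \<omega> *\<^sub>R real_cond_exp M (points_algebra M N S) (indicator E) \<omega> =
        edge_prob W (S \<omega>) m a * indicator G \<omega>"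
      using ce by eventually_elim (auto simp: indicator_def GN)
  qed auto
  also have "ennreal \<dots> = (\<integral>\<^sup>+\<omega>. ennreal (edge_prob W (S \<omega>) m a * indicator G \<omega>) \<partial>M)"
    by (rule nn_integral_eq_integral[symmetric])
       (auto intro!: integrable_const_bound[where B = 1] simp: edge_prob_nonneg edge_prob_le_1 indicator_def)
  also have "\<dots> = (\<integral>\<^sup>+\<omega>. ennreal (edge_prob W (S \<omega>) m a) * indicator G \<omega> \<partial>M)"
    by (intro nn_integral_cong) (auto simp: indicator_def)
  finally show ?thesis unfolding eq emeasure_eq_measure .
qed

text \<open>
  The definition speaks of the first \<open>m\<close> points in their given order. Here the points are picked by
  an arbitrary injection \<open>l\<close>, which is what is needed when they are renumbered. The pattern
  along \<open>l\<close> is the disjoint union of its extensions to all pairs of an initial segment that contains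
  the range of \<open>l\<close>, and their probabilities add up by \<open>sum_edge_prob_marginal\<close>.
\<close>

lemma graph_representation_pattern:
  fixes \<xi> :: "'w \<Rightarrow> ('a::polish_space \<times> 'a \<times> real) measure"
  assumes M: "prob_space M" and gr: "graph_representation M W \<xi> N S A" and W: "connection_kernel W"
    and l: "inj_on l {..<m}"
    and G: "G \<in> sets (points_algebra M N S)" and GN: "\<And>\<omega> i. \<omega> \<in> G \<Longrightarrow> i < m \<Longrightarrow> enat (l i) < N \<omega>"
  shows "emeasure M {\<omega>\<in>G. \<forall>j<m. \<forall>i<j. A \<omega> (l i, l j) = of_bool (a i j)} =
     (\<integral>\<^sup>+\<omega>. ennreal (edge_prob W (\<lambda>i. S \<omega> (l i)) m a) * indicator G \<omega> \<partial>M)"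
proof -
  interpret prob_space M by fact
  have rep: "representation M \<xi> N S A" using gr by (simp add: graph_representation_def)
  note [measurable] = representation_measurable[OF rep]
  note pa = points_algebra[of N M S, OF representation_measurable(1,2)[OF rep]]
  have G'[measurable]: "G \<in> sets M" using pa(1) G by (auto simp: subalgebra_def)
  define m' where "m' = (if m = 0 then 0 else Suc (Max (l ` {..<m})))"
  have lm': "l ` {..<m} \<subseteq> {..<m'}" by (auto simp: m'_def less_Suc_eq_le)
  have m'N: "enat m' \<le> N \<omega>" if "\<omega> \<in> G" for \<omega>
  proof (cases "m = 0")
    case False
    then have "Max (l ` {..<m}) \<in> l ` {..<m}" by (intro Max_in) auto
    then show ?thesis using GN[OF that] False by (auto simp: m'_def Suc_ile_eq)
  qed (simp add: m'_def flip: zero_enat_def)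
  define R where "R = {b \<in> upairs m' \<rightarrow>\<^sub>E UNIV. \<forall>(i, j)\<in>upairs m. b (ordered l (i, j)) = a i j}"
  have R: "finite R" unfolding R_def by (rule finite_subset[of _ "upairs m' \<rightarrow>\<^sub>E UNIV"]) (auto intro: finite_PiE)
  define E where "E b = {\<omega>\<in>G. \<forall>j<m'. \<forall>i<j. A \<omega> (i, j) = of_bool (b (i, j))}" for b
  have E_sets[measurable]: "E b \<in> sets M" for b unfolding E_def by measurable
  have mEP: "(\<lambda>\<omega>. edge_prob W (S \<omega>) m b) \<in> borel_measurable M" for m b
    by (rule measurable_edge_prob[OF W]) simp
  have AE01: "AE \<omega> in M. \<forall>i\<in>indices (N \<omega>). \<forall>j\<in>indices (N \<omega>). A \<omega> (i, j) \<in> {0, 1} \<and> A \<omega> (j, i) = A \<omega> (i, j)"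
    using rep unfolding representation_def by auto
  have "emeasure M {\<omega>\<in>G. \<forall>j<m. \<forall>i<j. A \<omega> (l i, l j) = of_bool (a i j)} = emeasure M (\<Union>b\<in>R. E b)"
  proof (rule emeasure_eq_AE)
    show "AE \<omega> in M. \<omega> \<in> {\<omega>\<in>G. \<forall>j<m. \<forall>i<j. A \<omega> (l i, l j) = of_bool (a i j)} \<longleftrightarrow> \<omega> \<in> (\<Union>b\<in>R. E b)"
      using AE01
    proof eventually_elim
      case (elim \<omega>)
      show ?case
      proof (cases "\<omega> \<in> G")
        case True
        have lt: "enat k < N \<omega>" if "k < m'" for k
          using m'N[OF True] that by (metis enat_ord_simps(2) order_less_le_trans)
        have A01: "A \<omega> (i, j) \<in> {0, 1}" "A \<omega> (j, i) = A \<omega> (i, j)" if "i < m'" "j < m'" for i j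
          using elim lt that by auto
        have ord: "A \<omega> (ordered l (i, j)) = A \<omega> (l i, l j)" if "i < m" "j < m" for i j
          using lm' that A01(2)[of "l i" "l j"] by (auto simp: ordered_def min_def max_def)
        define b where "b = restrict (\<lambda>p. A \<omega> p = 1) (upairs m')"
        have b: "A \<omega> (i, j) = of_bool (b (i, j))" if "(i, j) \<in> upairs m'" for i j
          using that A01(1)[of i j] by (auto simp: b_def upairs_def)
        have ou: "ordered l (i, j) \<in> upairs m'" if "i < j" "j < m" for i j
          using that by (intro subsetD[OF ordered_upairs(2)[OF l lm']] imageI) (simp add: upairs_def)
        have "(\<forall>j<m. \<forall>i<j. A \<omega> (l i, l j) = of_bool (a i j)) \<longleftrightarrow> b \<in> R"
        proof -
          have "A \<omega> (l i, l j) = of_bool (a i j) \<longleftrightarrow> b (ordered l (i, j)) = a i j" if "i < j" "j < m" for i j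
            using b[of "fst (ordered l (i, j))" "snd (ordered l (i, j))"] ou[OF that] ord[of i j] that by simp
          then have "(\<forall>j<m. \<forall>i<j. A \<omega> (l i, l j) = of_bool (a i j)) \<longleftrightarrow>
              (\<forall>(i, j)\<in>upairs m. b (ordered l (i, j)) = a i j)"
            unfolding upairs_def by blast
          moreover have "b \<in> upairs m' \<rightarrow>\<^sub>E UNIV" by (simp add: b_def)
          ultimately show ?thesis by (simp add: R_def)
        qed
        moreover have "\<omega> \<in> E c \<longleftrightarrow> c = b" if "c \<in> upairs m' \<rightarrow>\<^sub>E UNIV" for c
        proof
          assume "\<omega> \<in> E c"
          then have "c p = b p" if "p \<in> upairs m'" for p
            using b[of "fst p" "snd p"] that by (auto simp: E_def upairs_def)
          then show "c = b" using \<open>c \<in> _\<close> by (intro PiE_ext[of c "upairs m'" "\<lambda>_. UNIV" b]) (auto simp: b_def)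
        next
          assume "c = b" then show "\<omega> \<in> E c"
            using b True by (auto simp: E_def upairs_def)
        qed
        ultimately show ?thesis using True by (auto simp: R_def)
      qed (auto simp: E_def)
    qed
  qed (use R in auto)
  also have "\<dots> = (\<Sum>b\<in>R. emeasure M (E b))"
    unfolding E_def
    by (rule sum_emeasure[symmetric], use E_sets[unfolded E_def] in blast, rule disjoint_family_on_mono[OF _ disjoint_edge_patterns],
        use R in \<open>auto simp: R_def\<close>)
  also have "\<dots> = (\<Sum>b\<in>R. \<integral>\<^sup>+\<omega>. ennreal (edge_prob W (S \<omega>) m' (\<lambda>i j. b (i, j))) * indicator G \<omega> \<partial>M)"
    unfolding E_def by (intro sum.cong refl graph_representation_base[OF M gr W G m'N])
  also have "\<dots> = (\<integral>\<^sup>+\<omega>. (\<Sum>b\<in>R. ennreal (edge_prob W (S \<omega>) m' (\<lambda>i j. b (i, j))) * indicator G \<omega>) \<partial>M)"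
    using mEP by (intro nn_integral_sum[symmetric]) auto
  also have "\<dots> = (\<integral>\<^sup>+\<omega>. ennreal (edge_prob W (\<lambda>i. S \<omega> (l i)) m a) * indicator G \<omega> \<partial>M)"
  proof (intro nn_integral_cong)
    fix \<omega>
    have "(\<Sum>b\<in>R. ennreal (edge_prob W (S \<omega>) m' (\<lambda>i j. b (i, j)))) =
        ennreal (\<Sum>b\<in>R. edge_prob W (S \<omega>) m' (\<lambda>i j. b (i, j)))"
      by (intro sum_ennreal edge_prob_nonneg)
    also have "\<dots> = ennreal (edge_prob W (\<lambda>i. S \<omega> (l i)) m a)"
      unfolding R_def using W by (subst sum_edge_prob_marginal[OF _ _ l lm']) (auto simp: connection_kernel_def)
    finally show "(\<Sum>b\<in>R. ennreal (edge_prob W (S \<omega>) m' (\<lambda>i j. b (i, j))) * indicator G \<omega>) =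
        ennreal (edge_prob W (\<lambda>i. S \<omega> (l i)) m a) * indicator G \<omega>"
      by (simp flip: sum_distrib_right)
  qed
  finally show ?thesis .
qed


section \<open>The corners of a random graph matrix\<close>

text \<open>
  The adjacency matrix of the graph whose edges are given on the pairs \<open>i < j\<close>.
\<close>

definition graph_matrix :: "nat \<Rightarrow> (nat \<times> nat \<Rightarrow> bool) \<Rightarrow> nat \<times> nat \<Rightarrow> real" where
  "graph_matrix n b = restrict (\<lambda>(i, j). of_bool (i \<noteq> j \<and> b (min i j, max i j))) ({..<n} \<times> {..<n})"

lemma measurable_corner:
  assumes "X \<in> M \<rightarrow>\<^sub>M (\<Pi>\<^sub>M p\<in>UNIV. borel)"
  shows "(\<lambda>\<omega>. corner n (X \<omega>)) \<in> M \<rightarrow>\<^sub>M corner_space n"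
  unfolding corner_def restrict_def
  by (rule measurable_restrict[unfolded restrict_def])
     (rule measurable_compose[OF assms measurable_component_singleton], simp)

text \<open>
  A corner of a random adjacency matrix takes finitely many values, one for each edge pattern, so its
  law is known once the probabilities of the patterns are. The event \<open>G\<close> serves for conditioning.
\<close>

lemma emeasure_corner_graph_matrix:
  fixes Y :: "'w \<Rightarrow> nat \<times> nat \<Rightarrow> real"
  assumes G: "G \<in> sets M" and Y: "Y \<in> M \<rightarrow>\<^sub>M (\<Pi>\<^sub>M p\<in>UNIV. borel)" and F: "F \<in> sets (corner_space n)"
    and graph: "AE \<omega> in M. \<omega> \<in> G \<longrightarrow>
      (\<forall>i<n. Y \<omega> (i, i) = 0 \<and> (\<forall>j<n. Y \<omega> (i, j) \<in> {0, 1} \<and> Y \<omega> (j, i) = Y \<omega> (i, j)))"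
  shows "emeasure M {\<omega>\<in>G. corner n (Y \<omega>) \<in> F} =
    (\<Sum>b\<in>{b \<in> upairs n \<rightarrow>\<^sub>E UNIV. graph_matrix n b \<in> F}.
       emeasure M {\<omega>\<in>G. \<forall>j<n. \<forall>i<j. Y \<omega> (i, j) = of_bool (b (i, j))})"
proof -
  have [measurable]: "(\<lambda>\<omega>. Y \<omega> p) \<in> borel_measurable M" for p
    by (rule measurable_compose[OF Y measurable_component_singleton]) simp
  note [measurable] = G measurable_corner[OF Y] F
  define R where "R = {b \<in> upairs n \<rightarrow>\<^sub>E UNIV. graph_matrix n b \<in> F}"
  define E where "E b = {\<omega>\<in>G. \<forall>j<n. \<forall>i<j. Y \<omega> (i, j) = of_bool (b (i, j))}" for b
  have R: "finite R" unfolding R_def by (rule finite_subset[of _ "upairs n \<rightarrow>\<^sub>E UNIV"]) (auto intro: finite_PiE)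
  have E_sets[measurable]: "E b \<in> sets M" for b unfolding E_def by measurable
  have cm: "{\<omega>\<in>G. corner n (Y \<omega>) \<in> F} \<in> sets M"
  proof -
    have "{\<omega>\<in>G. corner n (Y \<omega>) \<in> F} = G \<inter> ((\<lambda>\<omega>. corner n (Y \<omega>)) -` F \<inter> space M)"
      using sets.sets_into_space[OF G] by auto
    then show ?thesis by simp
  qed
  have "emeasure M {\<omega>\<in>G. corner n (Y \<omega>) \<in> F} = emeasure M (\<Union>b\<in>R. E b)"
  proof (rule emeasure_eq_AE)
    show "AE \<omega> in M. \<omega> \<in> {\<omega>\<in>G. corner n (Y \<omega>) \<in> F} \<longleftrightarrow> \<omega> \<in> (\<Union>b\<in>R. E b)"
      using graph
    proof eventually_elim
      case (elim \<omega>)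
      show ?case
      proof (cases "\<omega> \<in> G")
        case True
        have diag: "Y \<omega> (i, i) = 0" if "i < n" for i using elim True that by blast
        have sym: "Y \<omega> (j, i) = Y \<omega> (i, j)"
          and val: "Y \<omega> (i, j) \<in> {0, 1}" if "i < n" "j < n" for i j
          using elim True that by blast+
        have E: "corner n (Y \<omega>) = graph_matrix n b" if "\<omega> \<in> E b" for b
        proof (rule ext)
          fix p :: "nat \<times> nat" obtain i j where p: "p = (i, j)" by (cases p)
          have Eb: "Y \<omega> (i, j) = of_bool (b (i, j))" if "i < j" "j < n" for i j
            using \<open>\<omega> \<in> E b\<close> that unfolding E_def by blast
          consider "i < j" "j < n" | "j < i" "i < n" | "i = j" "i < n" | "\<not> (i < n \<and> j < n)" by linarith
          then have "corner n (Y \<omega>) (i, j) = graph_matrix n b (i, j)"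
          proof cases
            case 1 then show ?thesis by (simp add: corner_def graph_matrix_def Eb)
          next
            case 2 then show ?thesis
              using sym[of j i] by (simp add: corner_def graph_matrix_def Eb)
          next
            case 3 then show ?thesis by (simp add: corner_def graph_matrix_def diag)
          next
            case 4
            then have "(i, j) \<notin> {..<n} \<times> {..<n}" by auto
            then show ?thesis by (simp only: corner_def graph_matrix_def restrict_apply if_False)
          qed
          then show "corner n (Y \<omega>) p = graph_matrix n b p" by (simp add: p)
        qed
        have "\<omega> \<in> E (restrict (\<lambda>p. Y \<omega> p = 1) (upairs n))"
          unfolding E_def
        proof (intro CollectI conjI allI impI)
          fix j i assume "j < n" "i < j"
          then show "Y \<omega> (i, j) = of_bool (restrict (\<lambda>p. Y \<omega> p = 1) (upairs n) (i, j))"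
            using val[of i j] by (auto simp: upairs_def)
        qed (rule True)
        then obtain c where c: "c \<in> upairs n \<rightarrow>\<^sub>E UNIV" "\<omega> \<in> E c" by (meson restrict_PiE_iff UNIV_I)
        then have "corner n (Y \<omega>) = graph_matrix n c" by (intro E)
        with c True have "\<omega> \<in> (\<Union>b\<in>R. E b)" if "corner n (Y \<omega>) \<in> F"
          using that by (auto simp: R_def)
        moreover have "corner n (Y \<omega>) \<in> F" if "\<omega> \<in> (\<Union>b\<in>R. E b)"
          using that E by (auto simp: R_def)
        ultimately show ?thesis using True by blast
      qed (auto simp: E_def)
    qed
  qed (use cm R in auto)
  also have "\<dots> = (\<Sum>b\<in>R. emeasure M (E b))"
    unfolding E_def
    by (rule sum_emeasure[symmetric], use E_sets[unfolded E_def] in blast, rule disjoint_family_on_mono[OF _ disjoint_edge_patterns],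
        use R in \<open>auto simp: R_def\<close>)
  finally show ?thesis unfolding R_def E_def .
qed

text \<open>
  Every finite set of entries lies in some corner, and the finite-dimensional laws determine the law.
\<close>

lemma distr_eq_if_corners_eq:
  assumes M: "prob_space M" and X: "random_matrix M X" and Y: "random_matrix M Y"
    and eq: "\<And>n. n \<ge> 1 \<Longrightarrow> distr M (corner_space n) (\<lambda>\<omega>. corner n (X \<omega>)) =
      distr M (corner_space n) (\<lambda>\<omega>. corner n (Y \<omega>))"
  shows "distr M (\<Pi>\<^sub>M p\<in>UNIV. borel) X = distr M (\<Pi>\<^sub>M p\<in>UNIV. borel) Y"
proof (rule measure_eqI_PiM_infinite)
  interpret prob_space M by fact
  interpret DX: prob_space "distr M (\<Pi>\<^sub>M p\<in>UNIV. borel) X" by (rule prob_space_distr) (rule X)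
  show "finite_measure (distr M (\<Pi>\<^sub>M p\<in>UNIV. borel) X)" by (rule DX.finite_measure_axioms)
  fix C :: "nat \<times> nat \<Rightarrow> real set" and J :: "(nat \<times> nat) set"
  assume J: "finite J" and C: "\<And>p. p \<in> J \<Longrightarrow> C p \<in> sets borel"
  define n where "n = Suc (Max (insert 0 (fst ` J \<union> snd ` J)))"
  have Jn: "J \<subseteq> {..<n} \<times> {..<n}"
  proof
    fix p assume "p \<in> J"
    then have "fst p \<in> insert 0 (fst ` J \<union> snd ` J)" "snd p \<in> insert 0 (fst ` J \<union> snd ` J)" by auto
    then show "p \<in> {..<n} \<times> {..<n}"
      using J by (cases p) (simp add: n_def less_Suc_eq_le)
  qed
  let ?F = "{y \<in> space (corner_space n). \<forall>p\<in>J. y p \<in> C p}"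
  have F: "?F \<in> sets (corner_space n)"
  proof (intro sets.sets_Collect_finite_All J)
    fix p assume "p \<in> J"
    then have "(\<lambda>y. y p) \<in> borel_measurable (corner_space n)"
      using Jn by (intro measurable_component_singleton) auto
    from measurable_sets[OF this C[OF \<open>p \<in> J\<close>]]
    show "{y \<in> space (corner_space n). y p \<in> C p} \<in> sets (corner_space n)"
      by (simp add: vimage_def Int_def conj_commute)
  qed
  have "emeasure (distr M (\<Pi>\<^sub>M p\<in>UNIV. borel) Z) (prod_emb UNIV (\<lambda>_. borel) J (Pi\<^sub>E J C)) =
     emeasure (distr M (corner_space n) (\<lambda>\<omega>. corner n (Z \<omega>))) ?F" if Z: "random_matrix M Z" for Z
  proof -
    have "corner n x \<in> ?F \<longleftrightarrow> x \<in> prod_emb UNIV (\<lambda>_. borel) J (Pi\<^sub>E J C)" for x :: "nat \<times> nat \<Rightarrow> real"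
    proof -
      have "corner n x p = x p" if "p \<in> J" for p using Jn that by (auto simp: corner_def)
      moreover have "corner n x \<in> space (corner_space n)" by (simp add: corner_def space_PiM)
      ultimately show ?thesis by (simp add: prod_emb_iff PiE_iff)
    qed
    then have "Z -` prod_emb UNIV (\<lambda>_. borel) J (Pi\<^sub>E J C) \<inter> space M = (\<lambda>\<omega>. corner n (Z \<omega>)) -` ?F \<inter> space M"
      by blast
    moreover have "prod_emb UNIV (\<lambda>_. borel) J (Pi\<^sub>E J C) \<in> sets (\<Pi>\<^sub>M p\<in>UNIV. borel)"
      using J C by (intro sets_PiM_I) auto
    ultimately show ?thesis
      by (simp only: emeasure_distr[OF measurable_corner[OF Z] F] emeasure_distr[OF Z])
  qed
  then show "emeasure (distr M (\<Pi>\<^sub>M p\<in>UNIV. borel) X) (prod_emb UNIV (\<lambda>_. borel) J (Pi\<^sub>E J C)) =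
      emeasure (distr M (\<Pi>\<^sub>M p\<in>UNIV. borel) Y) (prod_emb UNIV (\<lambda>_. borel) J (Pi\<^sub>E J C))"
    using X Y eq[of n] by (simp add: n_def)
qed auto


section \<open>Two representations of the same measure\<close>

lemma emeasure_point_sum:
  "F \<in> sets borel \<Longrightarrow> emeasure (point_sum I f) F = emeasure (count_space I) {i\<in>I. f i \<in> F}"
  unfolding point_sum_def by (subst emeasure_distr) (auto simp: Int_def vimage_def conj_commute)

text \<open>The atoms of a sum of point masses are the positions of the masses.\<close>

lemma point_sum_eq_imp_image_eq:
  fixes f :: "'i \<Rightarrow> 'b::t1_space" and g :: "'j \<Rightarrow> 'b"
  assumes "point_sum I f = point_sum J g"
  shows "f ` I = g ` J"
proof -
  have *: "x \<in> f ` I \<longleftrightarrow> emeasure (point_sum I f) {x} \<noteq> 0" for x and I :: "'k set" and f :: "'k \<Rightarrow> 'b"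
  proof -
    have "emeasure (point_sum I f) {x} = emeasure (count_space I) {i\<in>I. f i \<in> {x}}"
      by (rule emeasure_point_sum) simp
    also have "\<dots> = 0 \<longleftrightarrow> {i\<in>I. f i \<in> {x}} = {}"
      by (subst emeasure_count_space_eq_0) auto
    finally show ?thesis by auto
  qed
  show ?thesis by (intro set_eqI) (simp only: *[of _ f] *[of _ g] assms)
qed

text \<open>
  As the points are distinct, each point of the first representation occurs exactly once in the second;
  the atom at \<open>(x, y, a)\<close> then shows that the edge between \<open>x\<close> and \<open>y\<close> is the same in both.
\<close>

lemma representation_unique_up_to_bijection:
  fixes S\<^sub>1 S\<^sub>2 :: "nat \<Rightarrow> 'a::polish_space"
  assumes inj: "inj_on S\<^sub>1 I\<^sub>1" "inj_on S\<^sub>2 I\<^sub>2"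
    and eq: "point_sum (I\<^sub>1 \<times> I\<^sub>1) (\<lambda>(i, j). (S\<^sub>1 i, S\<^sub>1 j, A\<^sub>1 (i, j))) =
      point_sum (I\<^sub>2 \<times> I\<^sub>2) (\<lambda>(i, j). (S\<^sub>2 i, S\<^sub>2 j, A\<^sub>2 (i, j) :: real))"
  obtains \<rho> where "bij_betw \<rho> I\<^sub>1 I\<^sub>2" "\<And>i j. i \<in> I\<^sub>1 \<Longrightarrow> j \<in> I\<^sub>1 \<Longrightarrow> A\<^sub>1 (i, j) = A\<^sub>2 (\<rho> i, \<rho> j)"
proof -
  have im: "(\<lambda>(i, j). (S\<^sub>1 i, S\<^sub>1 j, A\<^sub>1 (i, j))) ` (I\<^sub>1 \<times> I\<^sub>1) = (\<lambda>(i, j). (S\<^sub>2 i, S\<^sub>2 j, A\<^sub>2 (i, j))) ` (I\<^sub>2 \<times> I\<^sub>2)"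
    by (rule point_sum_eq_imp_image_eq[OF eq])
  have "S\<^sub>1 ` I\<^sub>1 = S\<^sub>2 ` I\<^sub>2"
  proof -
    have "fst ` (\<lambda>(i, j). (S i, S j, A (i, j))) ` (I \<times> I) = S ` I" for S :: "nat \<Rightarrow> 'a" and A :: "nat \<times> nat \<Rightarrow> real" and I
    proof -
      have "fst ` (\<lambda>(i, j). (S i, S j, A (i, j))) ` (I \<times> I) = S ` fst ` (I \<times> I)"
        by (simp only: image_image split_beta' fst_conv)
      also have "fst ` (I \<times> I) = I" by auto
      finally show ?thesis .
    qed
    from this[of S\<^sub>1 A\<^sub>1 I\<^sub>1] this[of S\<^sub>2 A\<^sub>2 I\<^sub>2] im show ?thesis by simp
  qed
  define \<rho> where "\<rho> i = the_inv_into I\<^sub>2 S\<^sub>2 (S\<^sub>1 i)" for i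
  have \<rho>: "\<rho> i \<in> I\<^sub>2" "S\<^sub>2 (\<rho> i) = S\<^sub>1 i" if "i \<in> I\<^sub>1" for i
    using that \<open>S\<^sub>1 ` I\<^sub>1 = S\<^sub>2 ` I\<^sub>2\<close> inj(2) unfolding \<rho>_def
    by (auto intro!: the_inv_into_into f_the_inv_into_f)
  show ?thesis
  proof (rule that)
    have "bij_betw S\<^sub>1 I\<^sub>1 (S\<^sub>2 ` I\<^sub>2)" using inj(1) \<open>S\<^sub>1 ` I\<^sub>1 = S\<^sub>2 ` I\<^sub>2\<close> by (auto simp: bij_betw_def)
    moreover have "bij_betw (the_inv_into I\<^sub>2 S\<^sub>2) (S\<^sub>2 ` I\<^sub>2) I\<^sub>2"
      using inj(2) by (intro bij_betw_the_inv_into) (auto simp: bij_betw_def)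
    ultimately show "bij_betw \<rho> I\<^sub>1 I\<^sub>2"
      unfolding \<rho>_def by (rule bij_betw_trans[unfolded comp_def])
    fix i j assume ij: "i \<in> I\<^sub>1" "j \<in> I\<^sub>1"
    then have "(S\<^sub>1 i, S\<^sub>1 j, A\<^sub>1 (i, j)) \<in> (\<lambda>(i, j). (S\<^sub>2 i, S\<^sub>2 j, A\<^sub>2 (i, j))) ` (I\<^sub>2 \<times> I\<^sub>2)"
      unfolding im[symmetric] by force
    then obtain k l where kl: "k \<in> I\<^sub>2" "l \<in> I\<^sub>2" "S\<^sub>1 i = S\<^sub>2 k" "S\<^sub>1 j = S\<^sub>2 l" "A\<^sub>1 (i, j) = A\<^sub>2 (k, l)"
      by auto
    then have "k = \<rho> i" "l = \<rho> j" using \<rho> ij inj(2) by (metis inj_onD)+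
    with kl show "A\<^sub>1 (i, j) = A\<^sub>2 (\<rho> i, \<rho> j)" by simp
  qed
qed

lemma bij_betw_bijections:
  assumes "bij_betw \<rho> J J'"
  shows "bij_betw (\<lambda>f. restrict (\<rho> \<circ> f) I) (bijections I J) (bijections I J')"
proof (rule bij_betw_byWitness[where f' = "\<lambda>f. restrict (the_inv_into J \<rho> \<circ> f) I"])
  have inv: "bij_betw (the_inv_into J \<rho>) J' J" using assms by (rule bij_betw_the_inv_into)
  have *: "(\<lambda>f. restrict (\<sigma> \<circ> f) I) ` bijections I K \<subseteq> bijections I K'" if "bij_betw \<sigma> K K'" for \<sigma> :: "'x \<Rightarrow> 'y" and K K'
  proof (rule image_subsetI)
    fix f assume "f \<in> bijections I K"
    then have b: "bij_betw (\<sigma> \<circ> f) I K'" using that by (auto simp: bijections_def intro: bij_betw_trans)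
    then have "bij_betw (restrict (\<sigma> \<circ> f) I) I K'" by (subst bij_betw_cong[of _ _ "\<sigma> \<circ> f"]) auto
    then show "restrict (\<sigma> \<circ> f) I \<in> bijections I K'"
      using bij_betwE[OF b] by (auto simp: bijections_def)
  qed
  show "(\<lambda>f. restrict (\<rho> \<circ> f) I) ` bijections I J \<subseteq> bijections I J'" using assms by (rule *)
  show "(\<lambda>f. restrict (the_inv_into J \<rho> \<circ> f) I) ` bijections I J' \<subseteq> bijections I J" using inv by (rule *)
  have i: "inj_on \<rho> J" "\<rho> ` J = J'" using assms by (auto simp: bij_betw_def)
  show "\<forall>f\<in>bijections I J. restrict (the_inv_into J \<rho> \<circ> restrict (\<rho> \<circ> f) I) I = f"
    using i by (auto simp: bijections_def the_inv_into_f_f PiE_iff extensional_def fun_eq_iff restrict_def)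
  show "\<forall>f\<in>bijections I J'. restrict (\<rho> \<circ> restrict (the_inv_into J \<rho> \<circ> f) I) I = f"
    using i by (auto simp: bijections_def f_the_inv_into_f PiE_iff extensional_def fun_eq_iff restrict_def)
qed


section \<open>Laws of i.i.d. representations\<close>

lemma measurable_PiM_UNIV_borel:
  "(\<And>i. (\<lambda>\<omega>. X \<omega> i) \<in> borel_measurable M) \<Longrightarrow> X \<in> M \<rightarrow>\<^sub>M (\<Pi>\<^sub>M i\<in>UNIV. borel)"
  by (rule measurable_PiM_single'[of UNIV "\<lambda>i \<omega>. X \<omega> i" M "\<lambda>_. borel"]) simp_all

text \<open>
  The first \<open>n\<close> members of an i.i.d. sequence have the same joint law as any \<open>n\<close> distinct members.
\<close>

lemma nn_integral_edge_prob_reindex: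
  fixes \<mu> :: "'a::polish_space measure"
  assumes \<mu>: "prob_space \<mu>" "sets \<mu> = sets borel" and W: "connection_kernel W" and l: "inj_on l {..<n}"
  shows "(\<integral>\<^sup>+s. ennreal (edge_prob W (\<lambda>i. s (l i)) n a) \<partial>(\<Pi>\<^sub>M k\<in>(UNIV::nat set). \<mu>)) =
    (\<integral>\<^sup>+s. ennreal (edge_prob W s n a) \<partial>(\<Pi>\<^sub>M k\<in>(UNIV::nat set). \<mu>))"
proof -
  have *: "(\<integral>\<^sup>+s. ennreal (edge_prob W (\<lambda>i. s (l i)) n a) \<partial>(\<Pi>\<^sub>M k\<in>(UNIV::nat set). \<mu>)) =
      (\<integral>\<^sup>+s. ennreal (edge_prob W s n a) \<partial>(\<Pi>\<^sub>M k\<in>{..<n}. \<mu>))"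
    if l: "inj_on l {..<n}" for l :: "nat \<Rightarrow> nat"
  proof -
    have "(\<lambda>s. edge_prob W s n a) \<in> borel_measurable (\<Pi>\<^sub>M k\<in>{..<n}. \<mu>)"
    proof (rule measurable_edge_prob[OF W])
      fix i assume "i < n"
      then have "(\<lambda>s. s i) \<in> (\<Pi>\<^sub>M k\<in>{..<n}. \<mu>) \<rightarrow>\<^sub>M \<mu>" by (intro measurable_component_singleton) simp
      then show "(\<lambda>s. s i) \<in> (\<Pi>\<^sub>M k\<in>{..<n}. \<mu>) \<rightarrow>\<^sub>M borel" using \<mu>(2) by (simp cong: measurable_cong_sets)
    qed
    note [measurable] = this
    have "(\<Pi>\<^sub>M k\<in>{..<n}. \<mu>) = distr (\<Pi>\<^sub>M k\<in>UNIV. \<mu>) (\<Pi>\<^sub>M k\<in>{..<n}. \<mu>) (\<lambda>s. \<lambda>k\<in>{..<n}. s (l k))"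
      by (rule distr_PiM_reindex[symmetric]) (use \<mu> l in auto)
    then have "(\<integral>\<^sup>+s. ennreal (edge_prob W s n a) \<partial>(\<Pi>\<^sub>M k\<in>{..<n}. \<mu>)) =
       (\<integral>\<^sup>+s. ennreal (edge_prob W s n a) \<partial>(distr (\<Pi>\<^sub>M k\<in>UNIV. \<mu>) (\<Pi>\<^sub>M k\<in>{..<n}. \<mu>) (\<lambda>s. \<lambda>k\<in>{..<n}. s (l k))))"
      by simp
    also have "\<dots> = (\<integral>\<^sup>+s. ennreal (edge_prob W (\<lambda>k\<in>{..<n}. s (l k)) n a) \<partial>(\<Pi>\<^sub>M k\<in>UNIV. \<mu>))"
      by (rule nn_integral_distr) auto
    also have "\<dots> = (\<integral>\<^sup>+s. ennreal (edge_prob W (\<lambda>i. s (l i)) n a) \<partial>(\<Pi>\<^sub>M k\<in>UNIV. \<mu>))"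
      by (intro nn_integral_cong arg_cong[where f = ennreal] edge_prob_cong) auto
    finally show ?thesis by simp
  qed
  show ?thesis using *[OF l] *[of "\<lambda>i. i"] by simp
qed

text \<open>
  Given \<open>N = n\<close>, the points are i.i.d. and the probability of a pattern is the mean of its conditional
  probability. The result does not involve \<open>l\<close>: given its size, the adjacency matrix of an i.i.d.
  representation is exchangeable.
\<close>

lemma iid_representation_pattern:
  fixes \<xi> :: "'w \<Rightarrow> ('a::polish_space \<times> 'a \<times> real) measure"
  assumes M: "prob_space M" and gr: "graph_representation M W \<xi> N S A" and W: "connection_kernel W"
    and \<mu>: "prob_space \<mu>" "sets \<mu> = sets borel" and iid: "iid M \<mu> S"
    and ind: "independent M (count_space UNIV) N (\<Pi>\<^sub>M k\<in>UNIV. borel) S"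
    and l: "l \<in> bijections {..<n} {..<n}"
  shows "emeasure M {\<omega>\<in>space M. N \<omega> = enat n \<and> (\<forall>j<n. \<forall>i<j. A \<omega> (l i, l j) = of_bool (a i j))} =
    emeasure M {\<omega>\<in>space M. N \<omega> = enat n} * (\<integral>\<^sup>+s. ennreal (edge_prob W s n a) \<partial>(\<Pi>\<^sub>M k\<in>UNIV. \<mu>))"
proof -
  interpret prob_space M by fact
  have rep: "representation M \<xi> N S A" using gr by (simp add: graph_representation_def)
  note N[measurable] = representation_measurable(1)[OF rep] and S1 = representation_measurable(2)[OF rep]
  have S[measurable]: "S \<in> M \<rightarrow>\<^sub>M (\<Pi>\<^sub>M k\<in>UNIV. borel)" using rep by (simp add: representation_def)
  have ln: "l i < n" if "i < n" for i
    using l that by (auto simp: bijections_def bij_betw_def)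
  have linj: "inj_on l {..<n}" using l by (auto simp: bijections_def bij_betw_def)
  let ?P = "\<Pi>\<^sub>M k\<in>(UNIV::nat set). \<mu>" and ?B = "\<Pi>\<^sub>M k\<in>(UNIV::nat set). (borel :: 'a measure)"
  have sP: "sets ?P = sets ?B" by (rule sets_PiM_UNIV_borel_cong) (rule \<mu>)
  interpret P: prob_space ?P by (intro prob_space_PiM \<mu>)
  have Sl: "distr M ?B S = ?P"
    using iid_iff_distr[OF M \<mu>(1)] iid sP by (simp cong: distr_cong)
  define G where "G = {\<omega>\<in>space M. N \<omega> = enat n}"
  have G: "G \<in> sets (points_algebra M N S)" unfolding G_def by (rule points_algebra(3)[OF N S1])
  have E: "(\<lambda>p. edge_prob W (\<lambda>i. snd p (l i)) n a) \<in> borel_measurable (count_space UNIV \<Otimes>\<^sub>M ?B)"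
    by (intro measurable_edge_prob[OF W] measurable_compose[OF measurable_snd measurable_component_singleton]) simp
  have "(\<lambda>p. indicator {enat n} (fst p) :: ennreal) \<in> borel_measurable (count_space UNIV \<Otimes>\<^sub>M ?B)"
    by (rule measurable_compose[OF measurable_fst]) simp
  then have m: "(\<lambda>p. ennreal (edge_prob W (\<lambda>i. snd p (l i)) n a) * indicator {enat n} (fst p))
      \<in> borel_measurable (count_space UNIV \<Otimes>\<^sub>M ?B)"
    by (intro borel_measurable_times_ennreal measurable_compose[OF E measurable_ennreal])
  have [measurable]: "(\<lambda>s. edge_prob W (\<lambda>i. s (l i)) n a) \<in> borel_measurable ?P"
    unfolding measurable_cong_sets[OF sP refl] by (rule measurable_edge_prob[OF W]) measurable
  have "{\<omega>\<in>space M. N \<omega> = enat n \<and> (\<forall>j<n. \<forall>i<j. A \<omega> (l i, l j) = of_bool (a i j))} =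
     {\<omega>\<in>G. \<forall>j<n. \<forall>i<j. A \<omega> (l i, l j) = of_bool (a i j)}" by (simp add: G_def)
  also have "emeasure M \<dots> = (\<integral>\<^sup>+\<omega>. ennreal (edge_prob W (\<lambda>i. S \<omega> (l i)) n a) * indicator G \<omega> \<partial>M)"
    by (rule graph_representation_pattern[OF M gr W linj G]) (use ln in \<open>simp add: G_def\<close>)
  also have "\<dots> = (\<integral>\<^sup>+\<omega>. (\<lambda>p. ennreal (edge_prob W (\<lambda>i. snd p (l i)) n a) * indicator {enat n} (fst p)) (N \<omega>, S \<omega>) \<partial>M)"
    by (intro nn_integral_cong) (simp add: G_def indicator_def)
  also have "\<dots> = (\<integral>\<^sup>+p. ennreal (edge_prob W (\<lambda>i. snd p (l i)) n a) * indicator {enat n} (fst p)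
      \<partial>distr M (count_space UNIV \<Otimes>\<^sub>M ?B) (\<lambda>\<omega>. (N \<omega>, S \<omega>)))"
    by (intro nn_integral_distr[symmetric] measurable_Pair N S) (simp add: m)
  also have "\<dots> = (\<integral>\<^sup>+p. ennreal (edge_prob W (\<lambda>i. snd p (l i)) n a) * indicator {enat n} (fst p)
      \<partial>(distr M (count_space UNIV) N \<Otimes>\<^sub>M ?P))"
    by (simp add: distr_independent[OF M ind] Sl)
  also have "\<dots> = (\<integral>\<^sup>+k. \<integral>\<^sup>+s. ennreal (edge_prob W (\<lambda>i. s (l i)) n a) * indicator {enat n} k \<partial>?P
      \<partial>distr M (count_space UNIV) N)"
  proof (subst P.nn_integral_fst[symmetric])
    have eq: "sets (distr M (count_space UNIV) N \<Otimes>\<^sub>M ?P) = sets (count_space UNIV \<Otimes>\<^sub>M ?B)"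
      by (intro sets_pair_measure_cong sP) simp
    show "(\<lambda>p. ennreal (edge_prob W (\<lambda>i. snd p (l i)) n a) * indicator {enat n} (fst p))
        \<in> borel_measurable (distr M (count_space UNIV) N \<Otimes>\<^sub>M ?P)"
      unfolding measurable_cong_sets[OF eq refl] by (rule m)
  qed simp
  also have "\<dots> = (\<integral>\<^sup>+k. (\<integral>\<^sup>+s. ennreal (edge_prob W (\<lambda>i. s (l i)) n a) \<partial>?P) * indicator {enat n} k
      \<partial>distr M (count_space UNIV) N)"
    by (intro nn_integral_cong nn_integral_multc) measurable
  also have "\<dots> = (\<integral>\<^sup>+s. ennreal (edge_prob W (\<lambda>i. s (l i)) n a) \<partial>?P) * emeasure M G"
    by (subst nn_integral_cmult_indicator) (auto simp: emeasure_distr G_def vimage_def Int_def conj_commute)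
  finally show ?thesis
    by (simp add: nn_integral_edge_prob_reindex[OF \<mu> W linj] G_def mult.commute)
qed

lemma indices_enat: "indices (enat n) = {..<n}"
  by auto

lemma bij_betw_indices_imp_eq:
  assumes "bij_betw \<rho> (indices N) (indices N')"
  shows "N = N'"
proof -
  have *: "finite (indices N) \<longleftrightarrow> N \<noteq> \<infinity>" for N :: enat by (cases N) simp_all
  have inf: "N = \<infinity> \<longleftrightarrow> N' = \<infinity>"
    using bij_betw_finite[OF assms] unfolding * by blast
  show ?thesis
  proof (cases N)
    case (enat n)
    then obtain n' where n': "N' = enat n'" using inf by (cases N') simp_all
    show ?thesis using bij_betw_same_card[OF assms] unfolding enat n' indices_enat by simp
  qed (use inf in simp)
qed

lemma AE_representations_isomorphic:
  fixes \<xi> :: "'w \<Rightarrow> ('a::polish_space \<times> 'a \<times> real) measure"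
  assumes "representation M \<xi> N\<^sub>1 S\<^sub>1 A\<^sub>1" "representation M \<xi> N\<^sub>2 S\<^sub>2 A\<^sub>2"
  shows "AE \<omega> in M. N\<^sub>1 \<omega> = N\<^sub>2 \<omega> \<and> (\<exists>\<rho>. bij_betw \<rho> (indices (N\<^sub>1 \<omega>)) (indices (N\<^sub>1 \<omega>)) \<and>
    (\<forall>i\<in>indices (N\<^sub>1 \<omega>). \<forall>j\<in>indices (N\<^sub>1 \<omega>). A\<^sub>1 \<omega> (i, j) = A\<^sub>2 \<omega> (\<rho> i, \<rho> j)))"
proof -
  have "AE \<omega> in M. inj_on (S\<^sub>1 \<omega>) (indices (N\<^sub>1 \<omega>)) \<and>
      \<xi> \<omega> = point_sum (indices (N\<^sub>1 \<omega>) \<times> indices (N\<^sub>1 \<omega>)) (\<lambda>(i, j). (S\<^sub>1 \<omega> i, S\<^sub>1 \<omega> j, A\<^sub>1 \<omega> (i, j)))"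
    using assms(1) unfolding representation_def by auto
  moreover have "AE \<omega> in M. inj_on (S\<^sub>2 \<omega>) (indices (N\<^sub>2 \<omega>)) \<and>
      \<xi> \<omega> = point_sum (indices (N\<^sub>2 \<omega>) \<times> indices (N\<^sub>2 \<omega>)) (\<lambda>(i, j). (S\<^sub>2 \<omega> i, S\<^sub>2 \<omega> j, A\<^sub>2 \<omega> (i, j)))"
    using assms(2) unfolding representation_def by auto
  ultimately show ?thesis
  proof eventually_elim
    case (elim \<omega>)
    then have eq: "point_sum (indices (N\<^sub>1 \<omega>) \<times> indices (N\<^sub>1 \<omega>)) (\<lambda>(i, j). (S\<^sub>1 \<omega> i, S\<^sub>1 \<omega> j, A\<^sub>1 \<omega> (i, j))) =
        point_sum (indices (N\<^sub>2 \<omega>) \<times> indices (N\<^sub>2 \<omega>)) (\<lambda>(i, j). (S\<^sub>2 \<omega> i, S\<^sub>2 \<omega> j, A\<^sub>2 \<omega> (i, j)))" by simp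
    obtain \<rho> where \<rho>: "bij_betw \<rho> (indices (N\<^sub>1 \<omega>)) (indices (N\<^sub>2 \<omega>))"
        "\<And>i j. i \<in> indices (N\<^sub>1 \<omega>) \<Longrightarrow> j \<in> indices (N\<^sub>1 \<omega>) \<Longrightarrow> A\<^sub>1 \<omega> (i, j) = A\<^sub>2 \<omega> (\<rho> i, \<rho> j)"
      by (rule representation_unique_up_to_bijection[OF _ _ eq]) (use elim in blast)+
    moreover have "N\<^sub>1 \<omega> = N\<^sub>2 \<omega>" by (rule bij_betw_indices_imp_eq[OF \<rho>(1)])
    ultimately show ?case by auto
  qed
qed

text \<open>
  Outcome by outcome, the number of relabellings under which the pattern \<open>a\<close> appears is the same for
  both representations: if \<open>\<rho>\<close> carries the first to the second, the relabelling \<open>f\<close> of the first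
  corresponds to \<open>\<rho> \<circ> f\<close> for the second. By exchangeability the mean of this number is \<open>n!\<close> times the
  probability of the pattern.
\<close>

lemma iid_representations_same_law:
  fixes \<xi> :: "'w \<Rightarrow> ('a::polish_space \<times> 'a \<times> real) measure"
  assumes M: "prob_space M"
    and r1: "iid_representation M \<xi> N\<^sub>1 S\<^sub>1 A\<^sub>1" and r2: "iid_representation M \<xi> N\<^sub>2 S\<^sub>2 A\<^sub>2"
  shows "emeasure M {\<omega>\<in>space M. N\<^sub>1 \<omega> = enat n \<and> (\<forall>j<n. \<forall>i<j. A\<^sub>1 \<omega> (i, j) = of_bool (a i j))} =
    emeasure M {\<omega>\<in>space M. N\<^sub>2 \<omega> = enat n \<and> (\<forall>j<n. \<forall>i<j. A\<^sub>2 \<omega> (i, j) = of_bool (a i j))}"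
proof -
  define E where "E N A f = {\<omega>\<in>space M. N \<omega> = enat n \<and> (\<forall>j<n. \<forall>i<j. A \<omega> (f i, f j) = of_bool (a i j))}"
    for N and A :: "'w \<Rightarrow> nat \<times> nat \<Rightarrow> real" and f :: "nat \<Rightarrow> nat"
  let ?B = "bijections {..<n} {..<n}"
  have fin: "finite ?B" by (rule finite_bijections) auto
  have rep: "representation M \<xi> N S A" if "iid_representation M \<xi> N S A" for N S A
    using that by (auto simp: iid_representation_def graph_representation_def)
  have *: "of_nat (card ?B) * emeasure M {\<omega>\<in>space M. N \<omega> = enat n \<and> (\<forall>j<n. \<forall>i<j. A \<omega> (i, j) = of_bool (a i j))} =
      (\<integral>\<^sup>+\<omega>. (\<Sum>f\<in>?B. indicator (E N A f) \<omega>) \<partial>M)" if r: "iid_representation M \<xi> N S A" for N S A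
  proof -
    note [measurable] = representation_measurable[OF rep[OF r]]
    have [measurable]: "E N A f \<in> sets M" for f unfolding E_def by measurable
    let ?i = "restrict (\<lambda>i. i) {..<n}"
    have i: "?i \<in> ?B" by (auto simp: bijections_def bij_betw_def inj_on_def)
    have "{\<omega>\<in>space M. N \<omega> = enat n \<and> (\<forall>j<n. \<forall>i<j. A \<omega> (i, j) = of_bool (a i j))} = E N A ?i"
      unfolding E_def by (intro Collect_cong conj_cong refl all_cong) simp
    moreover have "emeasure M (E N A f) = emeasure M (E N A ?i)" if "f \<in> ?B" for f
    proof -
      obtain W \<mu> where *: "graph_representation M W \<xi> N S A" "connection_kernel W" "prob_space \<mu>" "sets \<mu> = sets borel"
        "iid M \<mu> S" "independent M (count_space UNIV) N (\<Pi>\<^sub>M k\<in>UNIV. borel) S"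
        using r unfolding iid_representation_def by blast
      show ?thesis unfolding E_def
        using iid_representation_pattern[OF M * that] iid_representation_pattern[OF M * i] by simp
    qed
    ultimately have "of_nat (card ?B) * emeasure M {\<omega>\<in>space M. N \<omega> = enat n \<and> (\<forall>j<n. \<forall>i<j. A \<omega> (i, j) = of_bool (a i j))} =
        (\<Sum>f\<in>?B. emeasure M (E N A f))" by simp
    also have "\<dots> = (\<integral>\<^sup>+\<omega>. (\<Sum>f\<in>?B. indicator (E N A f) \<omega>) \<partial>M)"
      by (subst nn_integral_sum) auto
    finally show ?thesis .
  qed
  have "(\<integral>\<^sup>+\<omega>. (\<Sum>f\<in>?B. indicator (E N\<^sub>1 A\<^sub>1 f) \<omega>) \<partial>M) = (\<integral>\<^sup>+\<omega>. (\<Sum>f\<in>?B. indicator (E N\<^sub>2 A\<^sub>2 f) \<omega>) \<partial>M)"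
  proof (rule nn_integral_cong_AE)
    show "AE \<omega> in M. (\<Sum>f\<in>?B. indicator (E N\<^sub>1 A\<^sub>1 f) \<omega> :: ennreal) = (\<Sum>f\<in>?B. indicator (E N\<^sub>2 A\<^sub>2 f) \<omega>)"
      using AE_representations_isomorphic[OF rep[OF r1] rep[OF r2]]
    proof eventually_elim
      case (elim \<omega>)
      show ?case
      proof (cases "N\<^sub>1 \<omega> = enat n")
        case True
        obtain \<rho> where b: "bij_betw \<rho> (indices (N\<^sub>1 \<omega>)) (indices (N\<^sub>1 \<omega>))"
          and A: "\<forall>i\<in>indices (N\<^sub>1 \<omega>). \<forall>j\<in>indices (N\<^sub>1 \<omega>). A\<^sub>1 \<omega> (i, j) = A\<^sub>2 \<omega> (\<rho> i, \<rho> j)"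
          using elim by blast
        have \<rho>: "A\<^sub>1 \<omega> (i, j) = A\<^sub>2 \<omega> (\<rho> i, \<rho> j)" if "i < n" "j < n" for i j
          using A that unfolding True indices_enat by blast
        have \<rho>12: "bij_betw \<rho> {..<n} {..<n}" "N\<^sub>2 \<omega> = enat n"
          using b conjunct1[OF elim] unfolding True indices_enat by simp_all
        have "indicator (E N\<^sub>1 A\<^sub>1 f) \<omega> = (indicator (E N\<^sub>2 A\<^sub>2 (restrict (\<rho> \<circ> f) {..<n})) \<omega> :: ennreal)"
          if "f \<in> ?B" for f
        proof -
          have f: "f i < n" if "i < n" for i using \<open>f \<in> ?B\<close> that by (auto simp: bijections_def)
          have "(\<forall>j<n. \<forall>i<j. A\<^sub>1 \<omega> (f i, f j) = of_bool (a i j)) \<longleftrightarrow>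
            (\<forall>j<n. \<forall>i<j. A\<^sub>2 \<omega> (restrict (\<rho> \<circ> f) {..<n} i, restrict (\<rho> \<circ> f) {..<n} j) = of_bool (a i j))"
            by (intro all_cong) (use \<rho> f in simp)
          then show ?thesis using True \<rho>12(2) by (simp add: E_def indicator_def)
        qed
        then have "(\<Sum>f\<in>?B. indicator (E N\<^sub>1 A\<^sub>1 f) \<omega> :: ennreal) =
            (\<Sum>f\<in>?B. indicator (E N\<^sub>2 A\<^sub>2 (restrict (\<rho> \<circ> f) {..<n})) \<omega>)" by (intro sum.cong refl)
        also have "\<dots> = (\<Sum>f\<in>?B. indicator (E N\<^sub>2 A\<^sub>2 f) \<omega>)"
          by (rule sum.reindex_bij_betw[OF bij_betw_bijections[OF \<rho>12(1)]])
        finally show ?thesis .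
      qed (use elim in \<open>simp add: E_def\<close>)
    qed
  qed
  then have "of_nat (card ?B) * emeasure M {\<omega>\<in>space M. N\<^sub>1 \<omega> = enat n \<and> (\<forall>j<n. \<forall>i<j. A\<^sub>1 \<omega> (i, j) = of_bool (a i j))} =
    of_nat (card ?B) * emeasure M {\<omega>\<in>space M. N\<^sub>2 \<omega> = enat n \<and> (\<forall>j<n. \<forall>i<j. A\<^sub>2 \<omega> (i, j) = of_bool (a i j))}"
    by (simp only: *[OF r1] *[OF r2])
  moreover have "of_nat (card ?B) \<noteq> (0 :: ennreal)" "of_nat (card ?B) \<noteq> (\<top> :: ennreal)"
    using fin bijections_nonempty[of n] by auto
  ultimately show ?thesis by (simp only: ennreal_mult_cancel_left) blast
qed


section \<open>The limiting exchangeable matrix\<close>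

text \<open>
  The matrix of the random graph on an infinite i.i.d. sequence of points \<open>V\<^sub>i\<close>. The edge between \<open>i < j\<close>
  is present iff \<open>Z\<^sub>i\<^sub>j < W(V\<^sub>i, V\<^sub>j)\<close> with \<open>Z\<^sub>i\<^sub>j\<close> uniform, so it has conditional probability
  \<open>W(V\<^sub>i, V\<^sub>j)\<close>. The stated law does not depend on the injection \<open>l\<close>, which contains both joint
  exchangeability and the laws of the corners.
\<close>

lemma exchangeable_graph_matrix_exists:
  fixes \<mu> :: "'a::polish_space measure"
  assumes M: "prob_space M" and sup: "supports_uniforms M \<xi>"
    and \<mu>: "prob_space \<mu>" "sets \<mu> = sets borel" and W: "connection_kernel W"
  obtains X where "random_matrix M X"
    "\<And>\<omega> i j. X \<omega> (i, i) = 0 \<and> X \<omega> (i, j) \<in> {0, 1} \<and> X \<omega> (j, i) = X \<omega> (i, j)"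
    "\<And>n (l :: nat \<Rightarrow> nat) a. inj_on l {..<n} \<Longrightarrow>
      emeasure M {\<omega>\<in>space M. \<forall>j<n. \<forall>i<j. X \<omega> (l i, l j) = of_bool (a i j)} =
      (\<integral>\<^sup>+s. ennreal (edge_prob W s n a) \<partial>(\<Pi>\<^sub>M k\<in>UNIV. \<mu>))"
proof -
  interpret prob_space M by fact
  let ?P = "\<Pi>\<^sub>M k\<in>(UNIV::nat set). \<mu>" and ?B = "\<Pi>\<^sub>M k\<in>(UNIV::nat set). (borel :: 'a measure)"
  let ?U = "\<Pi>\<^sub>M p\<in>(UNIV::(nat \<times> nat) set). unif"
  have sP: "sets ?P = sets ?B" by (rule sets_PiM_UNIV_borel_cong) (rule \<mu>)
  have sP': "sets ?P = sets borel" unfolding sP by (rule sets_PiM_equal_borel)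
  have sU: "sets ?U = sets (\<Pi>\<^sub>M p\<in>(UNIV::(nat \<times> nat) set). borel)" by (rule sets_PiM_UNIV_borel_cong) simp
  have sU': "sets ?U = sets borel" unfolding sU by (rule sets_PiM_equal_borel)
  interpret P: prob_space ?P by (intro prob_space_PiM \<mu>)
  interpret u: prob_space unif by (rule prob_space_unif)
  interpret U: product_prob_space "\<lambda>_. unif" "UNIV :: (nat \<times> nat) set" by unfold_locales
  obtain V Z where V: "V \<in> borel_measurable M" and Z: "Z \<in> borel_measurable M"
    and VZ: "distr M (borel \<Otimes>\<^sub>M borel) (\<lambda>\<omega>. (V \<omega>, Z \<omega>)) = ?P \<Otimes>\<^sub>M ?U"
    by (rule supports_uniforms_transfer[OF M sup P.prob_space_axioms sP' U.P.prob_space_axioms sU'])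
  note [measurable] = V Z
  define X where "X \<omega> = (\<lambda>(i, j). of_bool (i \<noteq> j \<and> Z \<omega> (min i j, max i j) < W (V \<omega> i) (V \<omega> j)) :: real)" for \<omega>
  have Wsym: "W x y = W y x" and W01: "0 \<le> W x y" "W x y \<le> 1" for x y
    using W by (simp_all add: connection_kernel_def)
  have Vi[measurable]: "(\<lambda>\<omega>. V \<omega> i) \<in> borel_measurable M" for i
  proof -
    have "V \<in> M \<rightarrow>\<^sub>M ?B" using V unfolding measurable_cong_sets[OF refl sets_PiM_equal_borel] .
    then show ?thesis by (rule measurable_compose) simp
  qed
  have Zp[measurable]: "(\<lambda>\<omega>. Z \<omega> p) \<in> borel_measurable M" for p
  proof -
    have "Z \<in> M \<rightarrow>\<^sub>M (\<Pi>\<^sub>M p\<in>UNIV. borel)" using Z unfolding measurable_cong_sets[OF refl sets_PiM_equal_borel] .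
    then show ?thesis by (rule measurable_compose) simp
  qed
  have Wm: "(\<lambda>\<omega>. W (f \<omega>) (g \<omega>)) \<in> borel_measurable K" if "f \<in> borel_measurable K" "g \<in> borel_measurable K" for f g K
  proof -
    have "(\<lambda>(x, y). W x y) \<in> borel_measurable borel" using W by (simp add: connection_kernel_def)
    from measurable_compose[OF borel_measurable_Pair[OF that] this] show ?thesis by simp
  qed
  note [measurable] = Wm[OF Vi Vi]
  show ?thesis
  proof (rule that)
    show "random_matrix M X"
    proof (rule measurable_PiM_UNIV_borel)
      fix p show "(\<lambda>\<omega>. X \<omega> p) \<in> borel_measurable M"
        by (cases p) (simp add: X_def of_bool_def)
    qed
    show "X \<omega> (i, i) = 0 \<and> X \<omega> (i, j) \<in> {0, 1} \<and> X \<omega> (j, i) = X \<omega> (i, j)" for \<omega> i j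
      by (simp add: X_def Wsym[of "V \<omega> i" "V \<omega> j"] min.commute max.commute eq_commute[of i j])
    fix n :: nat and l :: "nat \<Rightarrow> nat" and a assume l: "inj_on l {..<n}"
    define q where "q = Max (insert 0 (l ` {..<n}))"
    have lq: "l ` {..<n} \<subseteq> {..<Suc q}" by (auto simp: q_def less_Suc_eq_le)
    note o = ordered_upairs[OF l lq]
    define C where "C s = {z. \<forall>(i, j)\<in>upairs n. (z (ordered l (i, j)) < W (s (l i)) (s (l j))) = a i j}"
      for s :: "nat \<Rightarrow> 'a" and z
    define H where "H = {p \<in> space (borel \<Otimes>\<^sub>M borel). snd p \<in> C (fst p)}"
    have sPU: "sets (?P \<Otimes>\<^sub>M ?U) = sets (borel \<Otimes>\<^sub>M borel)" by (intro sets_pair_measure_cong sP' sU')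
    have bc: "(\<lambda>s. s i) \<in> borel_measurable (borel :: (nat \<Rightarrow> 'a) measure)" for i
      using measurable_component_singleton[of i UNIV "\<lambda>_. borel :: 'a measure"]
      by (simp add: measurable_cong_sets[OF sets_PiM_equal_borel refl])
    have bd: "(\<lambda>z. z p) \<in> borel_measurable (borel :: (nat \<times> nat \<Rightarrow> real) measure)" for p
      using measurable_component_singleton[of p UNIV "\<lambda>_. borel :: real measure"]
      by (simp add: measurable_cong_sets[OF sets_PiM_equal_borel refl])
    have H: "H \<in> sets (borel \<Otimes>\<^sub>M borel)"
      unfolding H_def C_def mem_Collect_eq split_beta
    proof (intro sets.sets_Collect_finite_All finite_upairs)
      fix p assume "p \<in> upairs n"
      have [measurable]: "(\<lambda>x. W (fst x (l (fst p))) (fst x (l (snd p)))) \<in> borel_measurable ((borel :: (nat \<Rightarrow> 'a) measure) \<Otimes>\<^sub>M (borel :: (nat \<times> nat \<Rightarrow> real) measure))"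
        by (intro Wm measurable_compose[OF measurable_fst bc])
      have [measurable]: "(\<lambda>x. snd x (ordered l p)) \<in> borel_measurable ((borel :: (nat \<Rightarrow> 'a) measure) \<Otimes>\<^sub>M (borel :: (nat \<times> nat \<Rightarrow> real) measure))"
        by (intro measurable_compose[OF measurable_snd bd])
      show "{x \<in> space ((borel :: (nat \<Rightarrow> 'a) measure) \<Otimes>\<^sub>M borel). (snd x (ordered l (fst p, snd p)) < W (fst x (l (fst p))) (fst x (l (snd p)))) = a (fst p) (snd p)} \<in> sets (borel \<Otimes>\<^sub>M borel)"
        by simp
    qed
    have "X \<omega> (l i, l j) = of_bool (a i j) \<longleftrightarrow> (Z \<omega> (ordered l (i, j)) < W (V \<omega> (l i)) (V \<omega> (l j))) = a i j"
      if "i < j" "j < n" for i j \<omega>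
    proof -
      have "l i \<noteq> l j" using l that by (auto simp: inj_on_def)
      then show ?thesis by (auto simp: X_def ordered_def)
    qed
    then have "(\<forall>j<n. \<forall>i<j. X \<omega> (l i, l j) = of_bool (a i j)) \<longleftrightarrow> Z \<omega> \<in> C (V \<omega>)" for \<omega>
      unfolding C_def upairs_def by blast
    then have "{\<omega>\<in>space M. \<forall>j<n. \<forall>i<j. X \<omega> (l i, l j) = of_bool (a i j)} = (\<lambda>\<omega>. (V \<omega>, Z \<omega>)) -` H \<inter> space M"
      by (auto simp: H_def space_pair_measure)
    then have "emeasure M {\<omega>\<in>space M. \<forall>j<n. \<forall>i<j. X \<omega> (l i, l j) = of_bool (a i j)} = emeasure (?P \<Otimes>\<^sub>M ?U) H"
      using H by (simp add: VZ[symmetric] emeasure_distr)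
    also have "\<dots> = (\<integral>\<^sup>+s. emeasure ?U (Pair s -` H) \<partial>?P)"
      using H sPU by (intro U.P.emeasure_pair_measure_alt) simp
    also have "\<dots> = (\<integral>\<^sup>+s. ennreal (edge_prob W (\<lambda>i. s (l i)) n a) \<partial>?P)"
    proof (rule nn_integral_cong)
      fix s
      (* for fixed points \<open>s\<close>, the pattern restricts every uniform variable separately *)
      define D where "D q = {u. \<forall>(i, j)\<in>upairs n. ordered l (i, j) = q \<longrightarrow> (u < W (s (l i)) (s (l j))) = a i j}" for q
      have D: "D (ordered l (i, j)) = {u. (u < W (s (l i)) (s (l j))) = a i j}" if "(i, j) \<in> upairs n" for i j
        using that o(1) by (auto simp: D_def inj_on_def)
      have "Pair s -` H = C s" by (auto simp: H_def space_pair_measure)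
      also have "\<dots> = {z \<in> space ?U. \<forall>q\<in>ordered l ` upairs n. z q \<in> D q}"
        unfolding C_def using D by (auto simp: space_PiM)
      also have "emeasure ?U \<dots> = (\<Prod>q\<in>ordered l ` upairs n. emeasure unif (D q))"
        by (rule U.emeasure_PiM_Collect) (auto simp: D)
      also have "\<dots> = (\<Prod>q\<in>upairs n. emeasure unif (D (ordered l q)))"
        by (simp add: prod.reindex[OF o(1)])
      also have "\<dots> = (\<Prod>(i, j)\<in>upairs n. ennreal (pmf (bernoulli_pmf (W (s (l i)) (s (l j)))) (a i j)))"
      proof (intro prod.cong refl)
        fix q assume q: "q \<in> upairs n"
        obtain i j where ij: "q = (i, j)" by (cases q)
        let ?w = "W (s (l i)) (s (l j))"
        have lt: "emeasure unif {..<?w} = ennreal ?w" by (rule emeasure_unif_less[OF W01])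
        have "emeasure unif {u. (u < ?w) = a i j} = ennreal (pmf (bernoulli_pmf ?w) (a i j))"
        proof (cases "a i j")
          case True
          then show ?thesis using lt W01 by (simp add: lessThan_def)
        next
          case False
          then have "{u. (u < ?w) = a i j} = space unif - {..<?w}" by auto
          also have "emeasure unif \<dots> = emeasure unif (space unif) - emeasure unif {..<?w}"
            by (rule emeasure_compl) (auto simp: lt)
          also have "\<dots> = ennreal (1 - ?w)"
            unfolding lt u.emeasure_space_1 using W01[of "s (l i)" "s (l j)"] by (simp add: ennreal_minus flip: ennreal_1)
          finally show ?thesis using False W01 by simp
        qed
        then show "emeasure unif (D (ordered l q)) =
            (case q of (i, j) \<Rightarrow> ennreal (pmf (bernoulli_pmf (W (s (l i)) (s (l j)))) (a i j)))"
          using D q by (simp add: ij)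
      qed
      also have "\<dots> = ennreal (edge_prob W (\<lambda>i. s (l i)) n a)"
        unfolding edge_prob_upairs split_beta by (rule prod_ennreal) simp
      finally show "emeasure ?U (Pair s -` H) = ennreal (edge_prob W (\<lambda>i. s (l i)) n a)" .
    qed
    also have "\<dots> = (\<integral>\<^sup>+s. ennreal (edge_prob W s n a) \<partial>?P)"
      by (rule nn_integral_edge_prob_reindex[OF \<mu> W l])
    finally show "emeasure M {\<omega>\<in>space M. \<forall>j<n. \<forall>i<j. X \<omega> (l i, l j) = of_bool (a i j)} =
      (\<integral>\<^sup>+s. ennreal (edge_prob W s n a) \<partial>?P)" .
  qed
qed

text \<open>
  A single i.i.d. representation whose size takes every value \<open>n \<ge> 1\<close> with positive probability
  settles both existence and uniqueness. The matrix is built from the kernel and the point law of this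
  representation, and \<open>iid_representations_same_law\<close> transfers its property to all other ones.
  Positivity is what makes the conditional laws, and so the corners, determined.
\<close>

lemma exchangeable_limit_of_iid_representation:
  fixes \<zeta> :: "'w \<Rightarrow> ('a::polish_space \<times> 'a \<times> real) measure"
    and \<xi> :: "'w \<Rightarrow> 'b::topological_space measure"
  assumes M: "prob_space M" and sup: "supports_uniforms M \<xi>"
    and r0: "iid_representation M \<zeta> N\<^sub>0 S\<^sub>0 A\<^sub>0"
    and pos: "\<And>n. n \<ge> 1 \<Longrightarrow> emeasure M {\<omega>\<in>space M. N\<^sub>0 \<omega> = enat n} \<noteq> 0"
  shows "(\<exists>X. exchangeable_adjacency_limit M \<zeta> X) \<and>
    (\<forall>X Y. exchangeable_adjacency_limit M \<zeta> X \<longrightarrow> exchangeable_adjacency_limit M \<zeta> Y \<longrightarrow>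
       distr M (\<Pi>\<^sub>M p\<in>UNIV. borel) X = distr M (\<Pi>\<^sub>M p\<in>UNIV. borel) Y)"
proof (intro conjI allI impI)
  fix X Y assume X: "exchangeable_adjacency_limit M \<zeta> X" and Y: "exchangeable_adjacency_limit M \<zeta> Y"
  show "distr M (\<Pi>\<^sub>M p\<in>UNIV. borel) X = distr M (\<Pi>\<^sub>M p\<in>UNIV. borel) Y"
  proof (rule distr_eq_if_corners_eq[OF M])
    fix n :: nat assume n: "n \<ge> 1"
    have "distr (uniform_measure M {\<omega>\<in>space M. N\<^sub>0 \<omega> = enat n}) (corner_space n) (\<lambda>\<omega>. corner n (A\<^sub>0 \<omega>)) =
        distr M (corner_space n) (\<lambda>\<omega>. corner n (Z \<omega>))" if "exchangeable_adjacency_limit M \<zeta> Z" for Z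
      using that r0 n unfolding exchangeable_adjacency_limit_def by blast
    from this[OF X] this[OF Y]
    show "distr M (corner_space n) (\<lambda>\<omega>. corner n (X \<omega>)) = distr M (corner_space n) (\<lambda>\<omega>. corner n (Y \<omega>))"
      by (rule trans[OF sym])
  qed (use X Y in \<open>simp_all add: exchangeable_adjacency_limit_def\<close>)
next
  interpret prob_space M by fact
  obtain W \<mu> where W: "graph_representation M W \<zeta> N\<^sub>0 S\<^sub>0 A\<^sub>0" "connection_kernel W"
    and \<mu>: "prob_space \<mu>" "sets \<mu> = sets borel"
    and iid: "iid M \<mu> S\<^sub>0" "independent M (count_space UNIV) N\<^sub>0 (\<Pi>\<^sub>M k\<in>UNIV. borel) S\<^sub>0"
    using r0 unfolding iid_representation_def by blast
  obtain X where X: "random_matrix M X"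
    and graph: "\<And>\<omega> i j. X \<omega> (i, i) = 0 \<and> X \<omega> (i, j) \<in> {0, 1} \<and> X \<omega> (j, i) = X \<omega> (i, j)"
    and law: "\<And>n (l :: nat \<Rightarrow> nat) a. inj_on l {..<n} \<Longrightarrow>
      emeasure M {\<omega>\<in>space M. \<forall>j<n. \<forall>i<j. X \<omega> (l i, l j) = of_bool (a i j)} =
      (\<integral>\<^sup>+s. ennreal (edge_prob W s n a) \<partial>(\<Pi>\<^sub>M k\<in>UNIV. \<mu>))"
    by (rule exchangeable_graph_matrix_exists[OF M sup \<mu> W(2)]) blast
  have Xp: "(\<lambda>\<omega>. X \<omega> p) \<in> borel_measurable M" for p
    by (rule measurable_compose[OF X]) simp
  have corner: "emeasure M {\<omega>\<in>space M. corner n (\<lambda>(i, j). X \<omega> (\<pi> i, \<pi> j)) \<in> F} =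
      (\<Sum>b\<in>{b \<in> upairs n \<rightarrow>\<^sub>E UNIV. graph_matrix n b \<in> F}.
        (\<integral>\<^sup>+s. ennreal (edge_prob W s n (\<lambda>i j. b (i, j))) \<partial>(\<Pi>\<^sub>M k\<in>UNIV. \<mu>)))"
    and Xpi: "random_matrix M (\<lambda>\<omega> (i, j). X \<omega> (\<pi> i, \<pi> j))"
    if \<pi>: "inj_on \<pi> {..<n}" and F: "F \<in> sets (corner_space n)" for \<pi> :: "nat \<Rightarrow> nat" and n F
  proof -
    show Xpi: "random_matrix M (\<lambda>\<omega> (i, j). X \<omega> (\<pi> i, \<pi> j))"
      by (rule measurable_PiM_UNIV_borel) (simp add: split_beta Xp)
    have "emeasure M {\<omega>\<in>space M. corner n (\<lambda>(i, j). X \<omega> (\<pi> i, \<pi> j)) \<in> F} =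
      (\<Sum>b\<in>{b \<in> upairs n \<rightarrow>\<^sub>E UNIV. graph_matrix n b \<in> F}.
        emeasure M {\<omega>\<in>space M. \<forall>j<n. \<forall>i<j. (case (i, j) of (i, j) \<Rightarrow> X \<omega> (\<pi> i, \<pi> j)) = of_bool (b (i, j))})"
      by (rule emeasure_corner_graph_matrix[OF _ Xpi F]) (use graph in \<open>simp_all\<close>)
    also have "\<dots> = (\<Sum>b\<in>{b \<in> upairs n \<rightarrow>\<^sub>E UNIV. graph_matrix n b \<in> F}.
        (\<integral>\<^sup>+s. ennreal (edge_prob W s n (\<lambda>i j. b (i, j))) \<partial>(\<Pi>\<^sub>M k\<in>UNIV. \<mu>)))"
      unfolding prod.case by (intro sum.cong refl law \<pi>)
    finally show "emeasure M {\<omega>\<in>space M. corner n (\<lambda>(i, j). X \<omega> (\<pi> i, \<pi> j)) \<in> F} = \<dots>" .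
  qed
  have corner_id: "emeasure M {\<omega>\<in>space M. corner n (X \<omega>) \<in> F} =
      (\<Sum>b\<in>{b \<in> upairs n \<rightarrow>\<^sub>E UNIV. graph_matrix n b \<in> F}.
        (\<integral>\<^sup>+s. ennreal (edge_prob W s n (\<lambda>i j. b (i, j))) \<partial>(\<Pi>\<^sub>M k\<in>UNIV. \<mu>)))"
    if "F \<in> sets (corner_space n)" for n F
    using corner[of "\<lambda>i. i" n F] that by simp
  have distr_corner: "emeasure (distr M (corner_space n) (\<lambda>\<omega>. corner n (Z \<omega>))) F =
      emeasure M {\<omega>\<in>space M. corner n (Z \<omega>) \<in> F}"
    if "random_matrix M Z" "F \<in> sets (corner_space n)" for Z n F
    by (subst emeasure_distr[OF measurable_corner[OF that(1)] that(2)])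
       (intro arg_cong[where f = "emeasure M"], blast)
  have "jointly_exchangeable M X"
    unfolding jointly_exchangeable_def
  proof (intro allI impI)
    fix n \<pi> assume "\<pi> permutes {..<n::nat}"
    then have \<pi>: "inj_on \<pi> {..<n}" by (metis permutes_inj inj_on_subset subset_UNIV)
    show "distr M (corner_space n) (\<lambda>\<omega>. corner n (X \<omega>)) =
        distr M (corner_space n) (\<lambda>\<omega>. corner n (\<lambda>(i, j). X \<omega> (\<pi> i, \<pi> j)))"
    proof (rule measure_eqI)
      fix F assume "F \<in> sets (distr M (corner_space n) (\<lambda>\<omega>. corner n (X \<omega>)))"
      then have F: "F \<in> sets (corner_space n)" by simp
      show "emeasure (distr M (corner_space n) (\<lambda>\<omega>. corner n (X \<omega>))) F =
          emeasure (distr M (corner_space n) (\<lambda>\<omega>. corner n (\<lambda>(i, j). X \<omega> (\<pi> i, \<pi> j)))) F"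
        by (simp only: distr_corner[OF X F] distr_corner[OF Xpi[OF \<pi> F] F] corner_id[OF F] corner[OF \<pi> F])
    qed simp
  qed
  moreover have "distr (uniform_measure M {\<omega>\<in>space M. N \<omega> = enat n}) (corner_space n) (\<lambda>\<omega>. corner n (A \<omega>)) =
      distr M (corner_space n) (\<lambda>\<omega>. corner n (X \<omega>))"
    if r: "iid_representation M \<zeta> N S A" and n: "n \<ge> 1" for N S A n
  proof (rule measure_eqI)
    have gr: "AE \<omega> in M. \<forall>i\<in>indices (N \<omega>). A \<omega> (i, i) = 0" and rep: "representation M \<zeta> N S A"
      using r by (auto simp: iid_representation_def graph_representation_def)
    have rep0: "representation M \<zeta> N\<^sub>0 S\<^sub>0 A\<^sub>0" using W(1) by (simp add: graph_representation_def)
    have A: "random_matrix M A" using rep by (simp add: representation_def)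
    note [measurable] = representation_measurable(1)[OF rep] representation_measurable(1)[OF rep0]
    define G where "G = {\<omega>\<in>space M. N \<omega> = enat n}"
    define c where "c = emeasure M G"
    have G[measurable]: "G \<in> sets M" unfolding G_def by measurable
    have c: "c = emeasure M {\<omega>\<in>space M. N\<^sub>0 \<omega> = enat n}"
      unfolding c_def G_def
      by (rule emeasure_eq_AE)
         (use AE_representations_isomorphic[OF rep rep0] in \<open>eventually_elim, simp\<close>, measurable)
    then have c0: "c \<noteq> 0" using pos[OF n] by simp
    have c1: "c \<noteq> \<top>" unfolding c_def by simp
    fix F assume "F \<in> sets (distr (uniform_measure M {\<omega>\<in>space M. N \<omega> = enat n}) (corner_space n) (\<lambda>\<omega>. corner n (A \<omega>)))"
    then have F: "F \<in> sets (corner_space n)" by simp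
    let ?q = "\<lambda>b. \<integral>\<^sup>+s. ennreal (edge_prob W s n (\<lambda>i j. b (i, j))) \<partial>(\<Pi>\<^sub>M k\<in>UNIV. \<mu>)"
    have pattern: "emeasure M {\<omega>\<in>G. \<forall>j<n. \<forall>i<j. A \<omega> (i, j) = of_bool (b (i, j))} = c * ?q b" for b
    proof -
      let ?i = "restrict (\<lambda>i. i) {..<n}"
      have i: "?i \<in> bijections {..<n} {..<n}" by (auto simp: bijections_def bij_betw_def inj_on_def)
      have "{\<omega>\<in>G. \<forall>j<n. \<forall>i<j. A \<omega> (i, j) = of_bool (b (i, j))} =
          {\<omega>\<in>space M. N \<omega> = enat n \<and> (\<forall>j<n. \<forall>i<j. A \<omega> (i, j) = of_bool (b (i, j)))}"
        by (simp add: G_def)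
      also have "emeasure M \<dots> = emeasure M {\<omega>\<in>space M. N\<^sub>0 \<omega> = enat n \<and> (\<forall>j<n. \<forall>i<j. A\<^sub>0 \<omega> (i, j) = of_bool (b (i, j)))}"
        by (rule iid_representations_same_law[OF M r r0])
      also have "{\<omega>\<in>space M. N\<^sub>0 \<omega> = enat n \<and> (\<forall>j<n. \<forall>i<j. A\<^sub>0 \<omega> (i, j) = of_bool (b (i, j)))} =
          {\<omega>\<in>space M. N\<^sub>0 \<omega> = enat n \<and> (\<forall>j<n. \<forall>i<j. A\<^sub>0 \<omega> (?i i, ?i j) = of_bool (b (i, j)))}"
        by (intro Collect_cong conj_cong refl all_cong) simp
      also have "emeasure M \<dots> = c * ?q b"
        unfolding c by (rule iid_representation_pattern[OF M W \<mu> iid i])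
      finally show ?thesis .
    qed
    have "emeasure (distr (uniform_measure M G) (corner_space n) (\<lambda>\<omega>. corner n (A \<omega>))) F =
        emeasure (uniform_measure M G) ((\<lambda>\<omega>. corner n (A \<omega>)) -` F \<inter> space M)"
      using measurable_corner[OF A] F by (subst emeasure_distr) simp_all
    also have "\<dots> = emeasure M (G \<inter> ((\<lambda>\<omega>. corner n (A \<omega>)) -` F \<inter> space M)) / c"
      unfolding c_def by (rule emeasure_uniform_measure[OF G measurable_sets[OF measurable_corner[OF A] F]])
    also have "G \<inter> ((\<lambda>\<omega>. corner n (A \<omega>)) -` F \<inter> space M) = {\<omega>\<in>G. corner n (A \<omega>) \<in> F}"
      unfolding G_def by blast
    also have "emeasure M \<dots> = (\<Sum>b\<in>{b \<in> upairs n \<rightarrow>\<^sub>E UNIV. graph_matrix n b \<in> F}. c * ?q b)"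
      unfolding pattern[symmetric]
    proof (rule emeasure_corner_graph_matrix[OF G A F])
      have "AE \<omega> in M. \<forall>i\<in>indices (N \<omega>). \<forall>j\<in>indices (N \<omega>). A \<omega> (i, j) \<in> {0, 1} \<and> A \<omega> (j, i) = A \<omega> (i, j)"
        using rep unfolding representation_def by auto
      with gr show "AE \<omega> in M. \<omega> \<in> G \<longrightarrow>
          (\<forall>i<n. A \<omega> (i, i) = 0 \<and> (\<forall>j<n. A \<omega> (i, j) \<in> {0, 1} \<and> A \<omega> (j, i) = A \<omega> (i, j)))"
      proof eventually_elim
        case (elim \<omega>)
        show ?case
        proof
          assume "\<omega> \<in> G"
          then have "indices (N \<omega>) = {..<n}" unfolding G_def by (simp add: lessThan_def)
          then show "\<forall>i<n. A \<omega> (i, i) = 0 \<and> (\<forall>j<n. A \<omega> (i, j) \<in> {0, 1} \<and> A \<omega> (j, i) = A \<omega> (i, j))"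
            using elim by blast
        qed
      qed
    qed
    also have "\<dots> / c = (\<Sum>b\<in>{b \<in> upairs n \<rightarrow>\<^sub>E UNIV. graph_matrix n b \<in> F}. ?q b)"
      unfolding sum_distrib_left[symmetric] by (subst mult.commute) (simp add: ennreal_mult_divide_eq c0 c1)
    finally show "emeasure (distr (uniform_measure M {\<omega>\<in>space M. N \<omega> = enat n}) (corner_space n) (\<lambda>\<omega>. corner n (A \<omega>))) F =
      emeasure (distr M (corner_space n) (\<lambda>\<omega>. corner n (X \<omega>))) F"
      by (simp only: distr_corner[OF X F] corner_id[OF F] G_def)
  qed simp
  ultimately show "\<exists>X. exchangeable_adjacency_limit M \<zeta> X"
    unfolding exchangeable_adjacency_limit_def using X by blast
qed


section \<open>Enumerating the points of an adjacency measure\<close>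

lemma Times_borel3:
  assumes "C \<in> sets borel" "D \<in> sets borel" "E \<in> sets borel"
  shows "C \<times> D \<times> E \<in> sets (borel :: ('a::second_countable_topology \<times> 'b::second_countable_topology \<times> 'c::second_countable_topology) measure)"
  using assms by (simp add: borel_prod[symmetric])

text \<open>
  The following three functions read an enumeration of the points in \<open>B\<close> off the adjacency measure
  alone. Let \<open>x\<close> be an adjacency measure with finitely many points in \<open>B\<close>; its mass on
  \<open>C \<times> C \<times> UNIV\<close> is the square of the number of points in \<open>C\<close>. Hence the square root below is the number of
  points in \<open>B\<close>.
\<close>

definition point_number :: "'a set \<Rightarrow> ('a::polish_space \<times> 'a \<times> real) measure \<Rightarrow> nat" where
  "point_number B x = nat \<lfloor>sqrt (enn2real (emeasure x (B \<times> B \<times> UNIV)))\<rfloor>"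

text \<open>
  The \<open>i\<close>-th smallest code of a point in \<open>B\<close>, counted from 0: the infimum of the rationals \<open>q\<close> such
  that at least \<open>i + 1\<close> points have a code up to \<open>q\<close>. Restricting \<open>q\<close> to the rationals keeps
  the function measurable.
\<close>

definition point_code :: "('a \<Rightarrow> real) \<Rightarrow> 'a set \<Rightarrow> nat \<Rightarrow> ('a::polish_space \<times> 'a \<times> real) measure \<Rightarrow> real" where
  "point_code e B i x = real_of_ereal (INF q::rat.
     if of_nat ((Suc i)\<^sup>2) \<le> emeasure x ({y\<in>B. e y \<le> of_rat q} \<times> {y\<in>B. e y \<le> of_rat q} \<times> UNIV)
     then ereal (of_rat q) else \<infinity>)"

text \<open>
  Points number \<open>i\<close> and \<open>j\<close> are joined iff there is a mass with mark 1 in the product of any two rational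
  code intervals around their codes. Sufficiently small intervals contain no other code.
\<close>

definition code_edge :: "('a \<Rightarrow> real) \<Rightarrow> 'a set \<Rightarrow> nat \<Rightarrow> nat \<Rightarrow> ('a::polish_space \<times> 'a \<times> real) measure \<Rightarrow> real" where
  "code_edge e B i j x = of_bool (\<forall>p q p' q' :: rat.
     of_rat p < point_code e B i x \<and> point_code e B i x \<le> of_rat q \<and>
     of_rat p' < point_code e B j x \<and> point_code e B j x \<le> of_rat q' \<longrightarrow>
     emeasure x ({y\<in>B. of_rat p < e y \<and> e y \<le> of_rat q} \<times> {y\<in>B. of_rat p' < e y \<and> e y \<le> of_rat q'} \<times> {1}) \<noteq> 0)"

lemma measurable_point_number:
  fixes B :: "'a::polish_space set"
  shows "B \<in> sets borel \<Longrightarrow> point_number B \<in> measure_algebra borel \<rightarrow>\<^sub>M count_space UNIV"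
proof -
  assume "B \<in> sets borel"
  then have [measurable]: "(\<lambda>x. emeasure x (B \<times> B \<times> UNIV)) \<in> borel_measurable (measure_algebra (borel :: ('a \<times> 'a \<times> real) measure))"
    by (intro measurable_emeasure_measure_algebra Times_borel3) auto
  show ?thesis unfolding point_number_def by measurable
qed

lemma code_interval_borel:
  fixes e :: "'a::topological_space \<Rightarrow> real"
  assumes [measurable]: "B \<in> sets borel" "e \<in> borel_measurable borel"
  shows "{y\<in>B. e y \<le> c} \<in> sets borel" "{y\<in>B. c < e y \<and> e y \<le> c'} \<in> sets borel"
proof -
  have "{y\<in>space borel. y \<in> B \<and> e y \<le> c} \<in> sets borel" by measurable
  then show "{y\<in>B. e y \<le> c} \<in> sets borel" by simp
  have "{y\<in>space borel. y \<in> B \<and> c < e y \<and> e y \<le> c'} \<in> sets borel" by measurable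
  then show "{y\<in>B. c < e y \<and> e y \<le> c'} \<in> sets borel" by simp
qed

lemma measurable_point_code:
  fixes B :: "'a::polish_space set"
  assumes "B \<in> sets borel" "e \<in> borel_measurable borel"
  shows "point_code e B i \<in> borel_measurable (measure_algebra borel)"
proof -
  let ?M = "measure_algebra (borel :: ('a \<times> 'a \<times> real) measure)"
  let ?c = "\<lambda>q x. emeasure x ({y\<in>B. e y \<le> real_of_rat q} \<times> {y\<in>B. e y \<le> real_of_rat q} \<times> UNIV)"
  have c: "?c q \<in> borel_measurable ?M" for q
    by (intro measurable_emeasure_measure_algebra Times_borel3 code_interval_borel assms) simp
  have m: "(\<lambda>x. if of_nat ((Suc i)\<^sup>2) \<le> ?c q x then ereal (of_rat q) else \<infinity>) \<in> borel_measurable ?M" for q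
    by (intro measurable_If borel_measurable_le borel_measurable_const c)
  have "(\<lambda>x. INF q::rat. if of_nat ((Suc i)\<^sup>2) \<le> ?c q x then ereal (of_rat q) else \<infinity>) \<in> borel_measurable ?M"
    by (rule borel_measurable_INF[OF countableI_type]) (rule m)
  then show ?thesis
    unfolding point_code_def by (rule borel_measurable_real_of_ereal)
qed

lemma measurable_code_edge:
  fixes B :: "'a::polish_space set"
  assumes "B \<in> sets borel" "e \<in> borel_measurable borel"
  shows "code_edge e B i j \<in> borel_measurable (measure_algebra borel)"
proof -
  let ?M = "measure_algebra (borel :: ('a \<times> 'a \<times> real) measure)"
  let ?c = "\<lambda>p q p' q' x. emeasure x ({y\<in>B. of_rat p < e y \<and> e y \<le> of_rat q} \<times>
      {y\<in>B. of_rat p' < e y \<and> e y \<le> of_rat q'} \<times> {1})"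
  have c: "?c p q p' q' \<in> borel_measurable ?M" for p q p' q'
    by (intro measurable_emeasure_measure_algebra Times_borel3 code_interval_borel assms) simp
  note pc = measurable_point_code[OF assms]
  have "Measurable.pred ?M (\<lambda>x. of_rat p < point_code e B i x \<and> point_code e B i x \<le> of_rat q \<and>
     of_rat p' < point_code e B j x \<and> point_code e B j x \<le> of_rat q' \<longrightarrow> ?c p q p' q' x \<noteq> 0)" for p q p' q' :: rat
    unfolding pred_def
    by (intro sets.sets_Collect borel_measurable_less borel_measurable_le borel_measurable_neq borel_measurable_const pc c)
  then have "Measurable.pred ?M (\<lambda>x. \<forall>p q p' q' :: rat. of_rat p < point_code e B i x \<and> point_code e B i x \<le> of_rat q \<and>
     of_rat p' < point_code e B j x \<and> point_code e B j x \<le> of_rat q' \<longrightarrow> ?c p q p' q' x \<noteq> 0)"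
    by (intro pred_intros_countable)
  then have "{x \<in> space ?M. \<forall>p q p' q' :: rat. of_rat p < point_code e B i x \<and> point_code e B i x \<le> of_rat q \<and>
     of_rat p' < point_code e B j x \<and> point_code e B j x \<le> of_rat q' \<longrightarrow> ?c p q p' q' x \<noteq> 0} \<in> sets ?M"
    by (simp only: pred_def)
  then show ?thesis
    unfolding code_edge_def of_bool_def by (intro measurable_If borel_measurable_const)
qed

lemma emeasure_count_space_square:
  assumes "countable J" "X \<subseteq> J"
  shows "emeasure (count_space (J \<times> J)) (X \<times> X) = emeasure (count_space J) X * emeasure (count_space J) X"
proof -
  interpret sigma_finite_measure "count_space J" by (rule sigma_finite_measure_count_space_countable) fact
  have "emeasure (count_space J \<Otimes>\<^sub>M count_space J) (X \<times> X) = emeasure (count_space J) X * emeasure (count_space J) X"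
    using assms(2) by (intro emeasure_pair_measure_Times) auto
  then show ?thesis using assms(1) by (simp add: pair_measure_countable)
qed

lemma emeasure_point_sum_pairs:
  fixes s :: "nat \<Rightarrow> 'a::polish_space" and a :: "nat \<times> nat \<Rightarrow> real"
  assumes "C \<in> sets borel" "D \<in> sets borel" "E \<in> sets borel"
  shows "emeasure (point_sum (J \<times> J) (\<lambda>(i, j). (s i, s j, a (i, j)))) (C \<times> D \<times> E) =
    emeasure (count_space (J \<times> J)) {(i, j). i \<in> J \<and> j \<in> J \<and> s i \<in> C \<and> s j \<in> D \<and> a (i, j) \<in> E}"
  by (subst emeasure_point_sum[OF Times_borel3[OF assms]]) (auto intro!: arg_cong[where f = "emeasure _"])

lemma ennreal_square_eq_iff: "a * a = b * b \<longleftrightarrow> a = (b :: ennreal)"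
proof
  assume eq: "a * a = b * b"
  show "a = b"
  proof (cases a)
    case top
    then show ?thesis using eq by (cases b) (simp_all add: ennreal_top_mult flip: ennreal_mult)
  next
    case (real r)
    show ?thesis
    proof (cases b)
      case top
      then show ?thesis using eq real by (simp add: ennreal_top_mult flip: ennreal_mult)
    next
      case (real r')
      then have "r * r = r' * r'" using eq \<open>0 \<le> r\<close> \<open>a = ennreal r\<close> by (simp flip: ennreal_mult)
      then have "r = r'" using \<open>0 \<le> r\<close> real(1) by (metis real_sqrt_abs2 abs_of_nonneg)
      then show ?thesis using real \<open>a = ennreal r\<close> by simp
    qed
  qed
qed simp

text \<open>
  The masses of \<open>x\<close> on \<open>C \<times> C \<times> {0, 1}\<close>, computed from the directing measure and from the
  representation, are the squares of the two sides.
\<close>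

lemma directing_measure_count:
  fixes s :: "nat \<Rightarrow> 'a::polish_space" and \<nu> :: "'a measure"
  assumes x: "x = point_sum (J \<times> J) (\<lambda>(i, j). (s i, s j, a (i, j) :: real))"
    and dir: "adjacency_directed_by x \<nu>" and a: "\<And>i j. i \<in> J \<Longrightarrow> j \<in> J \<Longrightarrow> a (i, j) \<in> {0, 1}"
    and C: "C \<in> sets borel"
  shows "emeasure \<nu> C = emeasure (count_space J) {k\<in>J. s k \<in> C}"
proof -
  have \<nu>: "simple_measure \<nu>"
    and eq: "\<And>C. C \<in> sets (borel :: ('a \<times> 'a) measure) \<Longrightarrow>
        emeasure x {(x, y, a). (x, y) \<in> C \<and> a \<in> {0, 1}} = emeasure (\<nu> \<Otimes>\<^sub>M \<nu>) C"
    using dir by (auto simp: adjacency_directed_by_def)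
  have s\<nu>: "sets \<nu> = sets borel" and fin: "bounded B \<Longrightarrow> B \<in> sets borel \<Longrightarrow> emeasure \<nu> B < \<infinity>" for B
    using \<nu> by (auto simp: simple_measure_def locally_finite_def)
  have "sigma_finite_measure \<nu>"
  proof
    let ?F = "range (\<lambda>n::nat. cball (undefined::'a) (real n))"
    have "(\<Union>n::nat. cball (undefined::'a) (real n)) = UNIV"
      by (auto simp: real_arch_simple)
    then have "\<Union>?F = space \<nu>" using sets_eq_imp_space_eq[OF s\<nu>] by simp
    moreover have "\<forall>F\<in>?F. emeasure \<nu> F \<noteq> \<infinity>" using fin by (auto simp: less_top[symmetric])
    ultimately show "\<exists>A. countable A \<and> A \<subseteq> sets \<nu> \<and> \<Union>A = space \<nu> \<and> (\<forall>a\<in>A. emeasure \<nu> a \<noteq> \<infinity>)"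
      by (intro exI[of _ ?F]) (auto simp: s\<nu>)
  qed
  then interpret sigma_finite_measure \<nu> .
  let ?X = "{k\<in>J. s k \<in> C}"
  have "emeasure \<nu> C * emeasure \<nu> C = emeasure (\<nu> \<Otimes>\<^sub>M \<nu>) (C \<times> C)"
    using C s\<nu> by (intro emeasure_pair_measure_Times[symmetric]) auto
  also have "\<dots> = emeasure x {(x, y, a). (x, y) \<in> C \<times> C \<and> a \<in> {0, 1}}"
    using C by (intro eq[symmetric]) (simp add: borel_prod[symmetric])
  also have "{(x, y, a). (x, y) \<in> C \<times> C \<and> a \<in> {0, 1}} = C \<times> C \<times> {0, 1 :: real}" by auto
  also have "emeasure x \<dots> = emeasure (count_space (J \<times> J)) {(i, j). i \<in> J \<and> j \<in> J \<and> s i \<in> C \<and> s j \<in> C \<and> a (i, j) \<in> {0, 1}}"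
    unfolding x by (rule emeasure_point_sum_pairs) (use C in auto)
  also have "{(i, j). i \<in> J \<and> j \<in> J \<and> s i \<in> C \<and> s j \<in> C \<and> a (i, j) \<in> {0, 1}} = ?X \<times> ?X"
    using a by blast
  also have "emeasure (count_space (J \<times> J)) \<dots> = emeasure (count_space J) ?X * emeasure (count_space J) ?X"
    by (rule emeasure_count_space_square) auto
  finally show ?thesis by (simp only: ennreal_square_eq_iff)
qed

lemma emeasure_square_count:
  fixes s :: "nat \<Rightarrow> 'a::polish_space" and a :: "nat \<times> nat \<Rightarrow> real"
  assumes C: "C \<in> sets borel" and fin: "finite {k\<in>J. s k \<in> C}"
  shows "emeasure (point_sum (J \<times> J) (\<lambda>(i, j). (s i, s j, a (i, j)))) (C \<times> C \<times> UNIV) =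
    of_nat ((card {k\<in>J. s k \<in> C})\<^sup>2)"
proof -
  have "emeasure (point_sum (J \<times> J) (\<lambda>(i, j). (s i, s j, a (i, j)))) (C \<times> C \<times> UNIV) =
    emeasure (count_space (J \<times> J)) {(i, j). i \<in> J \<and> j \<in> J \<and> s i \<in> C \<and> s j \<in> C \<and> a (i, j) \<in> UNIV}"
    by (rule emeasure_point_sum_pairs) (use C in auto)
  also have "{(i, j). i \<in> J \<and> j \<in> J \<and> s i \<in> C \<and> s j \<in> C \<and> a (i, j) \<in> UNIV} = {k\<in>J. s k \<in> C} \<times> {k\<in>J. s k \<in> C}"
    by blast
  also have "emeasure (count_space (J \<times> J)) \<dots> = emeasure (count_space J) {k\<in>J. s k \<in> C} * emeasure (count_space J) {k\<in>J. s k \<in> C}"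
    by (rule emeasure_count_space_square) auto
  also have "emeasure (count_space J) {k\<in>J. s k \<in> C} = of_nat (card {k\<in>J. s k \<in> C})"
    by (rule emeasure_count_space_finite) (use fin in auto)
  finally show ?thesis by (simp add: power2_eq_square)
qed

lemma emeasure_count_space_eq_0_iff:
  "X \<subseteq> A \<Longrightarrow> emeasure (count_space A) X = 0 \<longleftrightarrow> X = {}"
  by (simp add: emeasure_count_space_eq_0)

lemma isolating_rationals:
  assumes "finite R"
  obtains p q :: rat where "of_rat p < (r::real)" "r \<le> of_rat q"
    "\<And>r'. r' \<in> R \<Longrightarrow> of_rat p < r' \<Longrightarrow> r' \<le> of_rat q \<Longrightarrow> r' = r"
proof -
  obtain \<epsilon> where \<epsilon>: "\<epsilon> > 0" "\<forall>r'\<in>R. r' \<noteq> r \<longrightarrow> \<epsilon> \<le> dist r r'"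
    using finite_set_avoid[OF assms, of r] by blast
  obtain p where p: "r - \<epsilon> < of_rat p" "of_rat p < r" using of_rat_dense[of "r - \<epsilon>" r] \<epsilon>(1) by auto
  obtain q where q: "r < of_rat q" "of_rat q < r + \<epsilon>" using of_rat_dense[of r "r + \<epsilon>"] \<epsilon>(1) by auto
  show ?thesis
  proof (rule that[of p q])
    fix r' assume r': "r' \<in> R" "of_rat p < r'" "r' \<le> of_rat q"
    then have "dist r r' < \<epsilon>" using p q by (simp add: dist_real_def abs_less_iff)
    then show "r' = r" using \<epsilon>(2) r'(1) by fastforce
  qed (use p q in auto)
qed

lemma INF_rat_above: "(INF q::rat. if r \<le> of_rat q then ereal (of_rat q) else \<infinity>) = ereal r"
proof (rule INF_eqI)
  fix y assume y: "\<And>i. i \<in> UNIV \<Longrightarrow> y \<le> (if r \<le> of_rat i then ereal (of_rat i) else \<infinity>)"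
  show "y \<le> ereal r"
  proof (rule dense_ge)
    fix z assume "ereal r < z"
    show "y \<le> z"
    proof (cases z)
      case (real z')
      then obtain q where "r < of_rat q" "of_rat q < z'" using \<open>ereal r < z\<close> of_rat_dense[of r z'] by auto
      then show ?thesis using y[of q] real by (auto intro: order_trans[of _ "ereal (of_rat q)"])
    qed (use \<open>ereal r < z\<close> in auto)
  qed
qed auto

lemma sorted_enumeration_exists:
  assumes "finite I" and inj: "inj_on f I"
  obtains k :: "nat \<Rightarrow> 'i" where "bij_betw k {..<card I} I" "\<And>i j. i < j \<Longrightarrow> j < card I \<Longrightarrow> f (k i) < (f (k j) :: 'b::linorder)"
proof -
  define xs where "xs = sorted_list_of_set (f ` I)"
  have len: "length xs = card I" using assms by (simp add: xs_def card_image)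
  have xs: "sorted xs" "distinct xs" "set xs = f ` I" using assms by (simp_all add: xs_def)
  define k where "k i = the_inv_into I f (xs ! i)" for i
  have nth: "bij_betw (\<lambda>i. xs ! i) {..<card I} (f ` I)"
    using bij_betw_nth[OF xs(2) refl refl] xs(3) len by simp
  have inv: "bij_betw (the_inv_into I f) (f ` I) I" using inj by (intro bij_betw_the_inv_into inj_on_imp_bij_betw)
  show ?thesis
  proof (rule that)
    show "bij_betw k {..<card I} I"
      unfolding k_def using bij_betw_trans[OF nth inv] by (simp add: comp_def)
    fix i j assume ij: "i < j" "j < card I"
    have fk: "f (k l) = xs ! l" if "l < card I" for l
      unfolding k_def using that xs(3) len inj nth_mem[of l xs] by (intro f_the_inv_into_f) auto
    have "xs ! i \<le> xs ! j" "xs ! i \<noteq> xs ! j"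
      using ij xs len by (auto simp: sorted_nth_mono nth_eq_iff_index_eq)
    then show "f (k i) < f (k j)" using fk ij by simp
  qed
qed

lemma point_number_eq:
  fixes s :: "nat \<Rightarrow> 'a::polish_space" and a :: "nat \<times> nat \<Rightarrow> real"
  assumes "x = point_sum (J \<times> J) (\<lambda>(i, j). (s i, s j, a (i, j)))" "B \<in> sets borel" "finite {k\<in>J. s k \<in> B}"
  shows "point_number B x = card {k\<in>J. s k \<in> B}"
proof -
  have "enn2real (of_nat ((card {k\<in>J. s k \<in> B})\<^sup>2)) = (real (card {k\<in>J. s k \<in> B}))\<^sup>2"
    by (simp only: ennreal_of_nat_eq_real_of_nat of_nat_power) (rule enn2real_ennreal, simp)
  then show ?thesis
    unfolding point_number_def assms(1) emeasure_square_count[OF assms(2,3)] by simp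
qed

text \<open>
  Correctness of the three functions: if \<open>k\<close> lists the indices of the points in \<open>B\<close> by increasing
  code, they return the number, the codes and the edges of the listed points.
\<close>

lemma sorted_enumeration_codes:
  fixes s :: "nat \<Rightarrow> 'a::polish_space" and a :: "nat \<times> nat \<Rightarrow> real"
  assumes x: "x = point_sum (J \<times> J) (\<lambda>(i, j). (s i, s j, a (i, j)))" and B: "B \<in> sets borel"
    and e: "e \<in> borel_measurable borel"
    and a: "\<And>i j. i \<in> J \<Longrightarrow> j \<in> J \<Longrightarrow> a (i, j) \<in> {0, 1}"
    and k: "bij_betw k {..<n} {k\<in>J. s k \<in> B}" "\<And>i j. i < j \<Longrightarrow> j < n \<Longrightarrow> e (s (k i)) < e (s (k j))"
  shows "point_number B x = n"
    and "i < n \<Longrightarrow> point_code e B i x = e (s (k i))"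
    and "i < n \<Longrightarrow> j < n \<Longrightarrow> code_edge e B i j x = a (k i, k j)"
proof -
  let ?I = "{k\<in>J. s k \<in> B}"
  have fin: "finite ?I" using bij_betw_finite[OF k(1)] by simp
  have kI: "k i \<in> J" "s (k i) \<in> B" if "i < n" for i using k(1) that by (auto simp: bij_betw_def)
  have I: "?I = k ` {..<n}" using k(1) by (simp add: bij_betw_def)
  have kinj: "inj_on k {..<n}" using k(1) by (simp add: bij_betw_def)
  have le: "e (s (k i)) \<le> e (s (k j)) \<longleftrightarrow> i \<le> j" if "i < n" "j < n" for i j
    using k(2)[of i j] k(2)[of j i] that by (cases i j rule: linorder_cases) auto
  show "point_number B x = n"
    using point_number_eq[OF x B fin] bij_betw_same_card[OF k(1)] by simp
  have code: "point_code e B i x = e (s (k i))" if i: "i < n" for i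
  proof -
    have "of_nat ((Suc i)\<^sup>2) \<le> emeasure x ({y\<in>B. e y \<le> of_rat q} \<times> {y\<in>B. e y \<le> of_rat q} \<times> UNIV) \<longleftrightarrow>
        e (s (k i)) \<le> of_rat q" for q
    proof -
      let ?L = "{k\<in>J. s k \<in> {y\<in>B. e y \<le> of_rat q}}"
      have L: "?L = k ` {l. l < n \<and> e (s (k l)) \<le> of_rat q}"
      proof -
        have "?L = {m\<in>?I. e (s m) \<le> of_rat q}" by (intro Collect_cong) simp
        also have "\<dots> = {m \<in> k ` {..<n}. e (s m) \<le> of_rat q}" unfolding I ..
        also have "\<dots> = k ` {l. l < n \<and> e (s (k l)) \<le> of_rat q}" by auto
        finally show ?thesis .
      qed
      have finL: "finite ?L" unfolding L by simp
      note sq = emeasure_square_count[OF code_interval_borel(1)[OF B e] finL]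
      have card: "card ?L = card {l. l < n \<and> e (s (k l)) \<le> of_rat q}"
        unfolding L by (intro card_image inj_on_subset[OF kinj]) auto
      have "Suc i \<le> card {l. l < n \<and> e (s (k l)) \<le> of_rat q} \<longleftrightarrow> e (s (k i)) \<le> of_rat q"
      proof
        assume "e (s (k i)) \<le> of_rat q"
        then have "{..i} \<subseteq> {l. l < n \<and> e (s (k l)) \<le> of_rat q}"
          using le i by (auto intro: order_trans[OF iffD2[OF le]])
        from card_mono[OF _ this] show "Suc i \<le> card {l. l < n \<and> e (s (k l)) \<le> of_rat q}" by simp
      next
        assume c: "Suc i \<le> card {l. l < n \<and> e (s (k l)) \<le> of_rat q}"
        show "e (s (k i)) \<le> of_rat q"
        proof (rule ccontr)
          assume "\<not> ?thesis"
          have "l < i" if "l < n" "e (s (k l)) \<le> of_rat q" for l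
          proof -
            have "\<not> e (s (k i)) \<le> e (s (k l))" using that \<open>\<not> _\<close> by linarith
            then show ?thesis using le[OF i \<open>l < n\<close>] by simp
          qed
          then have "{l. l < n \<and> e (s (k l)) \<le> of_rat q} \<subseteq> {..<i}" by blast
          from card_mono[OF _ this] c show False by simp
        qed
      qed
      moreover have "of_nat ((Suc i)\<^sup>2) \<le> (of_nat (c\<^sup>2) :: ennreal) \<longleftrightarrow> Suc i \<le> c" for c
        by (simp only: of_nat_le_iff power2_nat_le_eq_le)
      ultimately show ?thesis unfolding x sq card by blast
    qed
    then show ?thesis unfolding point_code_def by (simp only: INF_rat_above real_of_ereal.simps)
  qed
  then show "i < n \<Longrightarrow> point_code e B i x = e (s (k i))" .
  show "code_edge e B i j x = a (k i, k j)" if ij: "i < n" "j < n"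
  proof -
    let ?E = "\<lambda>p q p' q'. {(l, m). l \<in> J \<and> m \<in> J \<and> s l \<in> {y\<in>B. of_rat p < e y \<and> e y \<le> of_rat q} \<and>
        s m \<in> {y\<in>B. of_rat p' < e y \<and> e y \<le> of_rat q'} \<and> a (l, m) \<in> {1}}"
    have em: "emeasure x ({y\<in>B. of_rat p < e y \<and> e y \<le> of_rat q} \<times> {y\<in>B. of_rat p' < e y \<and> e y \<le> of_rat q'} \<times> {1}) \<noteq> 0
      \<longleftrightarrow> ?E p q p' q' \<noteq> {}" for p q p' q'
    proof -
      have count: "emeasure x ({y\<in>B. of_rat p < e y \<and> e y \<le> of_rat q} \<times> {y\<in>B. of_rat p' < e y \<and> e y \<le> of_rat q'} \<times> {1}) =
          emeasure (count_space (J \<times> J)) (?E p q p' q')"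
        unfolding x by (intro emeasure_point_sum_pairs code_interval_borel B e) simp
      have "?E p q p' q' \<subseteq> J \<times> J" by (rule subsetI) clarsimp
      from emeasure_count_space_eq_0_iff[OF this] show ?thesis unfolding count by (rule arg_cong[where f = Not])
    qed
    note ce = code_edge_def[of e B i j x, unfolded em code[OF ij(1)] code[OF ij(2)]]
    show ?thesis
    proof (cases "a (k i, k j) = 1")
      case True
      then have "(k i, k j) \<in> ?E p q p' q'"
        if "of_rat p < e (s (k i)) \<and> e (s (k i)) \<le> of_rat q \<and> of_rat p' < e (s (k j)) \<and> e (s (k j)) \<le> of_rat q'" for p q p' q'
        using kI ij that by simp
      then have "code_edge e B i j x = 1" unfolding ce by (subst of_bool_eq(2)[symmetric]) (intro arg_cong[where f = of_bool], blast)
      then show ?thesis using True by simp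
    next
      case False
      let ?R = "(\<lambda>m. e (s m)) ` ?I"
      have R: "finite ?R" using fin by simp
      obtain p q where pq: "of_rat p < e (s (k i))" "e (s (k i)) \<le> of_rat q"
        "\<And>r. r \<in> ?R \<Longrightarrow> of_rat p < r \<Longrightarrow> r \<le> of_rat q \<Longrightarrow> r = e (s (k i))"
        by (rule isolating_rationals[OF R, where r = "e (s (k i))"]) blast
      obtain p' q' where pq': "of_rat p' < e (s (k j))" "e (s (k j)) \<le> of_rat q'"
        "\<And>r. r \<in> ?R \<Longrightarrow> of_rat p' < r \<Longrightarrow> r \<le> of_rat q' \<Longrightarrow> r = e (s (k j))"
        by (rule isolating_rationals[OF R, where r = "e (s (k j))"]) blast
      have eq: "m = k l" if "m \<in> ?I" "l < n" "e (s m) = e (s (k l))" for m l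
      proof -
        from that(1) have "m \<in> k ` {..<n}" unfolding I .
        then obtain l' where l': "l' < n" "m = k l'" by blast
        then have "l' = l" using le[of l l'] le[of l' l] that by simp
        then show ?thesis using l' by simp
      qed
      have "?E p q p' q' = {}"
      proof (rule ccontr)
        assume "?E p q p' q' \<noteq> {}"
        then obtain l m where lm: "l \<in> J" "m \<in> J" "s l \<in> B" "s m \<in> B" "a (l, m) = 1"
          "of_rat p < e (s l)" "e (s l) \<le> of_rat q" "of_rat p' < e (s m)" "e (s m) \<le> of_rat q'" by blast
        then have "l = k i" "m = k j"
          using pq(3)[of "e (s l)"] pq'(3)[of "e (s m)"] eq[of l i] eq[of m j] ij by blast+
        then show False using lm False by simp
      qed
      then have "code_edge e B i j x = 0"
        unfolding ce using pq(1,2) pq'(1,2) by (subst of_bool_eq(1)[symmetric]) (intro arg_cong[where f = of_bool], blast)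
      then show ?thesis using a[of "k i" "k j"] kI ij False by auto
    qed
  qed
qed


section \<open>The sorted representation\<close>

lemma nn_integral_count_space_single:
  fixes h :: "'k \<Rightarrow> ennreal"
  assumes "\<kappa> \<in> K" "\<And>k. k \<in> K \<Longrightarrow> k \<noteq> \<kappa> \<Longrightarrow> h k = 0"
  shows "(\<integral>\<^sup>+k. h k \<partial>count_space K) = h \<kappa>"
  using assms by (subst nn_integral_count_space'[where A = "{\<kappa>}"]) auto

text \<open>
  The points algebra knows only the points with index below \<open>N\<close>, so the coordinate \<open>S k\<close> has to be
  overwritten by a constant where it does not belong to the representation.
\<close>

lemma points_algebra_measurable:
  fixes S :: "'w \<Rightarrow> nat \<Rightarrow> 'a::polish_space"
  assumes N: "N \<in> M \<rightarrow>\<^sub>M count_space UNIV" and S: "\<And>k. (\<lambda>\<omega>. S \<omega> k) \<in> M \<rightarrow>\<^sub>M borel"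
  shows "N \<in> points_algebra M N S \<rightarrow>\<^sub>M count_space UNIV"
    and "(\<lambda>\<omega>. if enat k < N \<omega> then S \<omega> k else c) \<in> points_algebra M N S \<rightarrow>\<^sub>M borel"
proof -
  note pa = points_algebra[OF N S]
  have "N -` {n} \<inter> space M \<in> sets (points_algebra M N S)" for n
    using pa(3)[of n] by (simp add: vimage_def Int_def conj_commute)
  then show Nm: "N \<in> points_algebra M N S \<rightarrow>\<^sub>M count_space UNIV"
    by (subst measurable_count_space_eq2_countable) (simp_all add: pa(2))
  show "(\<lambda>\<omega>. if enat k < N \<omega> then S \<omega> k else c) \<in> points_algebra M N S \<rightarrow>\<^sub>M borel"
  proof (rule measurableI)
    fix D :: "'a set" assume D: "D \<in> sets borel"
    have "N -` {n. \<not> enat k < n} \<inter> space M \<in> sets (points_algebra M N S)"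
      using measurable_sets[OF Nm, of "{n. \<not> enat k < n}"] by (simp add: pa(2))
    then have "{\<omega>\<in>space M. enat k < N \<omega> \<and> S \<omega> k \<in> D} \<union> (if c \<in> D then N -` {n. \<not> enat k < n} \<inter> space M else {})
        \<in> sets (points_algebra M N S)" using pa(4)[OF D, of k] by auto
    also have "{\<omega>\<in>space M. enat k < N \<omega> \<and> S \<omega> k \<in> D} \<union> (if c \<in> D then N -` {n. \<not> enat k < n} \<inter> space M else {}) =
        (\<lambda>\<omega>. if enat k < N \<omega> then S \<omega> k else c) -` D \<inter> space (points_algebra M N S)"
      unfolding pa(2) by (auto split: if_splits)
    finally show "(\<lambda>\<omega>. if enat k < N \<omega> then S \<omega> k else c) -` D \<inter> space (points_algebra M N S) \<in> sets (points_algebra M N S)" .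
  qed simp
qed

text \<open>
  On the event \<open>N = n\<close>, the points algebra is generated by the first \<open>n\<close> points. Conditional
  probabilities given the points can therefore be checked for each \<open>n\<close> on events that involve these only.
\<close>

lemma points_algebra_trace:
  fixes S :: "'w \<Rightarrow> nat \<Rightarrow> 'a::polish_space"
  assumes N: "N \<in> M \<rightarrow>\<^sub>M count_space UNIV" and S: "\<And>k. (\<lambda>\<omega>. S \<omega> k) \<in> M \<rightarrow>\<^sub>M borel"
    and F: "F \<in> sets (points_algebra M N S)"
  shows "\<exists>C\<in>sets (\<Pi>\<^sub>M i\<in>{..<n}. borel). {\<omega>\<in>F. N \<omega> = enat n} = {\<omega>\<in>space M. N \<omega> = enat n \<and> restrict (S \<omega>) {..<n} \<in> C}"
proof -
  let ?G = "range (\<lambda>n. {\<omega>\<in>space M. N \<omega> = n}) \<union>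
      {{\<omega>\<in>space M. enat k < N \<omega> \<and> S \<omega> k \<in> C} | k C. C \<in> sets borel}"
  let ?P = "\<Pi>\<^sub>M i\<in>{..<n}. (borel :: 'a measure)"
  have r: "restrict (S \<omega>) {..<n} \<in> space ?P" for \<omega> by (simp add: space_PiM)
  have "F \<in> sigma_sets (space M) ?G"
    using F unfolding points_algebra_def by (subst (asm) sets_measure_of) auto
  then show ?thesis
  proof induction
    case (Basic F)
    then consider n' where "F = {\<omega>\<in>space M. N \<omega> = n'}"
      | k D where "F = {\<omega>\<in>space M. enat k < N \<omega> \<and> S \<omega> k \<in> D}" "D \<in> sets borel" by blast
    then show ?case
    proof cases
      case 1
      show ?thesis
        by (rule bexI[of _ "if n' = enat n then space ?P else {}"]) (auto simp: 1 r simp del: restrict_apply)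
    next
      case 2
      show ?thesis
      proof (cases "k < n")
        case True
        then have "(\<lambda>s. s k) \<in> ?P \<rightarrow>\<^sub>M borel" by (intro measurable_component_singleton) simp
        from measurable_sets[OF this 2(2)] have "(\<lambda>s. s k) -` D \<inter> space ?P \<in> sets ?P" .
        moreover have "{\<omega>\<in>F. N \<omega> = enat n} = {\<omega>\<in>space M. N \<omega> = enat n \<and> restrict (S \<omega>) {..<n} \<in> (\<lambda>s. s k) -` D \<inter> space ?P}"
          using True r by (auto simp: 2(1))
        ultimately show ?thesis by blast
      next
        case False
        then have "{\<omega>\<in>F. N \<omega> = enat n} = {\<omega>\<in>space M. N \<omega> = enat n \<and> restrict (S \<omega>) {..<n} \<in> {}}"
          by (auto simp: 2(1))
        then show ?thesis by blast
      qed
    qed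
  next
    case Empty
    then show ?case by (intro bexI[of _ "{}"]) auto
  next
    case (Compl F)
    then obtain C where C: "C \<in> sets ?P" "{\<omega>\<in>F. N \<omega> = enat n} = {\<omega>\<in>space M. N \<omega> = enat n \<and> restrict (S \<omega>) {..<n} \<in> C}"
      by blast
    have "{\<omega>\<in>space M - F. N \<omega> = enat n} = {\<omega>\<in>space M. N \<omega> = enat n} - {\<omega>\<in>F. N \<omega> = enat n}" by blast
    also have "\<dots> = {\<omega>\<in>space M. N \<omega> = enat n \<and> restrict (S \<omega>) {..<n} \<in> space ?P - C}"
      unfolding C(2) using r by blast
    finally show ?case using C(1) by blast
  next
    case (Union F)
    then have "\<forall>i. \<exists>C. C \<in> sets ?P \<and> {\<omega>\<in>F i. N \<omega> = enat n} = {\<omega>\<in>space M. N \<omega> = enat n \<and> restrict (S \<omega>) {..<n} \<in> C}"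
      by (simp only: Bex_def) simp
    from choice[OF this] obtain C where C': "\<forall>i. C i \<in> sets ?P \<and>
        {\<omega>\<in>F i. N \<omega> = enat n} = {\<omega>\<in>space M. N \<omega> = enat n \<and> restrict (S \<omega>) {..<n} \<in> C i}" by (rule exE)
    have C: "C i \<in> sets ?P"
      "{\<omega>\<in>F i. N \<omega> = enat n} = {\<omega>\<in>space M. N \<omega> = enat n \<and> restrict (S \<omega>) {..<n} \<in> C i}" for i
      using C'[rule_format, of i] by (rule conjunct1, rule conjunct2)
    have "{\<omega>\<in>\<Union>i. F i. N \<omega> = enat n} = (\<Union>i. {\<omega>\<in>F i. N \<omega> = enat n})" by blast
    also have "\<dots> = {\<omega>\<in>space M. N \<omega> = enat n \<and> restrict (S \<omega>) {..<n} \<in> (\<Union>i. C i)}"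
      unfolding C(2) by blast
    finally have eq: "{\<omega>\<in>\<Union>i. F i. N \<omega> = enat n} = {\<omega>\<in>space M. N \<omega> = enat n \<and> restrict (S \<omega>) {..<n} \<in> (\<Union>i. C i)}" .
    have "(\<Union>i. C i) \<in> sets ?P" by (intro sets.countable_UN image_subsetI C(1))
    with eq show ?case by (rule bexI)
  qed
qed

text \<open>
  A graph process with a given representation, a set \<open>B\<close> that contains finitely many points, and a Borel
  code \<open>e\<close> of the state space with decoder \<open>d\<close>, which makes it possible to sort the points in \<open>B\<close>.
  The point number \<open>i\<close> of this order is \<open>pt i (\<xi> \<omega>)\<close>.
\<close>

locale restricted_graph_process = prob_space M for M :: "'w measure" +
  fixes W :: "'a::polish_space \<Rightarrow> 'a \<Rightarrow> real" and \<xi> :: "'w \<Rightarrow> ('a \<times> 'a \<times> real) measure"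
    and N :: "'w \<Rightarrow> enat" and S :: "'w \<Rightarrow> nat \<Rightarrow> 'a" and A :: "'w \<Rightarrow> nat \<times> nat \<Rightarrow> real"
    and B :: "'a set" and e :: "'a \<Rightarrow> real" and d :: "real \<Rightarrow> 'a"
  assumes graph: "graph_representation M W \<xi> N S A" and kernel: "connection_kernel W"
    and measurable_\<xi>: "\<xi> \<in> M \<rightarrow>\<^sub>M measure_algebra borel"
    and borel_B: "B \<in> sets borel" and borel_e: "e \<in> borel_measurable borel"
    and borel_d: "d \<in> borel_measurable borel" and decode: "\<And>x. d (e x) = x"
    and AE_finite: "AE \<omega> in M. finite {k\<in>indices (N \<omega>). S \<omega> k \<in> B}"
begin

abbreviation inside :: "'w \<Rightarrow> nat set" where
  "inside \<omega> \<equiv> {k\<in>indices (N \<omega>). S \<omega> k \<in> B}"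

abbreviation num :: "('a \<times> 'a \<times> real) measure \<Rightarrow> nat" where
  "num \<equiv> point_number B"

abbreviation pt :: "nat \<Rightarrow> ('a \<times> 'a \<times> real) measure \<Rightarrow> 'a" where
  "pt i x \<equiv> d (point_code e B i x)"

abbreviation adj :: "nat \<Rightarrow> nat \<Rightarrow> ('a \<times> 'a \<times> real) measure \<Rightarrow> real" where
  "adj \<equiv> code_edge e B"

abbreviation measures :: "('a \<times> 'a \<times> real) measure measure" where
  "measures \<equiv> measure_algebra borel"

definition sorting :: "(nat \<Rightarrow> nat) \<Rightarrow> nat \<Rightarrow> 'w \<Rightarrow> bool" where
  "sorting k n \<omega> \<longleftrightarrow> bij_betw k {..<n} (inside \<omega>) \<and> (\<forall>j<n. \<forall>i<j. e (S \<omega> (k i)) < e (S \<omega> (k j)))"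

lemma rep: "representation M \<xi> N S A"
  using graph by (simp add: graph_representation_def)

lemma measurable_num: "num \<in> measures \<rightarrow>\<^sub>M count_space UNIV"
  by (rule measurable_point_number[OF borel_B])

lemma measurable_pt: "pt i \<in> measures \<rightarrow>\<^sub>M borel"
  by (rule measurable_compose[OF measurable_point_code[OF borel_B borel_e] borel_d])

lemma measurable_adj: "adj i j \<in> borel_measurable measures"
  by (rule measurable_code_edge[OF borel_B borel_e])

text \<open>
  The listing \<open>k\<close> of the points in \<open>B\<close> by increasing code, as a function on \<open>{..<num (\<xi> \<omega>)}\<close>. The second
  clause says that among the extensional functions on \<open>{..<n}\<close> there is no other sorting: none at
  all unless \<open>n\<close> is the number of points, and only \<open>k\<close> in that case. It makes the events
  \<open>sorting k n\<close> disjoint for different \<open>k\<close>.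
\<close>

definition sorted_by :: "(nat \<Rightarrow> nat) \<Rightarrow> nat \<Rightarrow> 'w \<Rightarrow> bool" where
  "sorted_by k n \<omega> \<longleftrightarrow> k \<in> {..<num (\<xi> \<omega>)} \<rightarrow>\<^sub>E UNIV \<and>
     (\<forall>k'\<in>{..<n} \<rightarrow>\<^sub>E UNIV. sorting k' n \<omega> \<longleftrightarrow> n = num (\<xi> \<omega>) \<and> k' = k) \<and>
     sorting k (num (\<xi> \<omega>)) \<omega> \<and>
     (\<forall>i<num (\<xi> \<omega>). pt i (\<xi> \<omega>) = S \<omega> (k i)) \<and>
     (\<forall>i<num (\<xi> \<omega>). \<forall>j<num (\<xi> \<omega>). adj i j (\<xi> \<omega>) = A \<omega> (k i, k j))"

lemma sorted_byD:
  assumes "sorted_by k n \<omega>"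
  shows "k \<in> {..<num (\<xi> \<omega>)} \<rightarrow>\<^sub>E UNIV"
    and "k' \<in> {..<n} \<rightarrow>\<^sub>E UNIV \<Longrightarrow> sorting k' n \<omega> \<longleftrightarrow> n = num (\<xi> \<omega>) \<and> k' = k"
    and "i < num (\<xi> \<omega>) \<Longrightarrow> pt i (\<xi> \<omega>) = S \<omega> (k i)"
    and "i < num (\<xi> \<omega>) \<Longrightarrow> j < num (\<xi> \<omega>) \<Longrightarrow> adj i j (\<xi> \<omega>) = A \<omega> (k i, k j)"
    and "sorting k (num (\<xi> \<omega>)) \<omega>"
  using assms by (simp_all add: sorted_by_def)

lemma AE_sorting: "AE \<omega> in M. \<exists>k. sorted_by k n \<omega>"
proof -
  have "AE \<omega> in M. inj_on (S \<omega>) (indices (N \<omega>)) \<and>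
        (\<forall>i\<in>indices (N \<omega>). \<forall>j\<in>indices (N \<omega>). A \<omega> (i, j) \<in> {0, 1} \<and> A \<omega> (j, i) = A \<omega> (i, j)) \<and>
        \<xi> \<omega> = point_sum (indices (N \<omega>) \<times> indices (N \<omega>)) (\<lambda>(i, j). (S \<omega> i, S \<omega> j, A \<omega> (i, j)))"
    using rep by (simp add: representation_def)
  with AE_finite show ?thesis
  proof eventually_elim
    case (elim \<omega>)
    let ?J = "indices (N \<omega>)"
    have x: "\<xi> \<omega> = point_sum (?J \<times> ?J) (\<lambda>(i, j). (S \<omega> i, S \<omega> j, A \<omega> (i, j)))"
      and a: "\<And>i j. i \<in> ?J \<Longrightarrow> j \<in> ?J \<Longrightarrow> A \<omega> (i, j) \<in> {0, 1}" and inj: "inj_on (S \<omega>) ?J"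
      using elim by blast+
    have "inj e" using decode by (metis injI)
    then have injI: "inj_on (\<lambda>k. e (S \<omega> k)) (inside \<omega>)"
      using inj by (auto simp: inj_on_def)
    have codes: "num (\<xi> \<omega>) = n" "\<And>i. i < n \<Longrightarrow> point_code e B i (\<xi> \<omega>) = e (S \<omega> (k i))"
      "\<And>i j. i < n \<Longrightarrow> j < n \<Longrightarrow> adj i j (\<xi> \<omega>) = A \<omega> (k i, k j)" if "sorting k n \<omega>" for k n
    proof -
      have k: "bij_betw k {..<n} (inside \<omega>)" "\<And>i j. i < j \<Longrightarrow> j < n \<Longrightarrow> e (S \<omega> (k i)) < e (S \<omega> (k j))"
        using that by (simp_all add: sorting_def)
      show "num (\<xi> \<omega>) = n" by (rule sorted_enumeration_codes(1)[OF x borel_B borel_e a k])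
      show "point_code e B i (\<xi> \<omega>) = e (S \<omega> (k i))" if "i < n" for i
        by (rule sorted_enumeration_codes(2)[OF x borel_B borel_e a k that])
      show "adj i j (\<xi> \<omega>) = A \<omega> (k i, k j)" if "i < n" "j < n" for i j
        by (rule sorted_enumeration_codes(3)[OF x borel_B borel_e a k that])
    qed
    obtain k0 where k0: "bij_betw k0 {..<card (inside \<omega>)} (inside \<omega>)"
      "\<And>i j. i < j \<Longrightarrow> j < card (inside \<omega>) \<Longrightarrow> e (S \<omega> (k0 i)) < e (S \<omega> (k0 j))"
      using sorted_enumeration_exists[OF elim(1) injI] by blast
    define k where "k = restrict k0 {..<card (inside \<omega>)}"
    have "bij_betw k {..<card (inside \<omega>)} (inside \<omega>)"
      unfolding k_def using k0(1) by (subst bij_betw_cong[of _ _ k0]) auto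
    then have sk: "sorting k (card (inside \<omega>)) \<omega>"
      using k0(2) by (simp add: sorting_def k_def)
    then have num: "num (\<xi> \<omega>) = card (inside \<omega>)" by (rule codes(1))
    note sk = sk[folded num]
    have kE: "k \<in> {..<num (\<xi> \<omega>)} \<rightarrow>\<^sub>E UNIV" by (simp add: k_def num)
    have "sorting k' n \<omega> \<longleftrightarrow> n = num (\<xi> \<omega>) \<and> k' = k" if k': "k' \<in> {..<n} \<rightarrow>\<^sub>E UNIV" for k'
    proof
      assume s: "sorting k' n \<omega>"
      then have n: "n = num (\<xi> \<omega>)" using codes(1) by simp
      have "k' i = k i" if i: "i < n" for i
      proof (rule inj_onD[OF injI])
        show "e (S \<omega> (k' i)) = e (S \<omega> (k i))"
          using codes(2)[OF s i] codes(2)[OF sk, of i] i n by simp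
        have b: "bij_betw k' {..<n} (inside \<omega>)" "bij_betw k {..<n} (inside \<omega>)"
          using s sk unfolding sorting_def n by simp_all
        show "k' i \<in> inside \<omega>" by (rule bspec[OF bij_betwE[OF b(1)]]) (simp add: i)
        show "k i \<in> inside \<omega>" by (rule bspec[OF bij_betwE[OF b(2)]]) (simp add: i)
      qed
      then have "k' = k" using kE n by (intro PiE_ext[OF k']) auto
      with n show "n = num (\<xi> \<omega>) \<and> k' = k" by simp
    qed (use sk in simp)
    then show ?case
      using kE sk codes(2)[OF sk] codes(3)[OF sk] decode unfolding sorted_by_def by (intro exI[of _ k]) simp
  qed
qed

lemma measurable_pts: "(\<lambda>x. \<lambda>i\<in>{..<n}. pt (f i) x) \<in> measures \<rightarrow>\<^sub>M (\<Pi>\<^sub>M i\<in>{..<n}. borel)"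
  by (rule measurable_restrict) (rule measurable_pt)

text \<open>
  There are \<open>n\<close> points in \<open>B\<close>, and listed in the order \<open>f\<close> of their sorted positions they lie in \<open>C\<close>.
\<close>

definition sorted_event :: "nat \<Rightarrow> (nat \<Rightarrow> nat) \<Rightarrow> (nat \<Rightarrow> 'a) set \<Rightarrow> ('a \<times> 'a \<times> real) measure set" where
  "sorted_event n f C = {x \<in> space measures. num x = n \<and> (\<lambda>i\<in>{..<n}. pt (f i) x) \<in> C}"

lemma sorted_event_sets:
  assumes C: "C \<in> sets (\<Pi>\<^sub>M i\<in>{..<n}. borel)"
  shows "sorted_event n f C \<in> sets measures"
proof -
  have "sorted_event n f C = (num -` {n} \<inter> space measures) \<inter> ((\<lambda>x. \<lambda>i\<in>{..<n}. pt (f i) x) -` C \<inter> space measures)"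
    unfolding sorted_event_def by blast
  also have "\<dots> \<in> sets measures"
    by (intro sets.Int measurable_sets[OF measurable_num] measurable_sets[OF measurable_pts C]) simp
  finally show ?thesis .
qed

definition edge_event :: "nat \<Rightarrow> (nat \<Rightarrow> nat) \<Rightarrow> (nat \<Rightarrow> nat \<Rightarrow> bool) \<Rightarrow> ('a \<times> 'a \<times> real) measure set" where
  "edge_event m f a = {x \<in> space measures. \<forall>j<m. \<forall>i<j. adj (f i) (f j) x = of_bool (a i j)}"

lemma edge_event_sets: "edge_event m f a \<in> sets measures"
proof -
  note [measurable] = measurable_adj
  show ?thesis unfolding edge_event_def by measurable
qed

text \<open>
  Sorting does not disturb the conditional law of the edges. The event is split according to the index
  function \<open>k\<close> that sorts the points. There are countably many such functions, and which of them occurs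
  is determined by the points. For a fixed \<open>k\<close> the sorted points are the points along an injection, so
  \<open>graph_representation_pattern\<close> applies to \<open>k \<circ> f\<close>; summing over \<open>k\<close> gives the result.
\<close>

lemma sorted_representation_pattern:
  assumes f: "f \<in> bijections {..<n} {..<n}" and mn: "m \<le> n" and C: "C \<in> sets (\<Pi>\<^sub>M i\<in>{..<n}. borel)"
  shows "(\<integral>\<^sup>+\<omega>. indicator (sorted_event n f C \<inter> edge_event m f a) (\<xi> \<omega>) \<partial>M) =
    (\<integral>\<^sup>+\<omega>. ennreal (edge_prob W (\<lambda>i. pt (f i) (\<xi> \<omega>)) m a) * indicator (sorted_event n f C) (\<xi> \<omega>) \<partial>M)"
proof -
  let ?P = "points_algebra M N S"
  let ?K = "{..<n} \<rightarrow>\<^sub>E (UNIV :: nat set)"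
  note Nm = representation_measurable(1)[OF rep] and Sm = representation_measurable(2)[OF rep]
  note pa = points_algebra[of N M S, OF Nm Sm]
  define G where "G k = {\<omega>\<in>space M. sorting k n \<omega> \<and> (\<lambda>i\<in>{..<n}. S \<omega> (k (f i))) \<in> C}" for k
  have fn: "f i < n" if "i < n" for i using f that by (auto simp: bijections_def)
  have finj: "inj_on f {..<n}" using f by (auto simp: bijections_def bij_betw_def)
  have K: "countable ?K" by (rule countable_PiE) auto
  (* whether \<open>k\<close> sorts the points can be decided from the points with index below \<open>N\<close> *)
  have G: "G k \<in> sets ?P" for k
  proof (cases "inj_on k {..<n}")
    case True
    define S' where "S' l \<omega> = (if enat l < N \<omega> then S \<omega> l else undefined)" for l \<omega>
    have S'[measurable]: "S' l \<in> ?P \<rightarrow>\<^sub>M borel" for l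
      unfolding S'_def by (rule points_algebra_measurable(2)[OF Nm Sm])
    have N'[measurable]: "N \<in> ?P \<rightarrow>\<^sub>M count_space UNIV" by (rule points_algebra_measurable(1)[OF Nm Sm])
    have eS'[measurable]: "(\<lambda>\<omega>. e (S' l \<omega>)) \<in> borel_measurable ?P" for l
      by (rule measurable_compose[OF S' borel_e])
    note [measurable] = borel_B
    have R: "(\<lambda>\<omega>. \<lambda>i\<in>{..<n}. S' (k (f i)) \<omega>) \<in> ?P \<rightarrow>\<^sub>M (\<Pi>\<^sub>M i\<in>{..<n}. borel)"
      by (rule measurable_restrict) (rule S')
    have "{\<omega>\<in>space ?P. (\<forall>i<n. enat (k i) < N \<omega> \<and> S' (k i) \<omega> \<in> B) \<and>
         (\<forall>l. l \<notin> k ` {..<n} \<longrightarrow> \<not> (enat l < N \<omega> \<and> S' l \<omega> \<in> B)) \<and>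
         (\<forall>j<n. \<forall>i<j. e (S' (k i) \<omega>) < e (S' (k j) \<omega>))} \<in> sets ?P"
      by measurable
    note Int = sets.Int[OF this measurable_sets[OF R C]]
    have "{\<omega>\<in>space ?P. (\<forall>i<n. enat (k i) < N \<omega> \<and> S' (k i) \<omega> \<in> B) \<and>
         (\<forall>l. l \<notin> k ` {..<n} \<longrightarrow> \<not> (enat l < N \<omega> \<and> S' l \<omega> \<in> B)) \<and>
         (\<forall>j<n. \<forall>i<j. e (S' (k i) \<omega>) < e (S' (k j) \<omega>))} \<inter> ((\<lambda>\<omega>. \<lambda>i\<in>{..<n}. S' (k (f i)) \<omega>) -` C \<inter> space ?P) = G k"
    proof (rule set_eqI)
      fix \<omega>
      have bij: "bij_betw k {..<n} (inside \<omega>) \<longleftrightarrow> (\<forall>i<n. enat (k i) < N \<omega> \<and> S' (k i) \<omega> \<in> B) \<and>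
         (\<forall>l. l \<notin> k ` {..<n} \<longrightarrow> \<not> (enat l < N \<omega> \<and> S' l \<omega> \<in> B))"
      proof -
        have "bij_betw k {..<n} (inside \<omega>) \<longleftrightarrow> k ` {..<n} = inside \<omega>"
          using True by (simp add: bij_betw_def)
        also have "\<dots> \<longleftrightarrow> (\<forall>i<n. enat (k i) < N \<omega> \<and> S \<omega> (k i) \<in> B) \<and> (\<forall>l. l \<notin> k ` {..<n} \<longrightarrow> \<not> (enat l < N \<omega> \<and> S \<omega> l \<in> B))"
          by auto
        finally show ?thesis by (simp add: S'_def cong: conj_cong)
      qed
      have eq: "S' (k i) \<omega> = S \<omega> (k i)" if "i < n" "\<forall>i<n. enat (k i) < N \<omega> \<and> S' (k i) \<omega> \<in> B" for i
        using that by (simp add: S'_def)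
      let ?Q = "\<forall>i<n. enat (k i) < N \<omega> \<and> S' (k i) \<omega> \<in> B"
      have pts: "(\<lambda>i\<in>{..<n}. S' (k (f i)) \<omega>) = (\<lambda>i\<in>{..<n}. S \<omega> (k (f i)))" if ?Q
        by (intro restrict_ext eq[OF fn that]) (simp only: lessThan_iff)
      have incr: "(\<forall>j<n. \<forall>i<j. e (S' (k i) \<omega>) < e (S' (k j) \<omega>)) \<longleftrightarrow> (\<forall>j<n. \<forall>i<j. e (S \<omega> (k i)) < e (S \<omega> (k j)))" if ?Q
        by (intro all_cong arg_cong2[where f = "(<)"] arg_cong[where f = e] eq[OF _ that]) (rule less_trans)
      show "\<omega> \<in> {\<omega>\<in>space ?P. (\<forall>i<n. enat (k i) < N \<omega> \<and> S' (k i) \<omega> \<in> B) \<and>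
         (\<forall>l. l \<notin> k ` {..<n} \<longrightarrow> \<not> (enat l < N \<omega> \<and> S' l \<omega> \<in> B)) \<and>
         (\<forall>j<n. \<forall>i<j. e (S' (k i) \<omega>) < e (S' (k j) \<omega>))} \<inter> ((\<lambda>\<omega>. \<lambda>i\<in>{..<n}. S' (k (f i)) \<omega>) -` C \<inter> space ?P) \<longleftrightarrow> \<omega> \<in> G k"
      proof (cases ?Q)
        case True
        show ?thesis
          unfolding G_def mem_Collect_eq Int_iff vimage_eq pa(2) unfolding sorting_def
          unfolding bij pts[OF True] incr[OF True]
          by (simp only: True simp_thms conj_ac)
      next
        case False
        show ?thesis
          unfolding G_def mem_Collect_eq Int_iff vimage_eq pa(2) unfolding sorting_def unfolding bij
          by (simp only: False simp_thms)
      qed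
    qed
    with Int show ?thesis by (simp only:)
  next
    case False
    then have "G k = {}" by (auto simp: G_def sorting_def bij_betw_def)
    then show ?thesis by simp
  qed
  have GM: "G k \<in> sets M" for k using G pa(1) by (auto simp: subalgebra_def)
  note [measurable] = representation_measurable[OF rep]
  define E where "E k = {\<omega>\<in>G k. \<forall>j<m. \<forall>i<j. A \<omega> (k (f i), k (f j)) = of_bool (a i j)}" for k
  have E: "E k \<in> sets M" for k unfolding E_def using GM[of k] by measurable
  have em: "emeasure M (E k) = (\<integral>\<^sup>+\<omega>. ennreal (edge_prob W (\<lambda>i. S \<omega> (k (f i))) m a) * indicator (G k) \<omega> \<partial>M)" for k
  proof (cases "inj_on k {..<n}")
    case True
    have "inj_on (\<lambda>i. k (f i)) {..<m}"
      using True finj fn mn by (auto simp: inj_on_def)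
    moreover have "enat (k (f i)) < N \<omega>" if "\<omega> \<in> G k" "i < m" for \<omega> i
      using that fn[of i] mn bij_betwE[of k "{..<n}" "inside \<omega>"] by (auto simp: G_def sorting_def)
    ultimately show ?thesis unfolding E_def
      by (rule graph_representation_pattern[OF prob_space_axioms graph kernel _ G])
  next
    case False
    then have "G k = {}" by (auto simp: G_def sorting_def bij_betw_def)
    then show ?thesis by (simp add: E_def)
  qed
  have epm: "(\<lambda>\<omega>. ennreal (edge_prob W (\<lambda>i. S \<omega> (k (f i))) m a) * indicator (G k) \<omega>) \<in> borel_measurable M" for k
  proof -
    have [measurable]: "(\<lambda>\<omega>. edge_prob W (\<lambda>i. S \<omega> (k (f i))) m a) \<in> borel_measurable M"
      by (rule measurable_edge_prob[OF kernel]) simp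
    show ?thesis using GM[of k] by measurable
  qed
  have sp: "\<xi> \<omega> \<in> space measures" if "\<omega> \<in> space M" for \<omega> using measurable_space[OF measurable_\<xi> that] .
  have split: "(\<integral>\<^sup>+\<omega>. indicator (sorted_event n f C \<inter> edge_event m f a) (\<xi> \<omega>) \<partial>M) =
      (\<integral>\<^sup>+\<omega>. \<integral>\<^sup>+k. indicator (E k) \<omega> \<partial>count_space ?K \<partial>M)"
  proof (rule nn_integral_cong_AE)
    show "AE \<omega> in M. indicator (sorted_event n f C \<inter> edge_event m f a) (\<xi> \<omega>) = (\<integral>\<^sup>+k. indicator (E k) \<omega> \<partial>count_space ?K)"
      using AE_sorting[of n] AE_space
    proof eventually_elim
      case (elim \<omega>)
      then obtain \<kappa> where "sorted_by \<kappa> n \<omega>" by blast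
      note \<kappa> = sorted_byD[OF this]
      show ?case
      proof (cases "num (\<xi> \<omega>) = n")
        case False
        then have "indicator (E k) \<omega> = (0 :: ennreal)" if "k \<in> ?K" for k
          using \<kappa>(2)[OF that] by (simp add: E_def G_def)
        then have "(\<integral>\<^sup>+k. indicator (E k) \<omega> \<partial>count_space ?K) = (\<integral>\<^sup>+k. 0 \<partial>count_space ?K)"
          by (intro nn_integral_cong) simp
        then show ?thesis using False by (simp add: sorted_event_def)
      next
        case True
        note \<kappa> = \<kappa>[unfolded True]
        have "indicator (E k) \<omega> = (0 :: ennreal)" if "k \<in> ?K" "k \<noteq> \<kappa>" for k
          using \<kappa>(2)[OF that(1)] that(2) by (simp add: E_def G_def)
        then have "(\<integral>\<^sup>+k. indicator (E k) \<omega> \<partial>count_space ?K) = indicator (E \<kappa>) \<omega>"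
          using \<kappa>(1) by (intro nn_integral_count_space_single)
        moreover have "\<omega> \<in> E \<kappa> \<longleftrightarrow> \<xi> \<omega> \<in> sorted_event n f C \<inter> edge_event m f a"
        proof -
          have "(\<lambda>i\<in>{..<n}. pt (f i) (\<xi> \<omega>)) = (\<lambda>i\<in>{..<n}. S \<omega> (\<kappa> (f i)))"
            by (intro restrict_ext) (simp add: \<kappa>(3) fn)
          moreover have "(\<forall>j<m. \<forall>i<j. adj (f i) (f j) (\<xi> \<omega>) = of_bool (a i j)) \<longleftrightarrow>
              (\<forall>j<m. \<forall>i<j. A \<omega> (\<kappa> (f i), \<kappa> (f j)) = of_bool (a i j))"
            using mn by (intro all_cong) (simp add: \<kappa>(4) fn)
          moreover have "sorting \<kappa> n \<omega>" using \<kappa>(1,2) by simp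
          ultimately show ?thesis
            using elim sp True by (simp add: E_def G_def sorted_event_def edge_event_def)
        qed
        ultimately show ?thesis by (simp add: indicator_def)
      qed
    qed
  qed
  have swap: "(\<integral>\<^sup>+\<omega>. \<integral>\<^sup>+k. indicator (E k) \<omega> \<partial>count_space ?K \<partial>M) =
      (\<integral>\<^sup>+k. \<integral>\<^sup>+\<omega>. indicator (E k) \<omega> \<partial>M \<partial>count_space ?K)"
    by (rule nn_integral_count_space_nn_integral[OF K]) (use E in simp)
  have cond: "(\<integral>\<^sup>+k. \<integral>\<^sup>+\<omega>. indicator (E k) \<omega> \<partial>M \<partial>count_space ?K) =
      (\<integral>\<^sup>+k. \<integral>\<^sup>+\<omega>. ennreal (edge_prob W (\<lambda>i. S \<omega> (k (f i))) m a) * indicator (G k) \<omega> \<partial>M \<partial>count_space ?K)"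
    by (rule nn_integral_cong) (simp only: nn_integral_indicator[OF E] em)
  have swap': "(\<integral>\<^sup>+k. \<integral>\<^sup>+\<omega>. ennreal (edge_prob W (\<lambda>i. S \<omega> (k (f i))) m a) * indicator (G k) \<omega> \<partial>M \<partial>count_space ?K) =
      (\<integral>\<^sup>+\<omega>. \<integral>\<^sup>+k. ennreal (edge_prob W (\<lambda>i. S \<omega> (k (f i))) m a) * indicator (G k) \<omega> \<partial>count_space ?K \<partial>M)"
    by (rule nn_integral_count_space_nn_integral[OF K epm, symmetric])
  have join: "(\<integral>\<^sup>+\<omega>. \<integral>\<^sup>+k. ennreal (edge_prob W (\<lambda>i. S \<omega> (k (f i))) m a) * indicator (G k) \<omega> \<partial>count_space ?K \<partial>M) =
      (\<integral>\<^sup>+\<omega>. ennreal (edge_prob W (\<lambda>i. pt (f i) (\<xi> \<omega>)) m a) * indicator (sorted_event n f C) (\<xi> \<omega>) \<partial>M)"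
  proof (rule nn_integral_cong_AE)
    show "AE \<omega> in M. (\<integral>\<^sup>+k. ennreal (edge_prob W (\<lambda>i. S \<omega> (k (f i))) m a) * indicator (G k) \<omega> \<partial>count_space ?K) =
        ennreal (edge_prob W (\<lambda>i. pt (f i) (\<xi> \<omega>)) m a) * indicator (sorted_event n f C) (\<xi> \<omega>)"
      using AE_sorting[of n] AE_space
    proof eventually_elim
      case (elim \<omega>)
      then obtain \<kappa> where "sorted_by \<kappa> n \<omega>" by blast
      note \<kappa> = sorted_byD[OF this]
      let ?h = "\<lambda>k. ennreal (edge_prob W (\<lambda>i. S \<omega> (k (f i))) m a) * indicator (G k) \<omega>"
      show ?case
      proof (cases "num (\<xi> \<omega>) = n")
        case False
        then have "?h k = 0" if "k \<in> ?K" for k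
          using \<kappa>(2)[OF that] by (simp add: G_def)
        then have "(\<integral>\<^sup>+k. ?h k \<partial>count_space ?K) = (\<integral>\<^sup>+k. 0 \<partial>count_space ?K)"
          by (intro nn_integral_cong) simp
        then show ?thesis using False by (simp add: sorted_event_def)
      next
        case True
        note \<kappa> = \<kappa>[unfolded True]
        have "?h k = 0" if "k \<in> ?K" "k \<noteq> \<kappa>" for k
          using \<kappa>(2)[OF that(1)] that(2) by (simp add: G_def)
        then have "(\<integral>\<^sup>+k. ?h k \<partial>count_space ?K) = ?h \<kappa>"
          using \<kappa>(1) by (intro nn_integral_count_space_single)
        moreover have "\<omega> \<in> G \<kappa> \<longleftrightarrow> \<xi> \<omega> \<in> sorted_event n f C"
        proof -
          have "(\<lambda>i\<in>{..<n}. pt (f i) (\<xi> \<omega>)) = (\<lambda>i\<in>{..<n}. S \<omega> (\<kappa> (f i)))"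
            by (intro restrict_ext) (simp add: \<kappa>(3) fn)
          moreover have "sorting \<kappa> n \<omega>" using \<kappa>(1,2) by simp
          ultimately show ?thesis
            using elim sp True by (simp add: G_def sorted_event_def)
        qed
        moreover have "edge_prob W (\<lambda>i. S \<omega> (\<kappa> (f i))) m a = edge_prob W (\<lambda>i. pt (f i) (\<xi> \<omega>)) m a"
          using mn by (intro edge_prob_cong) (simp_all add: \<kappa>(3) fn)
        ultimately show ?thesis by (simp add: indicator_def)
      qed
    qed
  qed
  show ?thesis by (rule trans[OF split trans[OF swap trans[OF cond trans[OF swap' join]]]])
qed

end


section \<open>Ordering the points at random\<close>

lemma point_sum_restrict:
  fixes s :: "nat \<Rightarrow> 'a::polish_space" and a :: "nat \<times> nat \<Rightarrow> real" and n :: nat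
  assumes x: "x = point_sum (J \<times> J) (\<lambda>(i, j). (s i, s j, a (i, j)))" and B: "B \<in> sets borel"
    and l: "bij_betw l {..<n} {k\<in>J. s k \<in> B}"
  shows "adjacency_restrict x B = point_sum ({..<n} \<times> {..<n}) (\<lambda>(i, j). (s (l i), s (l j), a (l i, l j)))"
proof (rule measure_eqI)
  let ?D = "B \<times> B \<times> (UNIV :: real set)"
  let ?f = "\<lambda>(i, j). (s i, s j, a (i, j))" and ?g = "\<lambda>(i, j). (s (l i), s (l j), a (l i, l j))"
  have sx: "sets x = sets borel" unfolding x point_sum_def by simp
  show "sets (adjacency_restrict x B) = sets (point_sum ({..<n} \<times> {..<n}) ?g)"
    unfolding adjacency_restrict_def point_sum_def using sx by simp
  fix F assume "F \<in> sets (adjacency_restrict x B)"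
  then have F: "F \<in> sets borel" using sx by (simp add: adjacency_restrict_def)
  have D: "?D \<in> sets borel" using B by (intro Times_borel3) simp_all
  have linj: "inj_on l {..<n}" and lim: "l ` {..<n} = {k\<in>J. s k \<in> B}" using l by (simp_all add: bij_betw_def)
  let ?Q1 = "{p \<in> J \<times> J. ?f p \<in> ?D \<inter> F}" and ?Q2 = "{p \<in> {..<n} \<times> {..<n}. ?g p \<in> F}"
  have "bij_betw (map_prod l l) ?Q2 ?Q1"
  proof (rule bij_betw_imageI)
    show "inj_on (map_prod l l) ?Q2"
      using map_prod_inj_on[OF linj linj] by (rule inj_on_subset) blast
    show "map_prod l l ` ?Q2 = ?Q1"
    proof (intro equalityI subsetI)
      fix p assume "p \<in> map_prod l l ` ?Q2"
      then obtain i j where ij: "i < n" "j < n" "?g (i, j) \<in> F" "p = (l i, l j)" by auto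
      moreover have "l i \<in> {k\<in>J. s k \<in> B}" "l j \<in> {k\<in>J. s k \<in> B}" using ij(1,2) lim by blast+
      ultimately show "p \<in> ?Q1" by simp
    next
      fix p assume p: "p \<in> ?Q1"
      obtain i j where ij: "p = (i, j)" by (cases p)
      have "i \<in> {k\<in>J. s k \<in> B}" "j \<in> {k\<in>J. s k \<in> B}" "?f (i, j) \<in> F" using p ij by simp_all
      then obtain i' j' where "i' < n" "j' < n" "i = l i'" "j = l j'"
        unfolding lim[symmetric] by blast
      with \<open>?f (i, j) \<in> F\<close> ij show "p \<in> map_prod l l ` ?Q2"
        by (intro rev_image_eqI[of "(i', j')"]) simp_all
    qed
  qed
  moreover have "finite ?Q2" by (rule finite_subset[of _ "{..<n} \<times> {..<n}"]) auto
  ultimately have card: "card ?Q2 = card ?Q1" "finite ?Q1"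
    using bij_betw_same_card bij_betw_finite by blast+
  have "emeasure (adjacency_restrict x B) F = emeasure x (?D \<inter> F)"
    unfolding adjacency_restrict_def by (rule emeasure_restricted) (simp_all add: sx D F)
  also have "\<dots> = emeasure (count_space (J \<times> J)) ?Q1"
    unfolding x by (rule emeasure_point_sum) (intro sets.Int D F)
  also have "\<dots> = of_nat (card ?Q1)" by (rule emeasure_count_space_finite) (use card in auto)
  also have "\<dots> = emeasure (count_space ({..<n} \<times> {..<n})) ?Q2"
    unfolding card(1)[symmetric] using \<open>finite ?Q2\<close> by (intro emeasure_count_space_finite[symmetric]) auto
  also have "\<dots> = emeasure (point_sum ({..<n} \<times> {..<n}) ?g) F"
    by (rule emeasure_point_sum[symmetric]) (rule F)
  finally show "emeasure (adjacency_restrict x B) F = emeasure (point_sum ({..<n} \<times> {..<n}) ?g) F" .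
qed

lemma nn_integral_pair_times:
  assumes "prob_space L" and f: "f \<in> borel_measurable K" and g: "g \<in> borel_measurable L"
  shows "(\<integral>\<^sup>+p. f (fst p) * g (snd p) \<partial>(K \<Otimes>\<^sub>M L)) = (\<integral>\<^sup>+x. f x \<partial>K) * (\<integral>\<^sup>+y. g y \<partial>L)"
proof -
  interpret prob_space L by fact
  note [measurable] = f g
  have "(\<integral>\<^sup>+p. f (fst p) * g (snd p) \<partial>(K \<Otimes>\<^sub>M L)) = (\<integral>\<^sup>+x. \<integral>\<^sup>+y. f x * g y \<partial>L \<partial>K)"
    by (subst nn_integral_fst[symmetric]) simp_all
  also have "\<dots> = (\<integral>\<^sup>+x. f x * (\<integral>\<^sup>+y. g y \<partial>L) \<partial>K)"
    by (intro nn_integral_cong nn_integral_cmult g)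
  also have "\<dots> = (\<integral>\<^sup>+x. f x \<partial>K) * (\<integral>\<^sup>+y. g y \<partial>L)"
    by (rule nn_integral_multc) (rule f)
  finally show ?thesis .
qed

text \<open>
  The order \<open>h n (Z \<omega>)\<close> is a uniformly random bijection of \<open>{..<n}\<close>, and \<open>V\<close> is a sequence of fresh points
  of law \<open>\<mu>\<close>; both are independent of \<open>\<xi>\<close> by the assumption \<open>law\<close>. The assumption \<open>points\<close> is the only one
  that concerns the directing measure: divided by \<open>n!\<close>, it says that the points in random order have
  a product law on the event that there are \<open>n\<close> of them.
\<close>

locale randomized_graph_process = restricted_graph_process M W \<xi> N S A B e d
  for M :: "'w measure" and W :: "'a::polish_space \<Rightarrow> 'a \<Rightarrow> real"
    and \<xi> :: "'w \<Rightarrow> ('a \<times> 'a \<times> real) measure" and N S A B e d +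
  fixes Z :: "'w \<Rightarrow> real" and V :: "'w \<Rightarrow> nat \<Rightarrow> 'a" and \<mu> :: "'a measure"
    and h :: "nat \<Rightarrow> real \<Rightarrow> nat \<Rightarrow> nat" and K :: "nat \<Rightarrow> ennreal"
  assumes \<mu>: "prob_space \<mu>" "sets \<mu> = sets borel"
    and Z: "Z \<in> borel_measurable M" and V: "V \<in> borel_measurable M"
    and law: "distr M (measure_algebra borel \<Otimes>\<^sub>M (borel \<Otimes>\<^sub>M borel)) (\<lambda>\<omega>. (\<xi> \<omega>, Z \<omega>, V \<omega>)) =
      distr M (measure_algebra borel) \<xi> \<Otimes>\<^sub>M (unif \<Otimes>\<^sub>M (\<Pi>\<^sub>M k\<in>UNIV. \<mu>))"
    and h: "\<And>n. h n \<in> borel \<rightarrow>\<^sub>M count_space UNIV" "\<And>n u. h n u \<in> bijections {..<n} {..<n}"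
      "\<And>n f. f \<in> bijections {..<n} {..<n} \<Longrightarrow>
        emeasure unif (h n -` {f}) = 1 / of_nat (card (bijections {..<n} {..<n::nat}))"
    and points: "\<And>n C. (\<And>i. C i \<in> sets borel) \<Longrightarrow>
      (\<Sum>f\<in>bijections {..<n} {..<n}. \<integral>\<^sup>+\<omega>. indicator (sorted_event n f (PiE {..<n} C)) (\<xi> \<omega>) \<partial>M) =
      K n * (\<Prod>i<n. emeasure \<mu> (C i))"
begin

abbreviation orders :: "nat \<Rightarrow> (nat \<Rightarrow> nat) set" where
  "orders n \<equiv> bijections {..<n} {..<n}"

abbreviation PV :: "(nat \<Rightarrow> 'a) measure" where
  "PV \<equiv> \<Pi>\<^sub>M k\<in>UNIV. \<mu>"

definition N' :: "'w \<Rightarrow> enat" where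
  "N' \<omega> = enat (num (\<xi> \<omega>))"

text \<open>
  The sequence in an i.i.d. representation is infinite and independent of \<open>N\<close>. Behind the points in
  \<open>B\<close> it is therefore continued by fresh points with the same law.
\<close>

definition S' :: "'w \<Rightarrow> nat \<Rightarrow> 'a" where
  "S' \<omega> i = (if i < num (\<xi> \<omega>) then pt (h (num (\<xi> \<omega>)) (Z \<omega>) i) (\<xi> \<omega>) else V \<omega> i)"

definition A' :: "'w \<Rightarrow> nat \<times> nat \<Rightarrow> real" where
  "A' \<omega> = (\<lambda>(i, j). adj (h (num (\<xi> \<omega>)) (Z \<omega>) i) (h (num (\<xi> \<omega>)) (Z \<omega>) j) (\<xi> \<omega>))"

lemma finite_orders: "finite (orders n)"
  by (rule finite_bijections) auto

lemma sets_PV: "sets PV = sets borel" "sets PV = sets (\<Pi>\<^sub>M k\<in>(UNIV :: nat set). (borel :: 'a measure))"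
proof -
  show "sets PV = sets (\<Pi>\<^sub>M k\<in>(UNIV :: nat set). (borel :: 'a measure))"
    by (rule sets_PiM_UNIV_borel_cong) (rule \<mu>)
  then show "sets PV = sets borel" by (simp only: sets_PiM_equal_borel)
qed

lemma prob_PV: "prob_space PV"
  by (intro prob_space_PiM \<mu>)

lemma num_\<xi>: "(\<lambda>\<omega>. num (\<xi> \<omega>)) \<in> M \<rightarrow>\<^sub>M count_space UNIV"
  by (rule measurable_compose[OF measurable_\<xi> measurable_num])

lemma order_measurable: "(\<lambda>\<omega>. h (num (\<xi> \<omega>)) (Z \<omega>) i) \<in> M \<rightarrow>\<^sub>M count_space UNIV"
proof (rule measurable_compose_countable[OF _ num_\<xi>])
  fix n
  show "(\<lambda>\<omega>. h n (Z \<omega>) i) \<in> M \<rightarrow>\<^sub>M count_space UNIV"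
    by (rule measurable_compose[OF measurable_compose[OF Z h(1)], of "\<lambda>f. f i"]) simp
qed

lemma V_component: "(\<lambda>\<omega>. V \<omega> i) \<in> M \<rightarrow>\<^sub>M borel"
proof -
  have "V \<in> M \<rightarrow>\<^sub>M (\<Pi>\<^sub>M k\<in>UNIV. borel)" using V unfolding measurable_cong_sets[OF refl sets_PiM_equal_borel] .
  then show ?thesis by (rule measurable_compose) simp
qed

lemma S'_component: "(\<lambda>\<omega>. S' \<omega> i) \<in> M \<rightarrow>\<^sub>M borel"
proof -
  have "(\<lambda>\<omega>. pt (h (num (\<xi> \<omega>)) (Z \<omega>) i) (\<xi> \<omega>)) \<in> M \<rightarrow>\<^sub>M borel"
    by (rule measurable_compose_countable[OF _ order_measurable]) (rule measurable_compose[OF measurable_\<xi> measurable_pt])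
  moreover have "{\<omega>\<in>space M. i < num (\<xi> \<omega>)} \<in> sets M"
    using measurable_sets[OF num_\<xi>, of "{i<..}"] by (simp add: vimage_def Int_def conj_commute)
  ultimately show ?thesis
    unfolding S'_def by (intro measurable_If V_component)
qed

lemma S'_measurable: "S' \<in> M \<rightarrow>\<^sub>M (\<Pi>\<^sub>M k\<in>UNIV. borel)"
  by (rule measurable_PiM_UNIV_borel) (rule S'_component)

lemma A'_component: "(\<lambda>\<omega>. A' \<omega> p) \<in> borel_measurable M"
proof -
  obtain i j where p: "p = (i, j)" by (cases p)
  have "(\<lambda>\<omega>. adj (h (num (\<xi> \<omega>)) (Z \<omega>) i) l (\<xi> \<omega>)) \<in> borel_measurable M" for l
    by (rule measurable_compose_countable[OF _ order_measurable]) (rule measurable_compose[OF measurable_\<xi> measurable_adj])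
  then show ?thesis
    unfolding A'_def p prod.case by (rule measurable_compose_countable[OF _ order_measurable])
qed

lemma N'_measurable: "N' \<in> M \<rightarrow>\<^sub>M count_space UNIV"
  unfolding N'_def by (rule measurable_compose[OF num_\<xi>]) simp

text \<open>
  Fubini: given \<open>\<xi>\<close>, the order takes each of its \<open>n!\<close> values with equal probability, independently of \<open>V\<close>.
\<close>

lemma randomization:
  assumes \<Phi>: "\<And>f. f \<in> orders n \<Longrightarrow> \<Phi> f \<in> borel_measurable measures" and H: "H \<in> sets borel"
  shows "(\<integral>\<^sup>+\<omega>. \<Phi> (h n (Z \<omega>)) (\<xi> \<omega>) * indicator H (V \<omega>) \<partial>M) =
    (\<Sum>f\<in>orders n. \<integral>\<^sup>+\<omega>. \<Phi> f (\<xi> \<omega>) \<partial>M) * (emeasure PV H / of_nat (card (orders n)))"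
proof -
  interpret PV: prob_space PV by (rule prob_PV)
  interpret u: prob_space unif by (rule prob_space_unif)
  interpret uPV: prob_space "unif \<Otimes>\<^sub>M PV" by (intro prob_space_pair prob_space_unif prob_PV)
  have sp: "sets (unif \<Otimes>\<^sub>M PV) = sets (borel \<Otimes>\<^sub>M borel)" by (intro sets_pair_measure_cong sets_PV) simp
  have D: "h n -` {f} \<in> sets borel" for f using measurable_sets[OF h(1), of "{f}"] by simp
  have HP: "H \<in> sets PV" using H sets_PV by simp
  have DH: "h n -` {f} \<times> H \<in> sets (borel \<Otimes>\<^sub>M borel)" for f using D H by simp
  have one: "(\<integral>\<^sup>+\<omega>. \<Phi> f (\<xi> \<omega>) * indicator (h n -` {f} \<times> H) (Z \<omega>, V \<omega>) \<partial>M) =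
      (\<integral>\<^sup>+\<omega>. \<Phi> f (\<xi> \<omega>) \<partial>M) * (emeasure PV H / of_nat (card (orders n)))" if f: "f \<in> orders n" for f
  proof -
    have i: "(indicator (h n -` {f} \<times> H) :: _ \<Rightarrow> ennreal) \<in> borel_measurable (borel \<Otimes>\<^sub>M borel)"
      by (rule borel_measurable_indicator) (rule DH)
    have i': "(indicator (h n -` {f} \<times> H) :: _ \<Rightarrow> ennreal) \<in> borel_measurable (unif \<Otimes>\<^sub>M PV)"
      by (rule borel_measurable_indicator) (simp only: sp DH)
    have \<Phi>d: "\<Phi> f \<in> borel_measurable (distr M measures \<xi>)" using \<Phi>[OF f] by simp
    have m: "(\<lambda>p. \<Phi> f (fst p) * indicator (h n -` {f} \<times> H) (snd p)) \<in> borel_measurable (measures \<Otimes>\<^sub>M (borel \<Otimes>\<^sub>M borel))"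
      by (intro borel_measurable_times_ennreal measurable_compose[OF measurable_fst \<Phi>[OF f]] measurable_compose[OF measurable_snd i])
    have T: "(\<lambda>\<omega>. (\<xi> \<omega>, Z \<omega>, V \<omega>)) \<in> M \<rightarrow>\<^sub>M measures \<Otimes>\<^sub>M (borel \<Otimes>\<^sub>M borel)"
      by (intro measurable_Pair measurable_\<xi> Z V)
    have "(\<integral>\<^sup>+\<omega>. \<Phi> f (\<xi> \<omega>) * indicator (h n -` {f} \<times> H) (Z \<omega>, V \<omega>) \<partial>M) =
        (\<integral>\<^sup>+p. \<Phi> f (fst p) * indicator (h n -` {f} \<times> H) (snd p) \<partial>distr M (measures \<Otimes>\<^sub>M (borel \<Otimes>\<^sub>M borel)) (\<lambda>\<omega>. (\<xi> \<omega>, Z \<omega>, V \<omega>)))"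
      by (subst nn_integral_distr[OF T]) (simp_all add: m)
    also have "\<dots> = (\<integral>\<^sup>+x. \<Phi> f x \<partial>distr M measures \<xi>) * (\<integral>\<^sup>+p. indicator (h n -` {f} \<times> H) p \<partial>(unif \<Otimes>\<^sub>M PV))"
      unfolding law by (rule nn_integral_pair_times[OF uPV.prob_space_axioms \<Phi>d i'])
    also have "(\<integral>\<^sup>+x. \<Phi> f x \<partial>distr M measures \<xi>) = (\<integral>\<^sup>+\<omega>. \<Phi> f (\<xi> \<omega>) \<partial>M)"
      by (rule nn_integral_distr[OF measurable_\<xi> \<Phi>d])
    also have "(\<integral>\<^sup>+p. indicator (h n -` {f} \<times> H) p \<partial>(unif \<Otimes>\<^sub>M PV)) = emeasure (unif \<Otimes>\<^sub>M PV) (h n -` {f} \<times> H)"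
      by (rule nn_integral_indicator) (simp only: sp DH)
    also have "\<dots> = emeasure unif (h n -` {f}) * emeasure PV H"
      by (rule PV.emeasure_pair_measure_Times) (simp_all add: D HP)
    also have "\<dots> = emeasure PV H / of_nat (card (orders n))"
      unfolding h(3)[OF f] by (simp add: divide_ennreal_def mult.commute)
    finally show ?thesis .
  qed
  have "(\<integral>\<^sup>+\<omega>. \<Phi> (h n (Z \<omega>)) (\<xi> \<omega>) * indicator H (V \<omega>) \<partial>M) =
      (\<integral>\<^sup>+\<omega>. (\<Sum>f\<in>orders n. \<Phi> f (\<xi> \<omega>) * indicator (h n -` {f} \<times> H) (Z \<omega>, V \<omega>)) \<partial>M)"
  proof (rule nn_integral_cong)
    fix \<omega>
    have "(\<Sum>f\<in>orders n. \<Phi> f (\<xi> \<omega>) * indicator (h n -` {f} \<times> H) (Z \<omega>, V \<omega>)) =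
        (\<Sum>f\<in>orders n. if h n (Z \<omega>) = f then \<Phi> f (\<xi> \<omega>) * indicator H (V \<omega>) else 0)"
      by (intro sum.cong refl) (simp add: indicator_def)
    also have "\<dots> = \<Phi> (h n (Z \<omega>)) (\<xi> \<omega>) * indicator H (V \<omega>)"
      by (subst sum.delta'[OF finite_orders]) (simp add: h(2))
    finally show "\<Phi> (h n (Z \<omega>)) (\<xi> \<omega>) * indicator H (V \<omega>) =
        (\<Sum>f\<in>orders n. \<Phi> f (\<xi> \<omega>) * indicator (h n -` {f} \<times> H) (Z \<omega>, V \<omega>))" by simp
  qed
  also have "\<dots> = (\<Sum>f\<in>orders n. \<integral>\<^sup>+\<omega>. \<Phi> f (\<xi> \<omega>) * indicator (h n -` {f} \<times> H) (Z \<omega>, V \<omega>) \<partial>M)"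
  proof (rule nn_integral_sum)
    fix f assume f: "f \<in> orders n"
    have "(indicator (h n -` {f} \<times> H) :: _ \<Rightarrow> ennreal) \<in> borel_measurable (borel \<Otimes>\<^sub>M borel)"
      by (rule borel_measurable_indicator) (rule DH)
    then show "(\<lambda>\<omega>. \<Phi> f (\<xi> \<omega>) * indicator (h n -` {f} \<times> H) (Z \<omega>, V \<omega>)) \<in> borel_measurable M"
      by (intro borel_measurable_times_ennreal measurable_compose[OF measurable_\<xi> \<Phi>[OF f]]
          measurable_compose[OF measurable_Pair[OF Z V]])
  qed
  finally show ?thesis by (simp add: one sum_distrib_right)
qed

lemma sorted_event_iff:
  assumes "\<omega> \<in> space M"
  shows "\<xi> \<omega> \<in> sorted_event n (h n (Z \<omega>)) C \<longleftrightarrow> num (\<xi> \<omega>) = n \<and> restrict (S' \<omega>) {..<n} \<in> C"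
proof -
  have "(\<lambda>i\<in>{..<n}. pt (h n (Z \<omega>) i) (\<xi> \<omega>)) = restrict (S' \<omega>) {..<n}" if "num (\<xi> \<omega>) = n"
    by (intro restrict_ext) (simp add: S'_def that)
  then show ?thesis
    using measurable_space[OF measurable_\<xi> assms] by (auto simp: sorted_event_def simp del: restrict_apply)
qed

text \<open>Averaging \<open>sorted_representation_pattern\<close> over the random order.\<close>

lemma randomized_pattern:
  assumes mn: "m \<le> n" and C: "C \<in> sets (\<Pi>\<^sub>M i\<in>{..<n}. borel)"
  defines "G \<equiv> {\<omega>\<in>space M. num (\<xi> \<omega>) = n \<and> restrict (S' \<omega>) {..<n} \<in> C}"
  shows "(\<integral>\<^sup>+\<omega>. indicator {\<omega>\<in>G. \<forall>j<m. \<forall>i<j. A' \<omega> (i, j) = of_bool (a i j)} \<omega> \<partial>M) =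
    (\<integral>\<^sup>+\<omega>. ennreal (edge_prob W (S' \<omega>) m a) * indicator G \<omega> \<partial>M)"
proof -
  have sp: "\<xi> \<omega> \<in> space measures" if "\<omega> \<in> space M" for \<omega> using measurable_space[OF measurable_\<xi> that] .
  have G: "\<omega> \<in> G \<longleftrightarrow> \<xi> \<omega> \<in> sorted_event n (h n (Z \<omega>)) C" if "\<omega> \<in> space M" for \<omega>
    unfolding G_def sorted_event_iff[OF that] using that by simp
  have numG: "num (\<xi> \<omega>) = n" if "\<omega> \<in> G" for \<omega> using that by (simp add: G_def)
  have "(\<integral>\<^sup>+\<omega>. indicator {\<omega>\<in>G. \<forall>j<m. \<forall>i<j. A' \<omega> (i, j) = of_bool (a i j)} \<omega> \<partial>M) =
      (\<integral>\<^sup>+\<omega>. indicator (sorted_event n (h n (Z \<omega>)) C \<inter> edge_event m (h n (Z \<omega>)) a) (\<xi> \<omega>) * indicator UNIV (V \<omega>) \<partial>M)"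
  proof (rule nn_integral_cong)
    fix \<omega> assume \<omega>: "\<omega> \<in> space M"
    have "(\<forall>j<m. \<forall>i<j. A' \<omega> (i, j) = of_bool (a i j)) \<longleftrightarrow> \<xi> \<omega> \<in> edge_event m (h n (Z \<omega>)) a" if "\<omega> \<in> G"
      using sp[OF \<omega>] by (simp add: A'_def edge_event_def numG[OF that])
    then have "\<omega> \<in> {\<omega>\<in>G. \<forall>j<m. \<forall>i<j. A' \<omega> (i, j) = of_bool (a i j)} \<longleftrightarrow>
        \<xi> \<omega> \<in> sorted_event n (h n (Z \<omega>)) C \<inter> edge_event m (h n (Z \<omega>)) a"
      unfolding mem_Collect_eq Int_iff G[OF \<omega>, symmetric] by blast
    then show "indicator {\<omega>\<in>G. \<forall>j<m. \<forall>i<j. A' \<omega> (i, j) = of_bool (a i j)} \<omega> =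
        (indicator (sorted_event n (h n (Z \<omega>)) C \<inter> edge_event m (h n (Z \<omega>)) a) (\<xi> \<omega>) * indicator UNIV (V \<omega>) :: ennreal)"
      by (simp only: indicator_def UNIV_I of_bool_eq mult_1_right)
  qed
  also have "\<dots> = (\<Sum>f\<in>orders n. \<integral>\<^sup>+\<omega>. indicator (sorted_event n f C \<inter> edge_event m f a) (\<xi> \<omega>) \<partial>M) *
      (emeasure PV UNIV / of_nat (card (orders n)))"
    by (rule randomization) (intro borel_measurable_indicator sets.Int sorted_event_sets[OF C] edge_event_sets, simp)
  also have "(\<Sum>f\<in>orders n. \<integral>\<^sup>+\<omega>. indicator (sorted_event n f C \<inter> edge_event m f a) (\<xi> \<omega>) \<partial>M) =
      (\<Sum>f\<in>orders n. \<integral>\<^sup>+\<omega>. ennreal (edge_prob W (\<lambda>i. pt (f i) (\<xi> \<omega>)) m a) * indicator (sorted_event n f C) (\<xi> \<omega>) \<partial>M)"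
    by (intro sum.cong refl sorted_representation_pattern mn C)
  also have "\<dots> * (emeasure PV UNIV / of_nat (card (orders n))) =
      (\<integral>\<^sup>+\<omega>. (ennreal (edge_prob W (\<lambda>i. pt (h n (Z \<omega>) i) (\<xi> \<omega>)) m a) * indicator (sorted_event n (h n (Z \<omega>)) C) (\<xi> \<omega>)) * indicator UNIV (V \<omega>) \<partial>M)"
  proof (rule randomization[symmetric])
    fix f
    show "(\<lambda>x. ennreal (edge_prob W (\<lambda>i. pt (f i) x) m a) * indicator (sorted_event n f C) x) \<in> borel_measurable measures"
      by (intro borel_measurable_times_ennreal measurable_compose[OF measurable_edge_prob[OF kernel measurable_pt] measurable_ennreal]
          borel_measurable_indicator sorted_event_sets[OF C])
  qed simp
  also have "\<dots> = (\<integral>\<^sup>+\<omega>. ennreal (edge_prob W (S' \<omega>) m a) * indicator G \<omega> \<partial>M)"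
  proof (rule nn_integral_cong)
    fix \<omega> assume \<omega>: "\<omega> \<in> space M"
    have "edge_prob W (\<lambda>i. pt (h n (Z \<omega>) i) (\<xi> \<omega>)) m a = edge_prob W (S' \<omega>) m a" if "\<omega> \<in> G"
      using mn by (intro edge_prob_cong) (simp_all add: S'_def numG[OF that])
    then show "(ennreal (edge_prob W (\<lambda>i. pt (h n (Z \<omega>) i) (\<xi> \<omega>)) m a) * indicator (sorted_event n (h n (Z \<omega>)) C) (\<xi> \<omega>)) * indicator UNIV (V \<omega>) =
        ennreal (edge_prob W (S' \<omega>) m a) * indicator G \<omega>"
      using G[OF \<omega>] by (cases "\<omega> \<in> G") simp_all
  qed
  finally show ?thesis .
qed

lemma AE_representation:
  "AE \<omega> in M. inj_on (S' \<omega>) (indices (N' \<omega>)) \<and>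
     (\<forall>i\<in>indices (N' \<omega>). \<forall>j\<in>indices (N' \<omega>). A' \<omega> (i, j) \<in> {0, 1} \<and> A' \<omega> (j, i) = A' \<omega> (i, j)) \<and>
     adjacency_restrict (\<xi> \<omega>) B = point_sum (indices (N' \<omega>) \<times> indices (N' \<omega>)) (\<lambda>(i, j). (S' \<omega> i, S' \<omega> j, A' \<omega> (i, j))) \<and>
     (\<forall>i\<in>indices (N' \<omega>). A' \<omega> (i, i) = 0)"
proof -
  have r1: "AE \<omega> in M. inj_on (S \<omega>) (indices (N \<omega>)) \<and>
        (\<forall>i\<in>indices (N \<omega>). \<forall>j\<in>indices (N \<omega>). A \<omega> (i, j) \<in> {0, 1} \<and> A \<omega> (j, i) = A \<omega> (i, j)) \<and>
        \<xi> \<omega> = point_sum (indices (N \<omega>) \<times> indices (N \<omega>)) (\<lambda>(i, j). (S \<omega> i, S \<omega> j, A \<omega> (i, j)))"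
    using rep by (simp add: representation_def)
  have r2: "AE \<omega> in M. \<forall>i\<in>indices (N \<omega>). A \<omega> (i, i) = 0"
    using graph by (simp add: graph_representation_def)
  show ?thesis
    using r1 r2 AE_sorting[of 0]
  proof eventually_elim
    case (elim \<omega>)
    let ?J = "indices (N \<omega>)" and ?n = "num (\<xi> \<omega>)"
    have x: "\<xi> \<omega> = point_sum (?J \<times> ?J) (\<lambda>(i, j). (S \<omega> i, S \<omega> j, A \<omega> (i, j)))"
      and a: "\<And>i j. i \<in> ?J \<Longrightarrow> j \<in> ?J \<Longrightarrow> A \<omega> (i, j) \<in> {0, 1} \<and> A \<omega> (j, i) = A \<omega> (i, j)" and inj: "inj_on (S \<omega>) ?J"
      and diag: "\<And>i. i \<in> ?J \<Longrightarrow> A \<omega> (i, i) = 0"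
      using elim(1,2) by blast+
    from elim(3) obtain k where "sorted_by k 0 \<omega>" by blast
    note k = sorted_byD[OF this]
    define l where "l i = k (h ?n (Z \<omega>) i)" for i
    have hn: "h ?n (Z \<omega>) i < ?n" if "i < ?n" for i
      using h(2)[of ?n "Z \<omega>"] that by (auto simp: bijections_def)
    have l: "bij_betw l {..<?n} (inside \<omega>)"
    proof -
      have b: "bij_betw (h ?n (Z \<omega>)) {..<?n} {..<?n}" using h(2)[of ?n "Z \<omega>"] by (simp add: bijections_def)
      have "bij_betw k {..<?n} (inside \<omega>)" using k(5) unfolding sorting_def by (rule conjunct1)
      from bij_betw_trans[OF b this] show ?thesis unfolding l_def comp_def .
    qed
    have lJ: "l i \<in> ?J" if "i < ?n" for i
      using bspec[OF bij_betwE[OF l], of i] that by simp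
    have S'l: "S' \<omega> i = S \<omega> (l i)" if "i < ?n" for i
      using k(3)[OF hn[OF that]] that by (simp add: S'_def l_def)
    have A'l: "A' \<omega> (i, j) = A \<omega> (l i, l j)" if "i < ?n" "j < ?n" for i j
      using k(4)[OF hn[OF that(1)] hn[OF that(2)]] by (simp add: A'_def l_def)
    have ind: "indices (N' \<omega>) = {..<?n}" unfolding N'_def by (rule indices_enat)
    have "inj_on (S' \<omega>) {..<?n}"
    proof (rule inj_onI)
      fix i j assume ij: "i \<in> {..<?n}" "j \<in> {..<?n}" "S' \<omega> i = S' \<omega> j"
      then have "l i = l j" using inj_onD[OF inj _ lJ lJ, of i j] S'l[of i] S'l[of j] by simp
      then show "i = j" using l ij by (auto simp: bij_betw_def dest: inj_onD)
    qed
    moreover have "\<forall>i\<in>{..<?n}. \<forall>j\<in>{..<?n}. A' \<omega> (i, j) \<in> {0, 1} \<and> A' \<omega> (j, i) = A' \<omega> (i, j)"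
    proof (intro ballI)
      fix i j assume ij: "i \<in> {..<?n}" "j \<in> {..<?n}"
      then have "i < ?n" "j < ?n" by simp_all
      with a[OF lJ lJ, of i j] show "A' \<omega> (i, j) \<in> {0, 1} \<and> A' \<omega> (j, i) = A' \<omega> (i, j)"
        by (simp only: A'l)
    qed
    moreover have "\<forall>i\<in>{..<?n}. A' \<omega> (i, i) = 0"
    proof
      fix i assume "i \<in> {..<?n}"
      then have "i < ?n" by simp
      with diag[OF lJ, of i] show "A' \<omega> (i, i) = 0" by (simp only: A'l)
    qed
    moreover have "adjacency_restrict (\<xi> \<omega>) B = point_sum ({..<?n} \<times> {..<?n}) (\<lambda>(i, j). (S' \<omega> i, S' \<omega> j, A' \<omega> (i, j)))"
    proof -
      have "adjacency_restrict (\<xi> \<omega>) B = point_sum ({..<?n} \<times> {..<?n}) (\<lambda>(i, j). (S \<omega> (l i), S \<omega> (l j), A \<omega> (l i, l j)))"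
        by (rule point_sum_restrict[OF x borel_B l])
      also have "\<dots> = point_sum ({..<?n} \<times> {..<?n}) (\<lambda>(i, j). (S' \<omega> i, S' \<omega> j, A' \<omega> (i, j)))"
        unfolding point_sum_def
      proof (intro distr_cong refl)
        fix p assume "p \<in> space (count_space ({..<?n} \<times> {..<?n}))"
        then obtain i j where "p = (i, j)" "i < ?n" "j < ?n" by auto
        then show "(case p of (i, j) \<Rightarrow> (S \<omega> (l i), S \<omega> (l j), A \<omega> (l i, l j))) = (case p of (i, j) \<Rightarrow> (S' \<omega> i, S' \<omega> j, A' \<omega> (i, j)))"
          by (simp only: prod.case S'l A'l)
      qed
      finally show ?thesis .
    qed
    ultimately show ?case unfolding ind by (intro conjI)
  qed
qed

lemma is_representation: "representation M (\<lambda>\<omega>. adjacency_restrict (\<xi> \<omega>) B) N' S' A'"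
  unfolding representation_def
proof (intro conjI)
  show "A' \<in> M \<rightarrow>\<^sub>M (\<Pi>\<^sub>M p\<in>UNIV. borel)" by (rule measurable_PiM_UNIV_borel) (rule A'_component)
  show "AE \<omega> in M. inj_on (S' \<omega>) (indices (N' \<omega>)) \<and>
     (\<forall>i\<in>indices (N' \<omega>). \<forall>j\<in>indices (N' \<omega>). A' \<omega> (i, j) \<in> {0, 1} \<and> A' \<omega> (j, i) = A' \<omega> (i, j)) \<and>
     adjacency_restrict (\<xi> \<omega>) B = point_sum (indices (N' \<omega>) \<times> indices (N' \<omega>)) (\<lambda>(i, j). (S' \<omega> i, S' \<omega> j, A' \<omega> (i, j)))"
    using AE_representation by eventually_elim (elim conjE, intro conjI)
qed (rule N'_measurable S'_measurable)+

lemma nn_integral_split_num: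
  assumes "X \<in> borel_measurable M"
  shows "(\<integral>\<^sup>+\<omega>. X \<omega> \<partial>M) = (\<integral>\<^sup>+n. \<integral>\<^sup>+\<omega>. X \<omega> * indicator {\<omega>\<in>space M. num (\<xi> \<omega>) = n} \<omega> \<partial>M \<partial>count_space UNIV)"
proof -
  have ev: "{\<omega>\<in>space M. num (\<xi> \<omega>) = n} \<in> sets M" for n
    using measurable_sets[OF num_\<xi>, of "{n}"] by (simp add: vimage_def Int_def conj_commute)
  have "(\<integral>\<^sup>+\<omega>. X \<omega> \<partial>M) = (\<integral>\<^sup>+\<omega>. \<integral>\<^sup>+n. X \<omega> * indicator {\<omega>\<in>space M. num (\<xi> \<omega>) = n} \<omega> \<partial>count_space UNIV \<partial>M)"
  proof (rule nn_integral_cong)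
    fix \<omega> assume "\<omega> \<in> space M"
    then show "X \<omega> = (\<integral>\<^sup>+n. X \<omega> * indicator {\<omega>\<in>space M. num (\<xi> \<omega>) = n} \<omega> \<partial>count_space UNIV)"
      by (subst nn_integral_count_space_single[of "num (\<xi> \<omega>)"]) simp_all
  qed
  also have "\<dots> = (\<integral>\<^sup>+n. \<integral>\<^sup>+\<omega>. X \<omega> * indicator {\<omega>\<in>space M. num (\<xi> \<omega>) = n} \<omega> \<partial>M \<partial>count_space UNIV)"
    by (intro nn_integral_count_space_nn_integral borel_measurable_times_ennreal assms borel_measurable_indicator ev) simp
  finally show ?thesis .
qed

text \<open>
  A conditional probability is characterized by its integrals over the events of the points algebra.
  These split according to the number of points, and for a fixed number \<open>points_algebra_trace\<close> reduces them
  to the events treated in \<open>randomized_pattern\<close>.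
\<close>

lemma is_graph_representation: "graph_representation M W (\<lambda>\<omega>. adjacency_restrict (\<xi> \<omega>) B) N' S' A'"
  unfolding graph_representation_def
proof (intro conjI allI)
  show "representation M (\<lambda>\<omega>. adjacency_restrict (\<xi> \<omega>) B) N' S' A'" by (rule is_representation)
  show "AE \<omega> in M. \<forall>i\<in>indices (N' \<omega>). A' \<omega> (i, i) = 0"
    using AE_representation by eventually_elim (elim conjE)
  fix m a
  let ?P = "points_algebra M N' S'"
  define E where "E = {\<omega>\<in>space M. enat m \<le> N' \<omega> \<and> (\<forall>j<m. \<forall>i<j. A' \<omega> (i, j) = of_bool (a i j))}"
  define g where "g \<omega> = (if enat m \<le> N' \<omega> then edge_prob W (S' \<omega>) m a else 0)" for \<omega>
  note pa = points_algebra[of N' M S', OF N'_measurable S'_component]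
  note [measurable] = N'_measurable A'_component
  have E[measurable]: "E \<in> sets M" unfolding E_def by measurable
  interpret finite_measure_subalgebra M ?P
    by standard (rule pa(1))
  have g01: "0 \<le> g \<omega>" "g \<omega> \<le> 1" for \<omega> by (simp_all add: g_def edge_prob_nonneg edge_prob_le_1)
  have gP: "g \<in> borel_measurable ?P"
  proof -
    define s where "s \<omega> i = (if enat i < N' \<omega> then S' \<omega> i else undefined)" for \<omega> i
    have s: "(\<lambda>\<omega>. s \<omega> i) \<in> ?P \<rightarrow>\<^sub>M borel" for i
      unfolding s_def by (rule points_algebra_measurable(2)[OF N'_measurable S'_component])
    have [measurable]: "N' \<in> ?P \<rightarrow>\<^sub>M count_space UNIV"
      by (rule points_algebra_measurable(1)[OF N'_measurable S'_component])
    have [measurable]: "(\<lambda>\<omega>. edge_prob W (s \<omega>) m a) \<in> borel_measurable ?P"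
      by (rule measurable_edge_prob[OF kernel s])
    have "g = (\<lambda>\<omega>. if enat m \<le> N' \<omega> then edge_prob W (s \<omega>) m a else 0)"
    proof
      fix \<omega>
      have "edge_prob W (S' \<omega>) m a = edge_prob W (s \<omega>) m a" if "enat m \<le> N' \<omega>"
        by (rule edge_prob_cong) (use that in \<open>auto simp: s_def N'_def\<close>)
      then show "g \<omega> = (if enat m \<le> N' \<omega> then edge_prob W (s \<omega>) m a else 0)" by (simp add: g_def)
    qed
    then show ?thesis by simp
  qed
  have gM[measurable]: "g \<in> borel_measurable M" using measurable_from_subalg[OF pa(1) gP] .
  have key: "emeasure M (E \<inter> F) = (\<integral>\<^sup>+\<omega>. ennreal (g \<omega>) * indicator F \<omega> \<partial>M)" if F: "F \<in> sets ?P" for F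
  proof -
    have FM[measurable]: "F \<in> sets M" using F pa(1) by (auto simp: subalgebra_def)
    have "emeasure M (E \<inter> F) = (\<integral>\<^sup>+\<omega>. indicator (E \<inter> F) \<omega> \<partial>M)" by simp
    also have "\<dots> = (\<integral>\<^sup>+n. \<integral>\<^sup>+\<omega>. indicator (E \<inter> F) \<omega> * indicator {\<omega>\<in>space M. num (\<xi> \<omega>) = n} \<omega> \<partial>M \<partial>count_space UNIV)"
      by (rule nn_integral_split_num) simp
    also have "\<dots> = (\<integral>\<^sup>+n. \<integral>\<^sup>+\<omega>. ennreal (g \<omega>) * indicator F \<omega> * indicator {\<omega>\<in>space M. num (\<xi> \<omega>) = n} \<omega> \<partial>M \<partial>count_space UNIV)"
    proof (rule nn_integral_cong)
      fix n
      obtain C where C: "C \<in> sets (\<Pi>\<^sub>M i\<in>{..<n}. borel)"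
        and FC: "{\<omega>\<in>F. N' \<omega> = enat n} = {\<omega>\<in>space M. N' \<omega> = enat n \<and> restrict (S' \<omega>) {..<n} \<in> C}"
        using points_algebra_trace[OF N'_measurable S'_component F, of n] by blast
      let ?G = "{\<omega>\<in>space M. num (\<xi> \<omega>) = n \<and> restrict (S' \<omega>) {..<n} \<in> C}"
      have FG: "\<omega> \<in> F \<and> num (\<xi> \<omega>) = n \<longleftrightarrow> \<omega> \<in> ?G" for \<omega>
        using FC[unfolded N'_def enat.inject] by blast
      have sp: "\<omega> \<in> space M" if "\<omega> \<in> F" for \<omega> using sets.sets_into_space[OF FM] that by blast
      show "(\<integral>\<^sup>+\<omega>. indicator (E \<inter> F) \<omega> * indicator {\<omega>\<in>space M. num (\<xi> \<omega>) = n} \<omega> \<partial>M) =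
          (\<integral>\<^sup>+\<omega>. ennreal (g \<omega>) * indicator F \<omega> * indicator {\<omega>\<in>space M. num (\<xi> \<omega>) = n} \<omega> \<partial>M)"
      proof (cases "m \<le> n")
        case False
        have z: "indicator (E \<inter> F) \<omega> * indicator {\<omega>\<in>space M. num (\<xi> \<omega>) = n} \<omega> = (0 :: ennreal)"
          "ennreal (g \<omega>) * indicator F \<omega> * indicator {\<omega>\<in>space M. num (\<xi> \<omega>) = n} \<omega> = 0" for \<omega>
          using False by (auto simp: indicator_def E_def g_def N'_def)
        show ?thesis unfolding z ..
      next
        case True
        have "(\<integral>\<^sup>+\<omega>. indicator (E \<inter> F) \<omega> * indicator {\<omega>\<in>space M. num (\<xi> \<omega>) = n} \<omega> \<partial>M) =
            (\<integral>\<^sup>+\<omega>. indicator {\<omega>\<in>?G. \<forall>j<m. \<forall>i<j. A' \<omega> (i, j) = of_bool (a i j)} \<omega> \<partial>M)"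
        proof (rule nn_integral_cong)
          fix \<omega>
          have "\<omega> \<in> E \<and> \<omega> \<in> F \<and> \<omega> \<in> space M \<and> num (\<xi> \<omega>) = n \<longleftrightarrow> \<omega> \<in> ?G \<and> (\<forall>j<m. \<forall>i<j. A' \<omega> (i, j) = of_bool (a i j))"
            using FG[of \<omega>] sp[of \<omega>] True unfolding E_def N'_def by auto
          then have "\<omega> \<in> (E \<inter> F) \<inter> {\<omega>\<in>space M. num (\<xi> \<omega>) = n} \<longleftrightarrow>
              \<omega> \<in> {\<omega>\<in>?G. \<forall>j<m. \<forall>i<j. A' \<omega> (i, j) = of_bool (a i j)}"
            by (simp only: Int_iff mem_Collect_eq conj_assoc)
          then show "indicator (E \<inter> F) \<omega> * indicator {\<omega>\<in>space M. num (\<xi> \<omega>) = n} \<omega> =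
              (indicator {\<omega>\<in>?G. \<forall>j<m. \<forall>i<j. A' \<omega> (i, j) = of_bool (a i j)} \<omega> :: ennreal)"
            unfolding indicator_inter_arith[symmetric] by (simp only: indicator_def)
        qed
        also have "\<dots> = (\<integral>\<^sup>+\<omega>. ennreal (edge_prob W (S' \<omega>) m a) * indicator ?G \<omega> \<partial>M)"
          by (rule randomized_pattern[OF True C])
        also have "\<dots> = (\<integral>\<^sup>+\<omega>. ennreal (g \<omega>) * indicator F \<omega> * indicator {\<omega>\<in>space M. num (\<xi> \<omega>) = n} \<omega> \<partial>M)"
        proof (rule nn_integral_cong)
          fix \<omega>
          have "indicator F \<omega> * indicator {\<omega>\<in>space M. num (\<xi> \<omega>) = n} \<omega> = (indicator ?G \<omega> :: ennreal)"
          proof -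
            have "\<omega> \<in> F \<inter> {\<omega>\<in>space M. num (\<xi> \<omega>) = n} \<longleftrightarrow> \<omega> \<in> ?G"
              using FG[of \<omega>] sp[of \<omega>] by blast
            then show ?thesis unfolding indicator_inter_arith[symmetric] by (simp only: indicator_def)
          qed
          moreover have "g \<omega> = edge_prob W (S' \<omega>) m a" if "\<omega> \<in> ?G"
            using that True by (simp add: g_def N'_def)
          ultimately show "ennreal (edge_prob W (S' \<omega>) m a) * indicator ?G \<omega> =
              ennreal (g \<omega>) * indicator F \<omega> * indicator {\<omega>\<in>space M. num (\<xi> \<omega>) = n} \<omega>"
            unfolding mult.assoc by (cases "\<omega> \<in> ?G") simp_all
        qed
        finally show ?thesis .
      qed
    qed
    also have "\<dots> = (\<integral>\<^sup>+\<omega>. ennreal (g \<omega>) * indicator F \<omega> \<partial>M)"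
      by (rule nn_integral_split_num[symmetric]) measurable
    finally show ?thesis .
  qed
  have gi: "integrable M g"
    by (rule integrable_const_bound[where B = 1]) (use g01 in auto)
  have "AE \<omega> in M. real_cond_exp M ?P (indicator E) \<omega> = g \<omega>"
  proof (rule real_cond_exp_charact[OF _ _ gi gP])
    fix F assume F: "F \<in> sets ?P"
    have FM[measurable]: "F \<in> sets M" using F pa(1) by (auto simp: subalgebra_def)
    have "ennreal (\<integral>\<omega>\<in>F. indicator E \<omega> \<partial>M) = ennreal (\<integral>\<omega>. indicator (E \<inter> F) \<omega> \<partial>M)"
      by (simp add: set_lebesgue_integral_def indicator_inter_arith mult.commute)
    also have "\<dots> = emeasure M (E \<inter> F)" by (simp add: emeasure_eq_measure)
    also have "\<dots> = (\<integral>\<^sup>+\<omega>. ennreal (g \<omega>) * indicator F \<omega> \<partial>M)" by (rule key[OF F])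
    also have "\<dots> = (\<integral>\<^sup>+\<omega>. ennreal (indicator F \<omega> *\<^sub>R g \<omega>) \<partial>M)"
      by (intro nn_integral_cong) (simp add: indicator_def)
    also have "\<dots> = ennreal (\<integral>\<omega>\<in>F. g \<omega> \<partial>M)"
      unfolding set_lebesgue_integral_def
      by (rule nn_integral_eq_integral)
         (use integrable_mult_indicator[OF FM gi] g01 in \<open>auto simp: indicator_def\<close>)
    finally show "(\<integral>\<omega>\<in>F. indicator E \<omega> \<partial>M) = (\<integral>\<omega>\<in>F. g \<omega> \<partial>M)"
      unfolding set_lebesgue_integral_def
      by (subst (asm) ennreal_inj) (auto intro!: integral_nonneg_AE simp: g01)
  qed (simp add: less_top[symmetric])
  then show "AE \<omega> in M. real_cond_exp M ?P (indicator {\<omega>\<in>space M. enat m \<le> N' \<omega> \<and> (\<forall>j<m. \<forall>i<j. A' \<omega> (i, j) = of_bool (a i j))}) \<omega> =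
      (if enat m \<le> N' \<omega> then \<Prod>j<m. \<Prod>i<j. pmf (bernoulli_pmf (W (S' \<omega> i) (S' \<omega> j))) (a i j) else 0)"
    unfolding E_def g_def edge_prob_def .
qed

text \<open>
  For a rectangle, the positions below \<open>n\<close> contribute by the assumption \<open>points\<close> and the remaining ones by
  the law of the fresh points. The constant \<open>K n / n!\<close> is identified by taking the whole space.
\<close>

lemma points_rectangle:
  assumes C: "\<And>i. C i \<in> sets borel" and r: "n \<le> r"
  shows "emeasure M {\<omega>\<in>space M. num (\<xi> \<omega>) = n \<and> (\<forall>i<r. S' \<omega> i \<in> C i)} =
    emeasure M {\<omega>\<in>space M. num (\<xi> \<omega>) = n} * (\<Prod>i<r. emeasure \<mu> (C i))"
proof -
  interpret \<mu>: prob_space \<mu> by (rule \<mu>)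
  have rect: "emeasure M {\<omega>\<in>space M. num (\<xi> \<omega>) = n \<and> (\<forall>i<r. S' \<omega> i \<in> C i)} =
      K n / of_nat (card (orders n)) * (\<Prod>i<r. emeasure \<mu> (C i))"
    if C: "\<And>i. C i \<in> sets borel" and r: "n \<le> r" for C r
  proof -
    define H where "H = {v. \<forall>i\<in>{n..<r}. v i \<in> C i}"
    have Hemb: "H = {v \<in> space PV. \<forall>i\<in>{n..<r}. v i \<in> C i}"
      unfolding H_def using sets_eq_imp_space_eq[OF \<mu>(2)] by (simp add: space_PiM)
    interpret PV: product_prob_space "\<lambda>_. \<mu>" "UNIV :: nat set" by unfold_locales
    have PH: "emeasure PV H = (\<Prod>i\<in>{n..<r}. emeasure \<mu> (C i))"
      unfolding Hemb by (rule PV.emeasure_PiM_Collect) (simp_all add: C \<mu>(2))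
    have "H \<in> sets PV"
      unfolding Hemb by (intro sets.sets_Collect_finite_All sets_Collect_single') (use C \<mu>(2) sets_eq_imp_space_eq[OF \<mu>(2)] in simp_all)
    then have H: "H \<in> sets borel" by (simp only: sets_PV)
    have PC: "PiE {..<n} C \<in> sets (\<Pi>\<^sub>M i\<in>{..<n}. borel)" by (intro sets_PiM_I_finite C) simp
    have ev: "{\<omega>\<in>space M. num (\<xi> \<omega>) = n \<and> (\<forall>i<r. S' \<omega> i \<in> C i)} \<in> sets M"
    proof -
      have [measurable]: "(\<lambda>\<omega>. num (\<xi> \<omega>)) \<in> M \<rightarrow>\<^sub>M count_space UNIV" by (rule num_\<xi>)
      have [measurable]: "(\<lambda>\<omega>. S' \<omega> i) \<in> M \<rightarrow>\<^sub>M borel" for i by (rule S'_component)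
      note [measurable] = C
      show ?thesis by measurable
    qed
    have "emeasure M {\<omega>\<in>space M. num (\<xi> \<omega>) = n \<and> (\<forall>i<r. S' \<omega> i \<in> C i)} =
        (\<integral>\<^sup>+\<omega>. indicator {\<omega>\<in>space M. num (\<xi> \<omega>) = n \<and> (\<forall>i<r. S' \<omega> i \<in> C i)} \<omega> \<partial>M)"
      using ev by simp
    also have "\<dots> = (\<integral>\<^sup>+\<omega>. indicator (sorted_event n (h n (Z \<omega>)) (PiE {..<n} C)) (\<xi> \<omega>) * indicator H (V \<omega>) \<partial>M)"
    proof (rule nn_integral_cong)
      fix \<omega> assume \<omega>: "\<omega> \<in> space M"
      have "(\<forall>i<r. S' \<omega> i \<in> C i) \<longleftrightarrow> restrict (S' \<omega>) {..<n} \<in> PiE {..<n} C \<and> V \<omega> \<in> H"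
        if n: "num (\<xi> \<omega>) = n"
      proof -
        have "(\<forall>i<r. S' \<omega> i \<in> C i) \<longleftrightarrow> (\<forall>i<n. S' \<omega> i \<in> C i) \<and> (\<forall>i\<in>{n..<r}. S' \<omega> i \<in> C i)"
          using r by (metis atLeastLessThan_iff le_less_linear less_le_trans)
        also have "(\<forall>i\<in>{n..<r}. S' \<omega> i \<in> C i) \<longleftrightarrow> V \<omega> \<in> H"
          unfolding H_def using n by (simp add: S'_def)
        also have "(\<forall>i<n. S' \<omega> i \<in> C i) \<longleftrightarrow> restrict (S' \<omega>) {..<n} \<in> PiE {..<n} C"
          by (simp add: restrict_PiE_iff Pi_iff Ball_def)
        finally show ?thesis .
      qed
      then have "\<omega> \<in> {\<omega>\<in>space M. num (\<xi> \<omega>) = n \<and> (\<forall>i<r. S' \<omega> i \<in> C i)} \<longleftrightarrow>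
          \<xi> \<omega> \<in> sorted_event n (h n (Z \<omega>)) (PiE {..<n} C) \<and> V \<omega> \<in> H"
        unfolding sorted_event_iff[OF \<omega>] mem_Collect_eq using \<omega> by blast
      then show "indicator {\<omega>\<in>space M. num (\<xi> \<omega>) = n \<and> (\<forall>i<r. S' \<omega> i \<in> C i)} \<omega> =
          (indicator (sorted_event n (h n (Z \<omega>)) (PiE {..<n} C)) (\<xi> \<omega>) * indicator H (V \<omega>) :: ennreal)"
        by (cases "\<xi> \<omega> \<in> sorted_event n (h n (Z \<omega>)) (PiE {..<n} C)"; cases "V \<omega> \<in> H") (simp_all only: indicator_def of_bool_eq mult_1_left mult_zero_left mult_zero_right simp_thms)
    qed
    also have "\<dots> = (\<Sum>f\<in>orders n. \<integral>\<^sup>+\<omega>. indicator (sorted_event n f (PiE {..<n} C)) (\<xi> \<omega>) \<partial>M) * (emeasure PV H / of_nat (card (orders n)))"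
      by (intro randomization borel_measurable_indicator sorted_event_sets PC H)
    also have "\<dots> = K n * (\<Prod>i<n. emeasure \<mu> (C i)) * ((\<Prod>i\<in>{n..<r}. emeasure \<mu> (C i)) / of_nat (card (orders n)))"
      unfolding points[OF C] PH ..
    also have "\<dots> = K n / of_nat (card (orders n)) * ((\<Prod>i<n. emeasure \<mu> (C i)) * (\<Prod>i\<in>{n..<r}. emeasure \<mu> (C i)))"
      by (simp add: divide_ennreal_def mult_ac)
    also have "(\<Prod>i<n. emeasure \<mu> (C i)) * (\<Prod>i\<in>{n..<r}. emeasure \<mu> (C i)) = (\<Prod>i<r. emeasure \<mu> (C i))"
      using prod.atLeastLessThan_concat[of 0 n r "\<lambda>i. emeasure \<mu> (C i)"] r by (simp add: atLeast0LessThan)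
    finally show ?thesis .
  qed
  have "emeasure M {\<omega>\<in>space M. num (\<xi> \<omega>) = n} = K n / of_nat (card (orders n))"
    using rect[of "\<lambda>_. UNIV" n] sets_eq_imp_space_eq[OF \<mu>(2)] \<mu>.emeasure_space_1 by simp
  then show ?thesis using rect[OF C r] by simp
qed

text \<open>Rectangles determine a finite measure on the sequence space.\<close>

lemma points_law:
  assumes F: "F \<in> sets (\<Pi>\<^sub>M k\<in>UNIV. borel)"
  shows "emeasure M {\<omega>\<in>space M. num (\<xi> \<omega>) = n \<and> S' \<omega> \<in> F} = emeasure M {\<omega>\<in>space M. num (\<xi> \<omega>) = n} * emeasure PV F"
proof -
  let ?B = "\<Pi>\<^sub>M k\<in>(UNIV :: nat set). (borel :: 'a measure)"
  interpret PV: prob_space PV by (rule prob_PV)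
  define G where "G = {\<omega>\<in>space M. num (\<xi> \<omega>) = n}"
  have G: "G \<in> sets M"
    using measurable_sets[OF num_\<xi>, of "{n}"] by (simp add: G_def vimage_def Int_def conj_commute)
  define L where "L = distr (density M (indicator G)) ?B S'"
  have LM: "emeasure L D = emeasure M {\<omega>\<in>space M. num (\<xi> \<omega>) = n \<and> S' \<omega> \<in> D}" if D: "D \<in> sets ?B" for D
  proof -
    have "emeasure L D = emeasure (density M (indicator G)) (S' -` D \<inter> space M)"
      unfolding L_def by (subst emeasure_distr) (simp_all add: S'_measurable D)
    also have "\<dots> = emeasure M (G \<inter> (S' -` D \<inter> space M))"
      by (rule emeasure_restricted[OF G measurable_sets[OF S'_measurable D]])
    also have "G \<inter> (S' -` D \<inter> space M) = {\<omega>\<in>space M. num (\<xi> \<omega>) = n \<and> S' \<omega> \<in> D}"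
      unfolding G_def by blast
    finally show ?thesis .
  qed
  have "L = scale_measure (emeasure M G) PV"
  proof (rule measure_eqI_PiM_infinite[where M = "\<lambda>_. borel" and I = UNIV])
    show "sets L = sets ?B" by (simp add: L_def)
    show "sets (scale_measure (emeasure M G) PV) = sets ?B" using sets_PV(2) by simp
    show "finite_measure L"
    proof (rule finite_measureI)
      have "emeasure L (space L) = emeasure M {\<omega>\<in>space M. num (\<xi> \<omega>) = n \<and> S' \<omega> \<in> space ?B}"
        using LM[OF sets.top] by (simp add: L_def)
      then show "emeasure L (space L) \<noteq> \<infinity>" by simp
    qed
    fix C :: "nat \<Rightarrow> 'a set" and J :: "nat set"
    assume J: "finite J" and C: "\<And>i. i \<in> J \<Longrightarrow> C i \<in> sets borel"
    define D where "D i = (if i \<in> J then C i else UNIV)" for i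
    have D: "D i \<in> sets borel" for i using C by (simp add: D_def)
    define r where "r = max n (Suc (Max (insert 0 J)))"
    have Jr: "J \<subseteq> {..<r}"
    proof
      fix i assume "i \<in> J"
      then have "i \<le> Max (insert 0 J)" using J by (intro Max_ge) simp_all
      then show "i \<in> {..<r}" unfolding r_def by simp
    qed
    have emb: "prod_emb UNIV (\<lambda>_. borel) J (PiE J C) = {s. \<forall>i<r. s i \<in> D i}"
      using Jr by (auto simp: prod_emb_def D_def PiE_iff subset_eq)
    have PE: "prod_emb UNIV (\<lambda>_. borel) J (PiE J C) \<in> sets ?B"
      using J C by (intro sets_PiM_I) auto
    interpret \<mu>: prob_space \<mu> by (rule \<mu>)
    interpret PVp: product_prob_space "\<lambda>_. \<mu>" "UNIV :: nat set" by unfold_locales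
    have "{s. \<forall>i<r. s i \<in> D i} = {s \<in> space PV. \<forall>i\<in>{..<r}. s i \<in> D i}"
      using sets_eq_imp_space_eq[OF \<mu>(2)] by (simp add: space_PiM Ball_def)
    also have "emeasure PV \<dots> = (\<Prod>i<r. emeasure \<mu> (D i))"
      by (rule PVp.emeasure_PiM_Collect) (simp_all add: D \<mu>(2))
    finally have PVr: "emeasure PV {s. \<forall>i<r. s i \<in> D i} = (\<Prod>i<r. emeasure \<mu> (D i))" .
    have "emeasure L (prod_emb UNIV (\<lambda>_. borel) J (PiE J C)) =
        emeasure M {\<omega>\<in>space M. num (\<xi> \<omega>) = n \<and> (\<forall>i<r. S' \<omega> i \<in> D i)}"
      unfolding LM[OF PE] unfolding emb by simp
    also have "\<dots> = emeasure M G * (\<Prod>i<r. emeasure \<mu> (D i))"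
      unfolding G_def by (rule points_rectangle[OF D]) (simp add: r_def)
    also have "\<dots> = emeasure (scale_measure (emeasure M G) PV) (prod_emb UNIV (\<lambda>_. borel) J (PiE J C))"
      unfolding emb using PVr by simp
    finally show "emeasure L (prod_emb UNIV (\<lambda>_. borel) J (PiE J C)) =
        emeasure (scale_measure (emeasure M G) PV) (prod_emb UNIV (\<lambda>_. borel) J (PiE J C))" .
  qed
  then show ?thesis using LM[OF F] by (simp add: G_def)
qed

lemma num_S'_law:
  assumes F: "F \<in> sets (\<Pi>\<^sub>M k\<in>UNIV. borel)"
  shows "emeasure M {\<omega>\<in>space M. N' \<omega> \<in> D \<and> S' \<omega> \<in> F} = emeasure M {\<omega>\<in>space M. N' \<omega> \<in> D} * emeasure PV F"
proof -
  have F': "{\<omega>\<in>space M. S' \<omega> \<in> F} \<in> sets M"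
    using measurable_sets[OF S'_measurable F] by (simp add: vimage_def Int_def conj_commute)
  have D': "{\<omega>\<in>space M. N' \<omega> \<in> D} \<in> sets M"
    using measurable_sets[OF N'_measurable, of D] by (simp add: vimage_def Int_def conj_commute)
  have ev: "{\<omega>\<in>space M. num (\<xi> \<omega>) = n} \<in> sets M" for n
    using measurable_sets[OF num_\<xi>, of "{n}"] by (simp add: vimage_def Int_def conj_commute)
  have *: "(\<integral>\<^sup>+\<omega>. indicator {\<omega>\<in>space M. N' \<omega> \<in> D \<and> S' \<omega> \<in> F} \<omega> * indicator {\<omega>\<in>space M. num (\<xi> \<omega>) = n} \<omega> \<partial>M) =
      indicator D (enat n) * emeasure M {\<omega>\<in>space M. num (\<xi> \<omega>) = n} * emeasure PV F"
    if F: "F \<in> sets (\<Pi>\<^sub>M k\<in>UNIV. borel)" for F n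
  proof -
    have F': "{\<omega>\<in>space M. S' \<omega> \<in> F} \<in> sets M"
      using measurable_sets[OF S'_measurable F] by (simp add: vimage_def Int_def conj_commute)
    have e: "{\<omega>\<in>space M. num (\<xi> \<omega>) = n \<and> S' \<omega> \<in> F} \<in> sets M"
      using sets.Int[OF ev[of n] F'] by (simp add: Int_def conj_ac cong: conj_cong)
    have "indicator {\<omega>\<in>space M. N' \<omega> \<in> D \<and> S' \<omega> \<in> F} \<omega> * indicator {\<omega>\<in>space M. num (\<xi> \<omega>) = n} \<omega> =
        (indicator D (enat n) * indicator {\<omega>\<in>space M. num (\<xi> \<omega>) = n \<and> S' \<omega> \<in> F} \<omega> :: ennreal)" for \<omega>
      by (auto simp: indicator_def N'_def)
    then have "(\<integral>\<^sup>+\<omega>. indicator {\<omega>\<in>space M. N' \<omega> \<in> D \<and> S' \<omega> \<in> F} \<omega> * indicator {\<omega>\<in>space M. num (\<xi> \<omega>) = n} \<omega> \<partial>M) =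
        (\<integral>\<^sup>+\<omega>. indicator D (enat n) * indicator {\<omega>\<in>space M. num (\<xi> \<omega>) = n \<and> S' \<omega> \<in> F} \<omega> \<partial>M)"
      by (simp only:)
    also have "\<dots> = indicator D (enat n) * emeasure M {\<omega>\<in>space M. num (\<xi> \<omega>) = n \<and> S' \<omega> \<in> F}"
      by (rule nn_integral_cmult_indicator[OF e])
    finally show ?thesis by (simp only: points_law[OF F] mult.assoc)
  qed
  have both: "emeasure M {\<omega>\<in>space M. N' \<omega> \<in> D \<and> S' \<omega> \<in> F} =
      (\<integral>\<^sup>+n. indicator D (enat n) * emeasure M {\<omega>\<in>space M. num (\<xi> \<omega>) = n} \<partial>count_space UNIV) * emeasure PV F"
    if F: "F \<in> sets (\<Pi>\<^sub>M k\<in>UNIV. borel)" for F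
  proof -
    have F': "{\<omega>\<in>space M. S' \<omega> \<in> F} \<in> sets M"
      using measurable_sets[OF S'_measurable F] by (simp add: vimage_def Int_def conj_commute)
    have e: "{\<omega>\<in>space M. N' \<omega> \<in> D \<and> S' \<omega> \<in> F} \<in> sets M"
      using sets.Int[OF D' F'] by (simp add: Int_def conj_ac cong: conj_cong)
    then have "emeasure M {\<omega>\<in>space M. N' \<omega> \<in> D \<and> S' \<omega> \<in> F} = (\<integral>\<^sup>+\<omega>. indicator {\<omega>\<in>space M. N' \<omega> \<in> D \<and> S' \<omega> \<in> F} \<omega> \<partial>M)"
      by simp
    also have "\<dots> = (\<integral>\<^sup>+n. indicator D (enat n) * emeasure M {\<omega>\<in>space M. num (\<xi> \<omega>) = n} * emeasure PV F \<partial>count_space UNIV)"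
      using nn_integral_split_num[of "indicator {\<omega>\<in>space M. N' \<omega> \<in> D \<and> S' \<omega> \<in> F}"] e by (simp only: * F borel_measurable_indicator)
    also have "\<dots> = (\<integral>\<^sup>+n. indicator D (enat n) * emeasure M {\<omega>\<in>space M. num (\<xi> \<omega>) = n} \<partial>count_space UNIV) * emeasure PV F"
      by (rule nn_integral_multc) simp
    finally show ?thesis .
  qed
  interpret PV: prob_space PV by (rule prob_PV)
  have sp: "space PV = space (\<Pi>\<^sub>M k\<in>(UNIV :: nat set). (borel :: 'a measure))"
    by (rule sets_eq_imp_space_eq[OF sets_PV(2)])
  have "emeasure M {\<omega>\<in>space M. N' \<omega> \<in> D} =
      (\<integral>\<^sup>+n. indicator D (enat n) * emeasure M {\<omega>\<in>space M. num (\<xi> \<omega>) = n} \<partial>count_space UNIV)"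
    using both[OF sets.top] PV.emeasure_space_1 sp by (simp add: space_PiM)
  then show ?thesis using both[OF F] by simp
qed

lemma is_iid_representation: "iid_representation M (\<lambda>\<omega>. adjacency_restrict (\<xi> \<omega>) B) N' S' A'"
  unfolding iid_representation_def
proof (intro conjI)
  let ?B = "\<Pi>\<^sub>M k\<in>(UNIV :: nat set). (borel :: 'a measure)"
  have law: "emeasure M {\<omega>\<in>space M. S' \<omega> \<in> F} = emeasure PV F" if "F \<in> sets ?B" for F
    using num_S'_law[OF that, of UNIV] by (simp add: emeasure_space_1)
  have S'PV: "S' \<in> M \<rightarrow>\<^sub>M PV" using S'_measurable unfolding measurable_cong_sets[OF refl sets_PV(2)] .
  have "distr M PV S' = PV"
  proof (rule measure_eqI)
    fix F assume "F \<in> sets (distr M PV S')"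
    then have F: "F \<in> sets PV" by simp
    then have "emeasure (distr M PV S') F = emeasure M {\<omega>\<in>space M. S' \<omega> \<in> F}"
      by (subst emeasure_distr[OF S'PV F]) (simp add: vimage_def Int_def conj_commute)
    then show "emeasure (distr M PV S') F = emeasure PV F" using law F sets_PV(2) by simp
  qed simp
  then have "iid M \<mu> S'" using S'PV iid_iff_distr[OF prob_space_axioms \<mu>(1)] by simp
  then show "\<exists>\<mu>. prob_space \<mu> \<and> sets \<mu> = sets borel \<and> iid M \<mu> S'" using \<mu> by blast
  show "\<exists>W. connection_kernel W \<and> graph_representation M W (\<lambda>\<omega>. adjacency_restrict (\<xi> \<omega>) B) N' S' A'"
    using kernel is_graph_representation by blast
  show "independent M (count_space UNIV) N' ?B S'"
    unfolding independent_def indep_set_def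
  proof (intro conjI N'_measurable S'_measurable indep_sets2_eq[THEN iffD2, unfolded indep_set_def] ballI)
    show "sets (vimage_algebra (space M) N' (count_space UNIV)) \<subseteq> events"
      using measurable_sets[OF N'_measurable] by (subst sets_vimage_algebra2) auto
    show "sets (vimage_algebra (space M) S' ?B) \<subseteq> events"
      using measurable_sets[OF S'_measurable] measurable_space[OF S'_measurable] by (subst sets_vimage_algebra2) auto
    fix a b assume "a \<in> sets (vimage_algebra (space M) N' (count_space UNIV))" "b \<in> sets (vimage_algebra (space M) S' ?B)"
    then obtain D F where a: "a = N' -` D \<inter> space M" and b: "b = S' -` F \<inter> space M" and F: "F \<in> sets ?B"
      using measurable_space[OF S'_measurable] by (subst (asm) (1 2) sets_vimage_algebra2) auto
    have a': "a = {\<omega>\<in>space M. N' \<omega> \<in> D}" and b': "b = {\<omega>\<in>space M. S' \<omega> \<in> F}"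
      and ab: "a \<inter> b = {\<omega>\<in>space M. N' \<omega> \<in> D \<and> S' \<omega> \<in> F}" using a b by auto
    have "ennreal (prob (a \<inter> b)) = ennreal (prob a * prob b)"
      using num_S'_law[OF F, of D] law[OF F] unfolding a'[symmetric] b'[symmetric] ab[symmetric]
      by (simp add: emeasure_eq_measure ennreal_mult)
    then show "prob (a \<inter> b) = prob a * prob b" by (subst (asm) ennreal_inj) auto
  qed
qed

end


section \<open>Counts of mixed Poisson and mixed binomial processes\<close>

abbreviation fibre_card :: "nat \<Rightarrow> (nat \<Rightarrow> nat) \<Rightarrow> nat \<Rightarrow> nat" where
  "fibre_card n c j \<equiv> card {i\<in>{..<n}. c i = j}"

text \<open>
  The colouring \<open>col\<close> partitions \<open>B\<close> into the sets \<open>{y\<in>B. col y = j}\<close> for \<open>j < k\<close>, and \<open>c\<close> colours the positions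
  \<open>i < n\<close>. The condition says that the numbers of points in the parts have a multinomial law given
  their sum, without division by the probability of the sum. It captures all that mixed Poisson and
  mixed binomial processes have in common here, with a constant \<open>K n\<close> that depends on \<open>n\<close> only.
\<close>

definition colour_counts ::
    "'w measure \<Rightarrow> ('w \<Rightarrow> 'a::polish_space measure) \<Rightarrow> 'a set \<Rightarrow> 'a measure \<Rightarrow> (nat \<Rightarrow> ennreal) \<Rightarrow> bool" where
  "colour_counts M \<nu> B \<mu> K \<longleftrightarrow>
     (\<forall>n k col c. col \<in> borel \<rightarrow>\<^sub>M count_space UNIV \<and> (\<forall>x. col x < k) \<and> (\<forall>i<n. c i < (k::nat)) \<longrightarrow>
        of_nat (\<Prod>j<k. fact (fibre_card n c j)) *
          emeasure M {\<omega>\<in>space M. \<forall>j<k. emeasure (\<nu> \<omega>) {y\<in>B. col y = j} = of_nat (fibre_card n c j)} =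
        K n * (\<Prod>i<n. emeasure \<mu> {y\<in>B. col y = c i}))"

lemma colour_class_borel:
  assumes "col \<in> borel \<rightarrow>\<^sub>M count_space (UNIV :: nat set)" "B \<in> sets borel"
  shows "{y\<in>B. col y = j} \<in> sets borel"
proof -
  have "{y\<in>B. col y = j} = B \<inter> (col -` {j} \<inter> space borel)" by auto
  also have "\<dots> \<in> sets borel" by (intro sets.Int assms(2) measurable_sets[OF assms(1)]) simp
  finally show ?thesis .
qed

lemma sum_fibre_card:
  assumes "\<And>i. i < n \<Longrightarrow> c i < k"
  shows "(\<Sum>j<k. fibre_card n c j) = n"
proof -
  have "(\<Sum>j<k. card {i\<in>{..<n}. c i = j}) = card (\<Union>j<k. {i\<in>{..<n}. c i = j})"
    by (rule card_UN_disjoint[symmetric]) auto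
  also have "(\<Union>j<k. {i\<in>{..<n}. c i = j}) = {..<n}" using assms by auto
  finally show ?thesis by simp
qed

lemma prod_power_fibre_card:
  fixes g :: "nat \<Rightarrow> 'b::comm_monoid_mult"
  assumes "\<And>i. i < n \<Longrightarrow> c i < k"
  shows "(\<Prod>j<k. g j ^ fibre_card n c j) = (\<Prod>i<n. g (c i))"
proof -
  have "(\<Prod>i<n. g (c i)) = (\<Prod>j<k. \<Prod>i\<in>{i\<in>{..<n}. c i = j}. g (c i))"
    using assms by (intro prod.group[symmetric]) auto
  also have "\<dots> = (\<Prod>j<k. g j ^ fibre_card n c j)"
    by (intro prod.cong refl) simp
  finally show ?thesis by simp
qed

text \<open>
  In the product of the Poisson probabilities with rates \<open>\<delta> \<mu>(D\<^sub>j)\<close>, the factors \<open>\<delta> ^ n\<^sub>j\<close> multiply to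
  \<open>\<delta> ^ n\<close> and the exponentials to \<open>exp (- \<delta> \<mu>(B))\<close>. The mean of \<open>\<delta> ^ n exp (- \<delta> \<mu>(B))\<close> is \<open>K n\<close>.
\<close>

lemma mixed_poisson_colour_counts:
  fixes \<nu> :: "'w \<Rightarrow> 'a::polish_space measure"
  assumes M: "prob_space M" and \<nu>: "mixed_poisson M \<nu>" and B: "B \<in> sets borel" "bounded B"
  obtains \<mu> K where "sets \<mu> = sets borel" "emeasure \<mu> B < \<infinity>" "colour_counts M \<nu> B \<mu> K"
    "emeasure \<mu> B = 0 \<Longrightarrow> K 0 = 1"
proof -
  interpret prob_space M by fact
  obtain \<delta> \<mu> where \<delta>: "\<delta> \<in> borel_measurable M" "AE \<omega> in M. \<delta> \<omega> \<ge> 0" and \<mu>: "locally_finite \<mu>"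
    and law: "\<And>(k::nat) C n. (\<forall>i<k. C i \<in> sets borel \<and> bounded (C i)) \<and> disjoint_family_on C {..<k} \<Longrightarrow>
           (AE \<omega> in M.
              real_cond_exp M (vimage_algebra (space M) \<delta> borel)
                (indicator {\<omega>\<in>space M. \<forall>i<k. emeasure (\<nu> \<omega>) (C i) = of_nat (n i)}) \<omega>
              = (\<Prod>i<k. poisson_prob (\<delta> \<omega> * measure \<mu> (C i)) (n i)))"
    using \<nu> unfolding mixed_poisson_def by blast
  have \<nu>m: "\<nu> \<in> M \<rightarrow>\<^sub>M measure_algebra borel" using \<nu> by (simp add: mixed_poisson_def)
  have s\<mu>: "sets \<mu> = sets borel" and fin: "emeasure \<mu> B < \<infinity>"
    using \<mu> B by (auto simp: locally_finite_def)
  define m where "m = measure \<mu> B"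
  have emB: "emeasure \<mu> B = ennreal m"
    unfolding m_def using fin by (intro emeasure_eq_ennreal_measure) simp
  interpret finite_measure_subalgebra M "vimage_algebra (space M) \<delta> borel"
  proof
    show "subalgebra M (vimage_algebra (space M) \<delta> borel)"
      unfolding subalgebra_def
    proof (intro conjI subsetI)
      fix D assume "D \<in> sets (vimage_algebra (space M) \<delta> borel)"
      then obtain C where "D = \<delta> -` C \<inter> space M" "C \<in> sets borel"
        by (subst (asm) sets_vimage_algebra2) auto
      then show "D \<in> sets M" using measurable_sets[OF \<delta>(1)] by simp
    qed simp
  qed
  define K where "K n = ennreal (\<integral>\<omega>. \<delta> \<omega> ^ n * exp (- (\<delta> \<omega> * m)) \<partial>M)" for n
  show ?thesis
  proof (rule that[OF s\<mu> fin])
    show "K 0 = 1" if "emeasure \<mu> B = 0"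
    proof -
      have "m = 0" using that by (simp add: m_def measure_def)
      then show ?thesis by (simp add: K_def prob_space)
    qed
    show "colour_counts M \<nu> B \<mu> K"
      unfolding colour_counts_def
    proof (intro allI impI, elim conjE)
      fix n k :: nat and col :: "'a \<Rightarrow> nat" and c
      assume col: "col \<in> borel \<rightarrow>\<^sub>M count_space UNIV" "\<forall>x. col x < k" and c: "\<forall>i<n. c i < k"
      let ?D = "\<lambda>j. {y\<in>B. col y = j}" and ?n = "\<lambda>j. fibre_card n c j"
      have D: "?D j \<in> sets borel" for j by (rule colour_class_borel[OF col(1) B(1)])
      have bD: "bounded (?D j)" for j by (rule bounded_subset[OF B(2)]) auto
      have disj: "disjoint_family_on ?D {..<k}" by (auto simp: disjoint_family_on_def)
      have finD: "emeasure \<mu> (?D j) < \<infinity>" for j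
        using \<mu> D bD by (auto simp: locally_finite_def)
      have emD: "emeasure \<mu> (?D j) = ennreal (measure \<mu> (?D j))" for j
        using finD[of j] by (intro emeasure_eq_ennreal_measure) simp
      have sumD: "(\<Sum>j<k. measure \<mu> (?D j)) = m"
      proof -
        have "measure \<mu> (\<Union>j\<in>{..<k}. ?D j) = (\<Sum>j<k. measure \<mu> (?D j))"
          by (rule measure_finite_Union) (use D s\<mu> disj finD in \<open>auto simp: less_top\<close>)
        also have "(\<Union>j\<in>{..<k}. ?D j) = B" using col(2) by auto
        finally show ?thesis by (simp add: m_def)
      qed
      define E where "E = {\<omega>\<in>space M. \<forall>j<k. emeasure (\<nu> \<omega>) (?D j) = of_nat (?n j)}"
      have E: "E \<in> sets M"
      proof -
        have [measurable]: "(\<lambda>\<omega>. emeasure (\<nu> \<omega>) (?D j)) \<in> borel_measurable M" for j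
          by (rule measurable_compose[OF \<nu>m measurable_emeasure_measure_algebra[OF D]])
        show ?thesis unfolding E_def by measurable
      qed
      let ?f = "\<Prod>j<k. fact (?n j) :: real" and ?g = "\<Prod>i<n. measure \<mu> (?D (c i))"
      have pois: "(\<Prod>j<k. poisson_prob (t * measure \<mu> (?D j)) (?n j)) = (t ^ n * exp (- (t * m))) * (?g / ?f)" for t
      proof -
        have "(\<Prod>j<k. poisson_prob (t * measure \<mu> (?D j)) (?n j)) =
            (\<Prod>j<k. t ^ ?n j) * (\<Prod>j<k. measure \<mu> (?D j) ^ ?n j) / ?f * (\<Prod>j<k. exp (- (t * measure \<mu> (?D j))))"
          by (simp add: poisson_prob_def power_mult_distrib prod.distrib prod_dividef)
        also have "(\<Prod>j<k. t ^ ?n j) = t ^ n"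
          unfolding power_sum[symmetric] using sum_fibre_card[of n c k] c by simp
        also have "(\<Prod>j<k. measure \<mu> (?D j) ^ ?n j) = ?g"
          using prod_power_fibre_card[of n c k "\<lambda>j. measure \<mu> (?D j)"] c by simp
        also have "(\<Prod>j<k. exp (- (t * measure \<mu> (?D j)))) = exp (- (t * m))"
          by (simp add: exp_sum[symmetric] sum_negf sum_distrib_left[symmetric] sumD)
        finally show ?thesis by simp
      qed
      have "measure M E = (\<integral>\<omega>. indicator E \<omega> \<partial>M)" using E by simp
      also have "\<dots> = (\<integral>\<omega>. real_cond_exp M (vimage_algebra (space M) \<delta> borel) (indicator E) \<omega> \<partial>M)"
        by (rule real_cond_exp_int(2)[symmetric]) (use E in \<open>simp add: less_top[symmetric]\<close>)
      also have "\<dots> = (\<integral>\<omega>. (\<delta> \<omega> ^ n * exp (- (\<delta> \<omega> * m))) * (?g / ?f) \<partial>M)"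
      proof (rule integral_cong_AE)
        show "AE \<omega> in M. real_cond_exp M (vimage_algebra (space M) \<delta> borel) (indicator E) \<omega> =
            (\<delta> \<omega> ^ n * exp (- (\<delta> \<omega> * m))) * (?g / ?f)"
          using law[of k ?D ?n] D bD disj unfolding pois E_def by blast
      qed (use \<delta>(1) in auto)
      also have "\<dots> = (\<integral>\<omega>. \<delta> \<omega> ^ n * exp (- (\<delta> \<omega> * m)) \<partial>M) * (?g / ?f)"
        by (rule integral_mult_left_zero)
      finally have ME: "?f * measure M E = (\<integral>\<omega>. \<delta> \<omega> ^ n * exp (- (\<delta> \<omega> * m)) \<partial>M) * ?g"
        by (simp add: prod_pos)
      have Kpos: "0 \<le> (\<integral>\<omega>. \<delta> \<omega> ^ n * exp (- (\<delta> \<omega> * m)) \<partial>M)"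
        using \<delta>(2) by (intro integral_nonneg_AE) auto
      have f: "of_nat (\<Prod>j<k. fact (?n j)) = ennreal ?f"
        by (simp add: ennreal_of_nat_eq_real_of_nat)
      have "of_nat (\<Prod>j<k. fact (?n j)) * emeasure M E = ennreal (?f * measure M E)"
        unfolding f emeasure_eq_measure by (rule ennreal_mult[symmetric]) (auto intro: prod_nonneg)
      also have "\<dots> = K n * ennreal ?g"
        unfolding ME K_def by (rule ennreal_mult[OF Kpos]) (auto intro: prod_nonneg)
      also have "ennreal ?g = (\<Prod>i<n. emeasure \<mu> (?D (c i)))"
        by (simp add: emD prod_ennreal)
      finally show "of_nat (\<Prod>j<k. fact (?n j)) * emeasure M {\<omega>\<in>space M. \<forall>j<k. emeasure (\<nu> \<omega>) (?D j) = of_nat (?n j)} =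
          K n * (\<Prod>i<n. emeasure \<mu> (?D (c i)))" unfolding E_def .
    qed
  qed
qed

lemma emeasure_point_sum_lessThan:
  assumes "C \<in> sets borel"
  shows "emeasure (point_sum {..<m::nat} s) C = of_nat (card {l\<in>{..<m}. s l \<in> C})"
  unfolding emeasure_point_sum[OF assms] by (rule emeasure_count_space_finite) auto

lemma measurable_point_sum_lessThan:
  fixes \<mu> :: "'a::polish_space measure"
  assumes "sets \<mu> = sets borel"
  shows "(\<lambda>(m, s). point_sum {..<m} s) \<in> count_space UNIV \<Otimes>\<^sub>M (\<Pi>\<^sub>M i\<in>(UNIV :: nat set). \<mu>) \<rightarrow>\<^sub>M measure_algebra borel"
proof (rule measurable_measure_algebra)
  let ?P = "count_space (UNIV :: nat set) \<Otimes>\<^sub>M (\<Pi>\<^sub>M i\<in>(UNIV :: nat set). \<mu>)"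
  show "sets (case p of (m, s) \<Rightarrow> point_sum {..<m} s) = sets borel" for p :: "nat \<times> (nat \<Rightarrow> 'a)"
    by (simp add: split_beta point_sum_def)
  fix C :: "'a set" assume C: "C \<in> sets borel"
  have "(\<lambda>p. emeasure (point_sum {..<m} (snd p)) C) \<in> borel_measurable ?P" for m
  proof -
    have "emeasure (point_sum {..<m} s) C = (\<Sum>l<m. indicator C (s l))" for s
      unfolding emeasure_point_sum_lessThan[OF C] by (simp add: indicator_def of_nat_sum[symmetric] sum.If_cases Int_def del: of_nat_sum)
    moreover have "(\<lambda>p. \<Sum>l<m. indicator C (snd p l) :: ennreal) \<in> borel_measurable ?P"
    proof (rule borel_measurable_sum)
      fix l
      have "(\<lambda>p. snd p l) \<in> ?P \<rightarrow>\<^sub>M \<mu>"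
        by (rule measurable_compose[OF measurable_snd measurable_component_singleton]) simp
      moreover have "(indicator C :: 'a \<Rightarrow> ennreal) \<in> borel_measurable \<mu>" using C assms by (intro borel_measurable_indicator) simp
      ultimately show "(\<lambda>p. indicator C (snd p l) :: ennreal) \<in> borel_measurable ?P" by (rule measurable_compose)
    qed
    ultimately show ?thesis by simp
  qed
  then have "(\<lambda>p. emeasure (point_sum {..<fst p} (snd p)) C) \<in> borel_measurable ?P"
    by (rule measurable_compose_countable[OF _ measurable_fst])
  then show "(\<lambda>p. emeasure (case p of (m, s) \<Rightarrow> point_sum {..<m} s) C) \<in> borel_measurable ?P"
    by (simp add: split_beta)
qed

text \<open>
  For exactly \<open>m\<close> i.i.d. points. On the event in question, the factor \<open>\<Prod>\<^sub>j n\<^sub>j!\<close> counts the ways to assign the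
  positions \<open>i < n\<close> to the points in \<open>B\<close> such that the colours match. Counting the pairs of an outcome
  and an assignment the other way round, every injection \<open>f\<close> of \<open>{..<n}\<close> into \<open>{..<m}\<close> contributes the
  probability that point \<open>f i\<close> lies in \<open>B\<close> with colour \<open>c i\<close> for all \<open>i\<close> and that the other \<open>m - n\<close> points
  lie outside \<open>B\<close>.
\<close>

lemma binomial_colour_counts:
  fixes \<mu> :: "'a::polish_space measure"
  assumes \<mu>: "prob_space \<mu>" "sets \<mu> = sets borel" and B: "B \<in> sets borel"
    and col: "col \<in> borel \<rightarrow>\<^sub>M count_space UNIV" "\<And>x. col x < k" and c: "\<And>i. i < n \<Longrightarrow> c i < (k::nat)"
  shows "of_nat (\<Prod>j<k. fact (fibre_card n c j)) *
      emeasure (\<Pi>\<^sub>M i\<in>UNIV. \<mu>) {s \<in> space (\<Pi>\<^sub>M i\<in>(UNIV::nat set). \<mu>). \<forall>j<k. card {l\<in>{..<m}. s l \<in> B \<and> col (s l) = j} = fibre_card n c j} =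
    of_nat (card {f \<in> {..<n} \<rightarrow>\<^sub>E {..<m}. inj_on f {..<n}}) * emeasure \<mu> (- B) ^ (m - n) * (\<Prod>i<n. emeasure \<mu> {y\<in>B. col y = c i})"
proof -
  interpret \<mu>: prob_space \<mu> by fact
  interpret P: product_prob_space "\<lambda>_. \<mu>" "UNIV :: nat set" by unfold_locales
  let ?P = "\<Pi>\<^sub>M i\<in>(UNIV::nat set). \<mu>" and ?D = "\<lambda>j. {y\<in>B. col y = j}"
  let ?I = "{f \<in> {..<n} \<rightarrow>\<^sub>E {..<m}. inj_on f {..<n}}"
  have sp: "space \<mu> = UNIV" using sets_eq_imp_space_eq[OF \<mu>(2)] by simp
  then have spP: "space ?P = UNIV" by (simp add: space_PiM)
  have D: "?D j \<in> sets \<mu>" for j using colour_class_borel[OF col(1) B] \<mu>(2) by simp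
  have nB: "- B \<in> sets \<mu>" using B \<mu>(2) by auto
  have I: "finite ?I" by (rule finite_subset[of _ "{..<n} \<rightarrow>\<^sub>E {..<m}"]) (auto intro: finite_PiE)
  (* the set to which the assignment \<open>f\<close> confines the point number \<open>l\<close> *)
  define X where "X f l = (if l \<in> f ` {..<n} then ?D (c (the_inv_into {..<n} f l)) else - B)" for f :: "nat \<Rightarrow> nat" and l
  have X: "X f l \<in> sets \<mu>" for f l unfolding X_def using D nB by simp
  define R where "R f = {s \<in> space ?P. \<forall>l\<in>{..<m}. s l \<in> X f l}" for f
  define Q where "Q = {s \<in> space ?P. \<forall>j<k. card {l\<in>{..<m}. s l \<in> B \<and> col (s l) = j} = fibre_card n c j}"
  have R: "R f \<in> sets ?P" for f
    unfolding R_def by (intro sets.sets_Collect_finite_All sets_Collect_single') (use X sp in simp_all)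
  have PR: "emeasure ?P (R f) = emeasure \<mu> (- B) ^ (m - n) * (\<Prod>i<n. emeasure \<mu> (?D (c i)))" if f: "f \<in> ?I" for f
  proof -
    have finj: "inj_on f {..<n}" and fm: "f ` {..<n} \<subseteq> {..<m}" using f by auto
    have "emeasure ?P (R f) = (\<Prod>l\<in>{..<m}. emeasure \<mu> (X f l))"
      unfolding R_def by (rule P.emeasure_PiM_Collect) (simp_all add: X)
    also have "\<dots> = (\<Prod>l\<in>{..<m} - f ` {..<n}. emeasure \<mu> (X f l)) * (\<Prod>l\<in>f ` {..<n}. emeasure \<mu> (X f l))"
      by (rule prod.subset_diff[OF fm]) simp
    also have "(\<Prod>l\<in>{..<m} - f ` {..<n}. emeasure \<mu> (X f l)) = (\<Prod>l\<in>{..<m} - f ` {..<n}. emeasure \<mu> (- B))"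
      by (intro prod.cong refl) (simp add: X_def)
    also have "\<dots> = emeasure \<mu> (- B) ^ (m - n)"
      using fm by (simp add: card_Diff_subset card_image[OF finj])
    also have "(\<Prod>l\<in>f ` {..<n}. emeasure \<mu> (X f l)) = (\<Prod>i<n. emeasure \<mu> (?D (c i)))"
      unfolding prod.reindex[OF finj] comp_def
      by (intro prod.cong refl) (simp add: X_def the_inv_into_f_f[OF finj])
    finally show ?thesis .
  qed
  have count: "of_nat (\<Prod>j<k. fact (fibre_card n c j)) * indicator Q s = (\<Sum>f\<in>?I. indicator (R f) s :: ennreal)" for s
  proof -
    let ?J = "{l\<in>{..<m}. s l \<in> B}"
    have ok: "s \<in> Q \<longleftrightarrow> (\<forall>j. card {i\<in>{..<n}. c i = j} = card {l\<in>?J. col (s l) = j})"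
    proof -
      have J: "{l\<in>?J. col (s l) = j} = {l\<in>{..<m}. s l \<in> B \<and> col (s l) = j}" for j by auto
      have out: "card {i\<in>{..<n}. c i = j} = card {l\<in>?J. col (s l) = j}" if "\<not> j < k" for j
      proof -
        have "{i\<in>{..<n}. c i = j} = {}" "{l\<in>?J. col (s l) = j} = {}" using that c col(2) by auto
        then show ?thesis by (simp only:)
      qed
      have "s \<in> Q \<longleftrightarrow> (\<forall>j<k. card {i\<in>{..<n}. c i = j} = card {l\<in>?J. col (s l) = j})"
        unfolding Q_def spP J by (simp only: mem_Collect_eq UNIV_I simp_thms eq_commute)
      then show ?thesis using out by blast
    qed
    have Rf: "s \<in> R f \<longleftrightarrow> f \<in> bijections {..<n} ?J \<and> (\<forall>i\<in>{..<n}. col (s (f i)) = c i)" if f: "f \<in> ?I" for f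
    proof -
      have finj: "inj_on f {..<n}" and fm: "f ` {..<n} \<subseteq> {..<m}" and fe: "f \<in> {..<n} \<rightarrow>\<^sub>E {..<m}" using f by auto
      have "s \<in> R f \<longleftrightarrow> (\<forall>l\<in>f ` {..<n}. s l \<in> X f l) \<and> (\<forall>l\<in>{..<m} - f ` {..<n}. s l \<in> X f l)"
        unfolding R_def spP using fm by blast
      also have "(\<forall>l\<in>f ` {..<n}. s l \<in> X f l) \<longleftrightarrow> (\<forall>i\<in>{..<n}. s (f i) \<in> B \<and> col (s (f i)) = c i)"
        by (simp add: X_def the_inv_into_f_f[OF finj])
      also have "(\<forall>l\<in>{..<m} - f ` {..<n}. s l \<in> X f l) \<longleftrightarrow> (\<forall>l\<in>{..<m} - f ` {..<n}. s l \<notin> B)"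
        by (simp add: X_def)
      also have "(\<forall>i\<in>{..<n}. s (f i) \<in> B \<and> col (s (f i)) = c i) \<and> (\<forall>l\<in>{..<m} - f ` {..<n}. s l \<notin> B) \<longleftrightarrow>
          f ` {..<n} = ?J \<and> (\<forall>i\<in>{..<n}. col (s (f i)) = c i)"
        using fm by blast
      also have "f ` {..<n} = ?J \<longleftrightarrow> f \<in> bijections {..<n} ?J"
        using finj fe by (auto simp: bijections_def bij_betw_def PiE_iff)
      finally show ?thesis .
    qed
    have bI: "f \<in> ?I" if "f \<in> bijections {..<n} ?J" for f
      using that by (auto simp: bijections_def bij_betw_def PiE_iff)
    have "(\<Sum>f\<in>?I. indicator (R f) s :: ennreal) = of_nat (card {f\<in>?I. s \<in> R f})"
      using I by (simp add: indicator_def sum.If_cases Int_def)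
    also have "{f\<in>?I. s \<in> R f} = {f \<in> bijections {..<n} ?J. \<forall>i\<in>{..<n}. col (s (f i)) = c i}"
      using Rf bI by blast
    also have "card \<dots> = (if s \<in> Q then \<Prod>j<k. fact (fibre_card n c j) else 0)"
      unfolding ok using c by (intro card_colour_bijections[where d = "\<lambda>l. col (s l)"]) auto
    finally show ?thesis by (simp add: indicator_def)
  qed
  have Q: "Q \<in> sets ?P"
  proof -
    have "(\<lambda>s. real (card {l\<in>{..<m}. s l \<in> B \<and> col (s l) = j})) \<in> borel_measurable ?P" for j
    proof -
      have "real (card {l\<in>{..<m}. s l \<in> B \<and> col (s l) = j}) = (\<Sum>l<m. indicator (?D j) (s l))" for s
        by (simp add: indicator_def sum.If_cases Int_def)
      moreover have "(\<lambda>s. \<Sum>l<m. indicator (?D j) (s l) :: real) \<in> borel_measurable ?P"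
        by (intro borel_measurable_sum measurable_compose[OF measurable_component_singleton borel_measurable_indicator] D) simp
      ultimately show ?thesis by simp
    qed
    note [measurable] = this
    have "{s \<in> space ?P. \<forall>j<k. real (card {l\<in>{..<m}. s l \<in> B \<and> col (s l) = j}) = real (fibre_card n c j)} \<in> sets ?P"
      by measurable
    then show ?thesis unfolding Q_def by (simp only: of_nat_eq_iff)
  qed
  have "of_nat (\<Prod>j<k. fact (fibre_card n c j)) * emeasure ?P Q = (\<integral>\<^sup>+s. of_nat (\<Prod>j<k. fact (fibre_card n c j)) * indicator Q s \<partial>?P)"
    by (rule nn_integral_cmult_indicator[symmetric, OF Q])
  also have "\<dots> = (\<Sum>f\<in>?I. emeasure ?P (R f))"
    unfolding count by (subst nn_integral_sum) (use R in simp_all)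
  also have "\<dots> = (\<Sum>f\<in>?I. emeasure \<mu> (- B) ^ (m - n) * (\<Prod>i<n. emeasure \<mu> (?D (c i))))"
    by (intro sum.cong refl PR)
  also have "\<dots> = of_nat (card ?I) * (emeasure \<mu> (- B) ^ (m - n) * (\<Prod>i<n. emeasure \<mu> (?D (c i))))"
    by (rule sum_constant)
  finally show ?thesis unfolding Q_def by (simp only: mult.assoc)
qed

text \<open>
  The constant \<open>K n\<close> is the mean over the random number \<open>m\<close> of the factor found for fixed \<open>m\<close>.
\<close>

lemma mixed_binomial_colour_counts:
  fixes \<nu> :: "'w \<Rightarrow> 'a::polish_space measure"
  assumes M: "prob_space M" and \<nu>: "mixed_binomial M \<nu>" and B: "B \<in> sets borel"
  obtains \<mu> K where "sets \<mu> = sets borel" "emeasure \<mu> B < \<infinity>" "colour_counts M \<nu> B \<mu> K"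
    "emeasure \<mu> B = 0 \<Longrightarrow> K 0 = 1"
proof -
  interpret prob_space M by fact
  obtain p :: "nat pmf" and \<mu> where \<mu>: "prob_space \<mu>" "sets \<mu> = sets borel"
    and law: "distr M (measure_algebra borel) \<nu> =
        distr (measure_pmf p \<Otimes>\<^sub>M (\<Pi>\<^sub>M i\<in>UNIV. \<mu>)) (measure_algebra borel) (\<lambda>(n, s). point_sum {..<n} s)"
    using \<nu> unfolding mixed_binomial_def by blast
  have \<nu>m: "\<nu> \<in> M \<rightarrow>\<^sub>M measure_algebra borel" using \<nu> by (simp add: mixed_binomial_def)
  interpret \<mu>: prob_space \<mu> by fact
  let ?P = "\<Pi>\<^sub>M i\<in>(UNIV::nat set). \<mu>"
  interpret P: prob_space ?P by (intro prob_space_PiM \<mu>)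
  have T: "(\<lambda>(m, s). point_sum {..<m} s) \<in> measure_pmf p \<Otimes>\<^sub>M ?P \<rightarrow>\<^sub>M measure_algebra borel"
  proof -
    have "sets (measure_pmf p \<Otimes>\<^sub>M ?P) = sets (count_space UNIV \<Otimes>\<^sub>M ?P)" by (intro sets_pair_measure_cong) simp_all
    then show ?thesis using measurable_point_sum_lessThan[OF \<mu>(2)] by (simp cong: measurable_cong_sets)
  qed
  define K where "K n = (\<integral>\<^sup>+m. of_nat (card {f \<in> {..<n} \<rightarrow>\<^sub>E {..<m}. inj_on f {..<n}}) * emeasure \<mu> (- B) ^ (m - n) \<partial>measure_pmf p)" for n
  show ?thesis
  proof (rule that[OF \<mu>(2)])
    show "emeasure \<mu> B < \<infinity>" by (simp add: less_top[symmetric])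
    show "K 0 = 1" if "emeasure \<mu> B = 0"
    proof -
      have "emeasure \<mu> (space \<mu> - B) = emeasure \<mu> (space \<mu>) - emeasure \<mu> B"
        using B \<mu>(2) by (intro emeasure_compl) simp_all
      then have "emeasure \<mu> (- B) = 1"
        using that \<mu>.emeasure_space_1 sets_eq_imp_space_eq[OF \<mu>(2)] by (simp add: Compl_eq_Diff_UNIV)
      then show ?thesis by (simp add: K_def measure_pmf.emeasure_space_1)
    qed
    show "colour_counts M \<nu> B \<mu> K"
      unfolding colour_counts_def
    proof (intro allI impI, elim conjE)
      fix n k :: nat and col :: "'a \<Rightarrow> nat" and c
      assume col: "col \<in> borel \<rightarrow>\<^sub>M count_space UNIV" "\<forall>x. col x < k" and c: "\<forall>i<n. c i < k"
      let ?D = "\<lambda>j. {y\<in>B. col y = j}" and ?n = "\<lambda>j. fibre_card n c j"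
      have D: "?D j \<in> sets borel" for j by (rule colour_class_borel[OF col(1) B])
      define Q where "Q = {x \<in> space (measure_algebra (borel :: 'a measure)). \<forall>j<k. emeasure x (?D j) = of_nat (?n j)}"
      have Q: "Q \<in> sets (measure_algebra borel)"
      proof -
        have [measurable]: "(\<lambda>x. emeasure x (?D j)) \<in> borel_measurable (measure_algebra borel)" for j
          by (rule measurable_emeasure_measure_algebra[OF D])
        show ?thesis unfolding Q_def by measurable
      qed
      let ?F = "of_nat (\<Prod>j<k. fact (?n j)) :: ennreal"
      have "{\<omega>\<in>space M. \<forall>j<k. emeasure (\<nu> \<omega>) (?D j) = of_nat (?n j)} = \<nu> -` Q \<inter> space M"
        using measurable_space[OF \<nu>m] unfolding Q_def by blast
      then have "emeasure M {\<omega>\<in>space M. \<forall>j<k. emeasure (\<nu> \<omega>) (?D j) = of_nat (?n j)} = emeasure (distr M (measure_algebra borel) \<nu>) Q"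
        by (simp only: emeasure_distr[OF \<nu>m Q])
      also have "\<dots> = emeasure (measure_pmf p \<Otimes>\<^sub>M ?P) ((\<lambda>(m, s). point_sum {..<m} s) -` Q \<inter> space (measure_pmf p \<Otimes>\<^sub>M ?P))"
        unfolding law by (rule emeasure_distr[OF T Q])
      also have "\<dots> = (\<integral>\<^sup>+m. emeasure ?P (Pair m -` ((\<lambda>(m, s). point_sum {..<m} s) -` Q \<inter> space (measure_pmf p \<Otimes>\<^sub>M ?P))) \<partial>measure_pmf p)"
        by (rule P.emeasure_pair_measure_alt) (rule measurable_sets[OF T Q])
      also have "\<dots> = (\<integral>\<^sup>+m. emeasure ?P {s \<in> space ?P. \<forall>j<k. card {l\<in>{..<m}. s l \<in> B \<and> col (s l) = j} = ?n j} \<partial>measure_pmf p)"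
      proof (intro nn_integral_cong arg_cong[where f = "emeasure ?P"] set_eqI)
        fix m :: nat and s :: "nat \<Rightarrow> 'a"
        have "point_sum {..<m} s \<in> space (measure_algebra borel)"
          by (simp add: space_measure_algebra point_sum_def)
        moreover have "emeasure (point_sum {..<m} s) (?D j) = of_nat (?n j) \<longleftrightarrow> card {l\<in>{..<m}. s l \<in> B \<and> col (s l) = j} = ?n j" for j
          unfolding emeasure_point_sum_lessThan[OF D] of_nat_eq_iff by (simp only: mem_Collect_eq)
        ultimately have "point_sum {..<m} s \<in> Q \<longleftrightarrow> (\<forall>j<k. card {l\<in>{..<m}. s l \<in> B \<and> col (s l) = j} = ?n j)"
          unfolding Q_def by (simp only: mem_Collect_eq simp_thms)
        then show "s \<in> Pair m -` ((\<lambda>(m, s). point_sum {..<m} s) -` Q \<inter> space (measure_pmf p \<Otimes>\<^sub>M ?P)) \<longleftrightarrow>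
            s \<in> {s \<in> space ?P. \<forall>j<k. card {l\<in>{..<m}. s l \<in> B \<and> col (s l) = j} = ?n j}"
          unfolding space_pair_measure by (simp only: vimage_eq Int_iff prod.case mem_Sigma_iff space_measure_pmf UNIV_I simp_thms mem_Collect_eq) blast
      qed
      finally have count: "emeasure M {\<omega>\<in>space M. \<forall>j<k. emeasure (\<nu> \<omega>) (?D j) = of_nat (?n j)} =
          (\<integral>\<^sup>+m. emeasure ?P {s \<in> space ?P. \<forall>j<k. card {l\<in>{..<m}. s l \<in> B \<and> col (s l) = j} = ?n j} \<partial>measure_pmf p)" .
      have "?F * emeasure M {\<omega>\<in>space M. \<forall>j<k. emeasure (\<nu> \<omega>) (?D j) = of_nat (?n j)} =
          (\<integral>\<^sup>+m. ?F * emeasure ?P {s \<in> space ?P. \<forall>j<k. card {l\<in>{..<m}. s l \<in> B \<and> col (s l) = j} = ?n j} \<partial>measure_pmf p)"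
        unfolding count by (rule nn_integral_cmult[symmetric]) simp
      also have "\<dots> = (\<integral>\<^sup>+m. of_nat (card {f \<in> {..<n} \<rightarrow>\<^sub>E {..<m}. inj_on f {..<n}}) * emeasure \<mu> (- B) ^ (m - n) *
          (\<Prod>i<n. emeasure \<mu> (?D (c i))) \<partial>measure_pmf p)"
        using col(2) c by (intro nn_integral_cong binomial_colour_counts[OF \<mu> B col(1)]) simp_all
      also have "\<dots> = K n * (\<Prod>i<n. emeasure \<mu> (?D (c i)))"
        unfolding K_def by (rule nn_integral_multc) simp
      finally show "?F * emeasure M {\<omega>\<in>space M. \<forall>j<k. emeasure (\<nu> \<omega>) (?D j) = of_nat (?n j)} =
          K n * (\<Prod>i<n. emeasure \<mu> (?D (c i)))" .
    qed
  qed
qed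

text \<open>
  Replacing \<open>\<mu>\<close> by its normalization on \<open>B\<close> only changes the constants. This requires \<open>\<mu>(B) > 0\<close>: otherwise
  \<open>K 0 = 1\<close>, which is the probability that there is no point in \<open>B\<close>.
\<close>

lemma normalized_colour_counts:
  fixes \<nu> :: "'w \<Rightarrow> 'a::polish_space measure"
  assumes M: "prob_space M" and \<nu>: "mixed_poisson M \<nu> \<or> mixed_binomial M \<nu>"
    and B: "B \<in> sets borel" "bounded B" and pos: "measure M {\<omega>\<in>space M. emeasure (\<nu> \<omega>) B = 0} < 1"
  obtains \<mu> K where "prob_space \<mu>" "sets \<mu> = sets borel" "\<And>C. C \<in> sets borel \<Longrightarrow> emeasure \<mu> (B \<inter> C) = emeasure \<mu> C"
    "colour_counts M \<nu> B \<mu> K"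
proof -
  interpret prob_space M by fact
  obtain \<mu> K where \<mu>: "sets \<mu> = sets borel" "emeasure \<mu> B < \<infinity>" and cc: "colour_counts M \<nu> B \<mu> K"
    and K0: "emeasure \<mu> B = 0 \<Longrightarrow> K 0 = 1"
    using \<nu> mixed_poisson_colour_counts[OF M _ B] mixed_binomial_colour_counts[OF M _ B(1)] by metis
  have B\<mu>: "B \<in> sets \<mu>" using B \<mu> by simp
  have nz: "emeasure \<mu> B \<noteq> 0"
  proof
    assume "emeasure \<mu> B = 0"
    then have "K 0 = 1" by (rule K0)
    moreover have "of_nat (\<Prod>j<1. fact (fibre_card 0 (\<lambda>_. 0) j)) *
          emeasure M {\<omega>\<in>space M. \<forall>j<1. emeasure (\<nu> \<omega>) {y\<in>B. (0::nat) = j} = of_nat (fibre_card 0 (\<lambda>_. 0) j)} =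
        K 0 * (\<Prod>i<0::nat. emeasure \<mu> {y\<in>B. (0::nat) = (\<lambda>_. 0) i})"
      using cc[unfolded colour_counts_def, rule_format, of "\<lambda>_. 0" 1 0 "\<lambda>_. 0"] by simp
    ultimately have "emeasure M {\<omega>\<in>space M. emeasure (\<nu> \<omega>) B = 0} = 1" by simp
    then show False using pos by (simp add: measure_def)
  qed
  define \<mu>' where "\<mu>' = uniform_measure \<mu> B"
  have em: "emeasure \<mu>' C = emeasure \<mu> (B \<inter> C) / emeasure \<mu> B" if "C \<in> sets borel" for C
    unfolding \<mu>'_def using that \<mu>(1) by (intro emeasure_uniform_measure B\<mu>) simp
  define b where "b = emeasure \<mu> B"
  have b: "b \<noteq> 0" "b \<noteq> \<top>" using nz \<mu>(2) by (simp_all add: b_def less_top)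
  show ?thesis
  proof (rule that[of \<mu>' "\<lambda>n. K n * b ^ n"])
    show "prob_space \<mu>'" unfolding \<mu>'_def using nz \<mu>(2) by (intro prob_space_uniform_measure) (simp_all add: less_top)
    show "sets \<mu>' = sets borel" by (simp add: \<mu>'_def \<mu>)
    show "emeasure \<mu>' (B \<inter> C) = emeasure \<mu>' C" if "C \<in> sets borel" for C
      using em[OF that] em[OF sets.Int[OF B(1) that]] by (simp add: Int_assoc[symmetric])
    show "colour_counts M \<nu> B \<mu>' (\<lambda>n. K n * b ^ n)"
      unfolding colour_counts_def
    proof (intro allI impI)
      fix n k :: nat and col :: "'a \<Rightarrow> nat" and c
      assume a: "col \<in> borel \<rightarrow>\<^sub>M count_space UNIV \<and> (\<forall>x. col x < k) \<and> (\<forall>i<n. c i < k)"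
      have "b * emeasure \<mu>' {y\<in>B. col y = j} = emeasure \<mu> {y\<in>B. col y = j}" for j
      proof -
        have "B \<inter> {y\<in>B. col y = j} = {y\<in>B. col y = j}" by auto
        then have "emeasure \<mu>' {y\<in>B. col y = j} = emeasure \<mu> {y\<in>B. col y = j} / b"
          using em[OF colour_class_borel[OF _ B(1)]] a by (simp add: b_def)
        then show ?thesis using b by (simp add: ennreal_times_divide mult.commute[of b] ennreal_mult_divide_eq)
      qed
      then have "(\<Prod>i<n. emeasure \<mu> {y\<in>B. col y = c i}) = (\<Prod>i<n. b * emeasure \<mu>' {y\<in>B. col y = c i})"
        by simp
      also have "\<dots> = b ^ n * (\<Prod>i<n. emeasure \<mu>' {y\<in>B. col y = c i})" by (simp add: prod.distrib)
      finally have eq: "K n * (\<Prod>i<n. emeasure \<mu> {y\<in>B. col y = c i}) = K n * b ^ n * (\<Prod>i<n. emeasure \<mu>' {y\<in>B. col y = c i})"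
        by (simp only: mult.assoc)
      show "of_nat (\<Prod>j<k. fact (fibre_card n c j)) *
          emeasure M {\<omega>\<in>space M. \<forall>j<k. emeasure (\<nu> \<omega>) {y\<in>B. col y = j} = of_nat (fibre_card n c j)} =
        K n * b ^ n * (\<Prod>i<n. emeasure \<mu>' {y\<in>B. col y = c i})"
        unfolding eq[symmetric] by (rule cc[unfolded colour_counts_def, rule_format, OF a])
    qed
  qed
qed


section \<open>Independence of the points in random order\<close>

context restricted_graph_process
begin

text \<open>
  Both sides are means: outcome by outcome, the number of orders in which the point at position
  \<open>i\<close> has colour \<open>c i\<close> is \<open>\<Prod>\<^sub>j n\<^sub>j!\<close> if the colours of the points occur as often as those of \<open>c\<close>, and 0
  otherwise.
\<close>

lemma colour_sum:
  assumes \<nu>: "\<nu> \<in> M \<rightarrow>\<^sub>M measure_algebra borel"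
    and count: "AE \<omega> in M. \<forall>C\<in>sets borel. emeasure (\<nu> \<omega>) C = emeasure (count_space (indices (N \<omega>))) {k\<in>indices (N \<omega>). S \<omega> k \<in> C}"
    and col: "col \<in> borel \<rightarrow>\<^sub>M count_space UNIV" "\<And>x. col x < k" and c: "\<And>i. i < n \<Longrightarrow> c i < (k::nat)"
  defines "H \<equiv> \<lambda>f. {x \<in> space measures. num x = n \<and> (\<forall>i<n. col (pt (f i) x) = c i)}"
  shows "H f \<in> sets measures"
    and "(\<Sum>f\<in>bijections {..<n} {..<n}. \<integral>\<^sup>+\<omega>. indicator (H f) (\<xi> \<omega>) \<partial>M) =
      of_nat (\<Prod>j<k. fact (fibre_card n c j)) *
        emeasure M {\<omega>\<in>space M. \<forall>j<k. emeasure (\<nu> \<omega>) {y\<in>B. col y = j} = of_nat (fibre_card n c j)}"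
proof -
  have Hs: "H f \<in> sets measures" for f
  proof -
    have [measurable]: "(\<lambda>x. col (pt i x)) \<in> measures \<rightarrow>\<^sub>M count_space UNIV" for i
      by (rule measurable_compose[OF measurable_pt col(1)])
    note [measurable] = measurable_num
    show ?thesis unfolding H_def by measurable
  qed
  then show "H f \<in> sets measures" .
  let ?B = "bijections {..<n} {..<n}" and ?D = "\<lambda>j. {y\<in>B. col y = j}"
  have D: "?D j \<in> sets borel" for j by (rule colour_class_borel[OF col(1) borel_B])
  define Q where "Q = {\<omega>\<in>space M. \<forall>j<k. emeasure (\<nu> \<omega>) (?D j) = of_nat (fibre_card n c j)}"
  have Q: "Q \<in> sets M"
  proof -
    have [measurable]: "(\<lambda>\<omega>. emeasure (\<nu> \<omega>) (?D j)) \<in> borel_measurable M" for j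
      by (rule measurable_compose[OF \<nu> measurable_emeasure_measure_algebra[OF D]])
    show ?thesis unfolding Q_def by measurable
  qed
  have fin: "finite ?B" by (rule finite_bijections) auto
  have "(\<Sum>f\<in>?B. \<integral>\<^sup>+\<omega>. indicator (H f) (\<xi> \<omega>) \<partial>M) = (\<integral>\<^sup>+\<omega>. (\<Sum>f\<in>?B. indicator (H f) (\<xi> \<omega>)) \<partial>M)"
    by (rule nn_integral_sum[symmetric]) (rule measurable_compose[OF measurable_\<xi> borel_measurable_indicator[OF Hs]])
  also have "\<dots> = (\<integral>\<^sup>+\<omega>. of_nat (\<Prod>j<k. fact (fibre_card n c j)) * indicator Q \<omega> \<partial>M)"
  proof (rule nn_integral_cong_AE)
    show "AE \<omega> in M. (\<Sum>f\<in>?B. indicator (H f) (\<xi> \<omega>)) = of_nat (\<Prod>j<k. fact (fibre_card n c j)) * (indicator Q \<omega> :: ennreal)"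
      using AE_sorting[of n] AE_space count
    proof eventually_elim
      case (elim \<omega>)
      obtain \<kappa> where "sorted_by \<kappa> n \<omega>" using elim(1) by blast
      note \<kappa> = sorted_byD[OF this]
      let ?m = "num (\<xi> \<omega>)" and ?J = "indices (N \<omega>)"
      define g where "g l = col (pt l (\<xi> \<omega>))" for l
      have gk: "g l < k" for l using col(2) by (simp add: g_def)
      have bij: "bij_betw \<kappa> {..<?m} (inside \<omega>)" using \<kappa>(5) unfolding sorting_def by (rule conjunct1)
      have \<nu>D: "emeasure (\<nu> \<omega>) (?D j) = of_nat (fibre_card ?m g j)" for j
      proof -
        have im: "{k\<in>?J. S \<omega> k \<in> ?D j} = \<kappa> ` {l\<in>{..<?m}. g l = j}"
        proof -
          have "{k\<in>?J. S \<omega> k \<in> ?D j} = {k\<in>inside \<omega>. col (S \<omega> k) = j}" by auto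
          also have "inside \<omega> = \<kappa> ` {..<?m}" using bij by (simp add: bij_betw_def)
          also have "{k\<in>\<kappa> ` {..<?m}. col (S \<omega> k) = j} = \<kappa> ` {l\<in>{..<?m}. g l = j}"
            using \<kappa>(3) by (auto simp: g_def)
          finally show ?thesis .
        qed
        have "emeasure (\<nu> \<omega>) (?D j) = emeasure (count_space ?J) {k\<in>?J. S \<omega> k \<in> ?D j}"
          using elim(3) D by blast
        also have "\<dots> = of_nat (card {k\<in>?J. S \<omega> k \<in> ?D j})"
        proof (rule emeasure_count_space_finite)
          show "finite {k\<in>?J. S \<omega> k \<in> ?D j}" unfolding im by simp
        qed blast
        also have "card {k\<in>?J. S \<omega> k \<in> ?D j} = fibre_card ?m g j"
          unfolding im by (rule card_image) (rule inj_on_subset[of \<kappa> "{..<?m}"], use bij in \<open>auto simp: bij_betw_def\<close>)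
        finally show ?thesis .
      qed
      have Qiff: "\<omega> \<in> Q \<longleftrightarrow> (\<forall>j<k. fibre_card ?m g j = fibre_card n c j)"
        unfolding Q_def using elim(2) by (simp only: mem_Collect_eq simp_thms \<nu>D of_nat_eq_iff)
      have sp: "\<xi> \<omega> \<in> space measures" using measurable_space[OF measurable_\<xi> elim(2)] .
      show ?case
      proof (cases "?m = n")
        case False
        have "\<omega> \<notin> Q"
        proof
          assume "\<omega> \<in> Q"
          then have "(\<Sum>j<k. fibre_card ?m g j) = (\<Sum>j<k. fibre_card n c j)" unfolding Qiff by (intro sum.cong) auto
          then show False using False sum_fibre_card[of ?m g k] sum_fibre_card[of n c k] gk c by simp
        qed
        moreover have "\<xi> \<omega> \<notin> H f" for f unfolding H_def using False by simp
        ultimately show ?thesis by simp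
      next
        case True
        have "(\<Sum>f\<in>?B. indicator (H f) (\<xi> \<omega>) :: ennreal) = of_nat (card {f\<in>?B. \<xi> \<omega> \<in> H f})"
          using fin by (simp add: indicator_def sum.If_cases Int_def)
        also have "{f\<in>?B. \<xi> \<omega> \<in> H f} = {f\<in>?B. \<forall>i\<in>{..<n}. g (f i) = c i}"
          unfolding H_def using sp True by (simp add: g_def Ball_def)
        also have "card \<dots> = (if \<forall>j. card {i\<in>{..<n}. c i = j} = card {l\<in>{..<n}. g l = j}
            then \<Prod>j<k. fact (fibre_card n c j) else 0)"
          using c by (intro card_colour_bijections) auto
        also have "(\<forall>j. card {i\<in>{..<n}. c i = j} = card {l\<in>{..<n}. g l = j}) \<longleftrightarrow> \<omega> \<in> Q"
        proof -
          have "fibre_card n g j = fibre_card n c j" if "\<not> j < k" for j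
          proof -
            have "{i\<in>{..<n}. c i = j} = {}" "{i\<in>{..<n}. g i = j} = {}" using that c gk by auto
            then show ?thesis by (simp only:)
          qed
          then show ?thesis unfolding Qiff True by metis
        qed
        finally show ?thesis by (simp add: indicator_def)
      qed
    qed
  qed
  also have "\<dots> = of_nat (\<Prod>j<k. fact (fibre_card n c j)) * emeasure M Q"
    by (rule nn_integral_cmult_indicator[OF Q])
  finally show "(\<Sum>f\<in>?B. \<integral>\<^sup>+\<omega>. indicator (H f) (\<xi> \<omega>) \<partial>M) =
      of_nat (\<Prod>j<k. fact (fibre_card n c j)) *
        emeasure M {\<omega>\<in>space M. \<forall>j<k. emeasure (\<nu> \<omega>) {y\<in>B. col y = j} = of_nat (fibre_card n c j)}"
    unfolding Q_def .
qed

text \<open>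
  The sets \<open>C 0, \<dots>, C (n - 1)\<close> may overlap. Their common refinement is a partition: the colour
  of \<open>y\<close> encodes the set of all \<open>i < n\<close> with \<open>y \<in> C i\<close>. A rectangle is then the disjoint union of the
  colourings \<open>c\<close> with \<open>i \<in> set_decode (c i)\<close> for all \<open>i < n\<close>, and by distributivity the sum of the
  products of \<open>colour_counts\<close> over all these colourings is the product for the rectangle.
\<close>

lemma ordered_points_law:
  assumes \<nu>: "\<nu> \<in> M \<rightarrow>\<^sub>M measure_algebra borel"
    and count: "AE \<omega> in M. \<forall>C\<in>sets borel. emeasure (\<nu> \<omega>) C = emeasure (count_space (indices (N \<omega>))) {k\<in>indices (N \<omega>). S \<omega> k \<in> C}"
    and \<mu>: "sets \<mu> = sets borel" "\<And>C. C \<in> sets borel \<Longrightarrow> emeasure \<mu> (B \<inter> C) = emeasure \<mu> C"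
    and cc: "colour_counts M \<nu> B \<mu> K" and C: "\<And>i. C i \<in> sets borel"
  shows "(\<Sum>f\<in>bijections {..<n} {..<n}. \<integral>\<^sup>+\<omega>. indicator (sorted_event n f (PiE {..<n} C)) (\<xi> \<omega>) \<partial>M) =
      K n * (\<Prod>i<n. emeasure \<mu> (C i))"
proof -
  let ?B = "bijections {..<n} {..<n}"
  define col where "col y = set_encode {i. i < n \<and> y \<in> C i}" for y
  define k where "k = Suc (Max (set_encode ` Pow {..<n}))"
  have colk: "col y < k" for y
  proof -
    have "col y \<in> set_encode ` Pow {..<n}" unfolding col_def by auto
    then have "col y \<le> Max (set_encode ` Pow {..<n})" by (intro Max_ge) simp_all
    then show ?thesis by (simp add: k_def)
  qed
  have dec: "i \<in> set_decode (col y) \<longleftrightarrow> y \<in> C i" if "i < n" for i y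
    unfolding col_def using that by (subst set_encode_inverse) simp_all
  have colm: "col \<in> borel \<rightarrow>\<^sub>M count_space UNIV"
  proof -
    have "col = (\<lambda>y. \<Sum>i<n. if y \<in> C i then 2 ^ i else 0)"
      unfolding col_def set_encode_def by (intro ext) (simp add: sum.If_cases Int_def lessThan_def)
    moreover have "(\<lambda>y. \<Sum>i<n. if y \<in> C i then 2 ^ i else 0 :: nat) \<in> borel \<rightarrow>\<^sub>M count_space UNIV"
      using C by measurable
    ultimately show ?thesis by simp
  qed
  let ?D = "\<lambda>j. {y\<in>B. col y = j}"
  define J where "J i = {j\<in>{..<k}. i \<in> set_decode j}" for i
  define H where "H c f = {x \<in> space measures. num x = n \<and> (\<forall>i<n. col (pt (f i) x) = c i)}" for c and f :: "nat \<Rightarrow> nat"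
  let ?CC = "PiE {..<n} J"
  have CC: "finite ?CC" by (rule finite_PiE) (simp_all add: J_def)
  have ck: "c i < k" if "c \<in> ?CC" "i < n" for c i using that by (auto simp: J_def PiE_iff)
  have Hs: "H c f \<in> sets measures" if "c \<in> ?CC" for c f
    unfolding H_def by (rule colour_sum(1)[OF \<nu> count colm colk ck[OF that]])
  have split: "indicator (sorted_event n f (PiE {..<n} C)) (\<xi> \<omega>) = (\<Sum>c\<in>?CC. indicator (H c f) (\<xi> \<omega>) :: ennreal)"
    if \<omega>: "\<omega> \<in> space M" for \<omega> f
  proof -
    have sp: "\<xi> \<omega> \<in> space measures" using measurable_space[OF measurable_\<xi> \<omega>] .
    define c0 where "c0 = (\<lambda>i\<in>{..<n}. col (pt (f i) (\<xi> \<omega>)))"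
    have mem: "\<xi> \<omega> \<in> sorted_event n f (PiE {..<n} C) \<longleftrightarrow> num (\<xi> \<omega>) = n \<and> c0 \<in> ?CC"
    proof -
      have "(\<lambda>i\<in>{..<n}. pt (f i) (\<xi> \<omega>)) \<in> PiE {..<n} C \<longleftrightarrow> (\<forall>i<n. pt (f i) (\<xi> \<omega>) \<in> C i)"
        by (simp add: restrict_PiE_iff Ball_def Pi_iff)
      also have "\<dots> \<longleftrightarrow> (\<forall>i<n. i \<in> set_decode (col (pt (f i) (\<xi> \<omega>))))" using dec by simp
      also have "\<dots> \<longleftrightarrow> c0 \<in> ?CC" using colk by (simp add: c0_def restrict_PiE_iff J_def Ball_def Pi_iff)
      finally show ?thesis using sp by (simp only: sorted_event_def mem_Collect_eq simp_thms)
    qed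
    have Hc: "\<xi> \<omega> \<in> H c f \<longleftrightarrow> num (\<xi> \<omega>) = n \<and> c = c0" if c: "c \<in> ?CC" for c
    proof -
      have "c = c0 \<longleftrightarrow> (\<forall>i<n. c i = c0 i)"
      proof
        assume "\<forall>i<n. c i = c0 i"
        moreover have "c0 \<in> {..<n} \<rightarrow>\<^sub>E UNIV" by (simp add: c0_def)
        moreover have "c \<in> {..<n} \<rightarrow>\<^sub>E UNIV" using c by (simp add: PiE_iff)
        ultimately show "c = c0" by (intro PiE_ext[of c "{..<n}" "\<lambda>_. UNIV" c0]) simp_all
      qed simp
      then show ?thesis unfolding H_def c0_def using sp by auto
    qed
    have "(\<Sum>c\<in>?CC. indicator (H c f) (\<xi> \<omega>) :: ennreal) = (\<Sum>c\<in>?CC. if c = c0 then of_bool (num (\<xi> \<omega>) = n) else 0)"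
      by (intro sum.cong refl) (simp add: indicator_def Hc)
    also have "\<dots> = of_bool (num (\<xi> \<omega>) = n \<and> c0 \<in> ?CC)"
      by (subst sum.delta[OF CC]) simp
    finally show ?thesis by (simp only: indicator_def mem)
  qed
  have class_sum: "(\<Sum>j\<in>J i. emeasure \<mu> (?D j)) = emeasure \<mu> (C i)" if i: "i < n" for i
  proof -
    have "(\<Sum>j\<in>J i. emeasure \<mu> (?D j)) = emeasure \<mu> (\<Union>j\<in>J i. ?D j)"
      by (rule sum_emeasure) (use colour_class_borel[OF colm borel_B] \<mu>(1) in \<open>auto simp: disjoint_family_on_def J_def\<close>)
    also have "(\<Union>j\<in>J i. ?D j) = B \<inter> C i"
      using dec[OF i] colk by (auto simp: J_def)
    finally show ?thesis using \<mu>(2)[OF C] by simp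
  qed
  have "(\<Sum>f\<in>?B. \<integral>\<^sup>+\<omega>. indicator (sorted_event n f (PiE {..<n} C)) (\<xi> \<omega>) \<partial>M) =
      (\<Sum>f\<in>?B. \<Sum>c\<in>?CC. \<integral>\<^sup>+\<omega>. indicator (H c f) (\<xi> \<omega>) \<partial>M)"
  proof (rule sum.cong[OF refl])
    fix f
    have "(\<integral>\<^sup>+\<omega>. indicator (sorted_event n f (PiE {..<n} C)) (\<xi> \<omega>) \<partial>M) = (\<integral>\<^sup>+\<omega>. (\<Sum>c\<in>?CC. indicator (H c f) (\<xi> \<omega>)) \<partial>M)"
      by (rule nn_integral_cong) (rule split)
    also have "\<dots> = (\<Sum>c\<in>?CC. \<integral>\<^sup>+\<omega>. indicator (H c f) (\<xi> \<omega>) \<partial>M)"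
      by (rule nn_integral_sum) (rule measurable_compose[OF measurable_\<xi> borel_measurable_indicator[OF Hs]])
    finally show "(\<integral>\<^sup>+\<omega>. indicator (sorted_event n f (PiE {..<n} C)) (\<xi> \<omega>) \<partial>M) =
        (\<Sum>c\<in>?CC. \<integral>\<^sup>+\<omega>. indicator (H c f) (\<xi> \<omega>) \<partial>M)" .
  qed
  also have "\<dots> = (\<Sum>c\<in>?CC. \<Sum>f\<in>?B. \<integral>\<^sup>+\<omega>. indicator (H c f) (\<xi> \<omega>) \<partial>M)"
    by (rule sum.swap)
  also have "\<dots> = (\<Sum>c\<in>?CC. K n * (\<Prod>i<n. emeasure \<mu> (?D (c i))))"
  proof (rule sum.cong[OF refl])
    fix c assume c: "c \<in> ?CC"
    have a: "col \<in> borel \<rightarrow>\<^sub>M count_space UNIV \<and> (\<forall>x. col x < k) \<and> (\<forall>i<n. c i < k)"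
      using colm colk ck[OF c] by blast
    show "(\<Sum>f\<in>?B. \<integral>\<^sup>+\<omega>. indicator (H c f) (\<xi> \<omega>) \<partial>M) = K n * (\<Prod>i<n. emeasure \<mu> (?D (c i)))"
      unfolding H_def
      by (rule trans[OF colour_sum(2)[OF \<nu> count colm colk ck[OF c]] cc[unfolded colour_counts_def, rule_format, OF a]])
  qed
  also have "\<dots> = K n * (\<Sum>c\<in>?CC. \<Prod>i<n. emeasure \<mu> (?D (c i)))"
    by (rule sum_distrib_left[symmetric])
  also have "(\<Sum>c\<in>?CC. \<Prod>i<n. emeasure \<mu> (?D (c i))) = (\<Prod>i<n. \<Sum>j\<in>J i. emeasure \<mu> (?D j))"
    by (rule prod_sum_PiE[symmetric]) (simp_all add: J_def)
  also have "\<dots> = (\<Prod>i<n. emeasure \<mu> (C i))"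
    by (rule prod.cong[OF refl]) (simp add: class_sum)
  finally show ?thesis .
qed

end


section \<open>Existence and uniqueness of the exchangeable matrix\<close>

theorem theorem21:
  fixes M :: "'w measure"
    and \<xi> :: "'w \<Rightarrow> ('a::polish_space \<times> 'a \<times> real) measure"
    and \<nu> :: "'w \<Rightarrow> 'a measure"
    and B :: "'a set"
  assumes "prob_space M"
    and "supports_uniforms M \<xi>"
    and "graph_process M \<xi>"
    and "boundedly_exchangeable M \<xi> \<nu>"
    and "B \<in> sets borel" and "bounded B"
    and "measure M {\<omega>\<in>space M. emeasure (\<nu> \<omega>) B = 0} < 1"
  shows "(\<exists>X. exchangeable_adjacency_limit M (\<lambda>\<omega>. adjacency_restrict (\<xi> \<omega>) B) X) \<and>
         (\<forall>X Y. exchangeable_adjacency_limit M (\<lambda>\<omega>. adjacency_restrict (\<xi> \<omega>) B) X \<longrightarrow>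
                exchangeable_adjacency_limit M (\<lambda>\<omega>. adjacency_restrict (\<xi> \<omega>) B) Y \<longrightarrow>
                distr M (\<Pi>\<^sub>M p\<in>UNIV. borel) X = distr M (\<Pi>\<^sub>M p\<in>UNIV. borel) Y)"
proof -
  interpret prob_space M by fact
  obtain W N S A where W: "connection_kernel W" and gr: "graph_representation M W \<xi> N S A"
    and ram: "random_adjacency_measure M \<xi>"
    using assms(3) unfolding graph_process_def by blast
  have \<xi>: "\<xi> \<in> M \<rightarrow>\<^sub>M measure_algebra borel" using ram by (simp add: random_adjacency_measure_def)
  have rep: "representation M \<xi> N S A" using gr by (simp add: graph_representation_def)
  have dir: "AE \<omega> in M. adjacency_directed_by (\<xi> \<omega>) (\<nu> \<omega>)"
    and mixed: "mixed_poisson M \<nu> \<or> mixed_binomial M \<nu>"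
    and pos: "\<And>n. n \<ge> 1 \<Longrightarrow> measure M {\<omega>\<in>space M. emeasure (\<nu> \<omega>) B = of_nat n} > 0"
    using assms(4-7) unfolding boundedly_exchangeable_def by blast+
  have \<nu>: "\<nu> \<in> M \<rightarrow>\<^sub>M measure_algebra borel"
    using mixed by (auto simp: mixed_poisson_def mixed_binomial_def)
  (* the directing measure counts the points of the given representation *)
  have count: "AE \<omega> in M. \<forall>C\<in>sets borel. emeasure (\<nu> \<omega>) C = emeasure (count_space (indices (N \<omega>))) {k\<in>indices (N \<omega>). S \<omega> k \<in> C}"
  proof -
    have "AE \<omega> in M. inj_on (S \<omega>) (indices (N \<omega>)) \<and>
        (\<forall>i\<in>indices (N \<omega>). \<forall>j\<in>indices (N \<omega>). A \<omega> (i, j) \<in> {0, 1} \<and> A \<omega> (j, i) = A \<omega> (i, j)) \<and>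
        \<xi> \<omega> = point_sum (indices (N \<omega>) \<times> indices (N \<omega>)) (\<lambda>(i, j). (S \<omega> i, S \<omega> j, A \<omega> (i, j)))"
      using rep by (simp add: representation_def)
    with dir show ?thesis
    proof eventually_elim
      case (elim \<omega>)
      show ?case
        by (intro ballI directing_measure_count[OF _ elim(1), where a = "A \<omega>"]) (use elim(2) in blast)+
    qed
  qed
  have fin: "AE \<omega> in M. finite {k\<in>indices (N \<omega>). S \<omega> k \<in> B}"
    using count dir
  proof eventually_elim
    case (elim \<omega>)
    have "emeasure (\<nu> \<omega>) B < \<infinity>"
      using elim(2) assms(5,6) by (simp add: adjacency_directed_by_def simple_measure_def locally_finite_def)
    then have "emeasure (count_space (indices (N \<omega>))) {k\<in>indices (N \<omega>). S \<omega> k \<in> B} < \<infinity>"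
      using elim(1) assms(5) by simp
    then show ?case by (subst (asm) emeasure_count_space) (auto split: if_splits)
  qed
  obtain e :: "'a \<Rightarrow> real" and d where ed: "e \<in> borel_measurable borel" "d \<in> borel_measurable borel" "\<And>x. d (e x) = x"
    by (rule borel_real_code) blast
  interpret restricted_graph_process M W \<xi> N S A B e d
    by standard (rule gr W \<xi> assms(5) ed fin)+
  obtain \<mu> K where \<mu>: "prob_space \<mu>" "sets \<mu> = sets borel" "\<And>C. C \<in> sets borel \<Longrightarrow> emeasure \<mu> (B \<inter> C) = emeasure \<mu> C"
    and cc: "colour_counts M \<nu> B \<mu> K"
    by (rule normalized_colour_counts[OF assms(1) mixed assms(5-7)]) blast
  have PV: "prob_space (\<Pi>\<^sub>M k\<in>(UNIV::nat set). \<mu>)" by (intro prob_space_PiM \<mu>)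
  have sPV: "sets (\<Pi>\<^sub>M k\<in>(UNIV::nat set). \<mu>) = sets borel"
  proof -
    have "sets (\<Pi>\<^sub>M k\<in>(UNIV::nat set). \<mu>) = sets (\<Pi>\<^sub>M k\<in>(UNIV::nat set). borel)"
      by (rule sets_PiM_UNIV_borel_cong) (rule \<mu>(2))
    then show ?thesis by (simp only: sets_PiM_equal_borel)
  qed
  have su: "sets unif = sets borel" by simp
  obtain Z V where ZV: "Z \<in> borel_measurable M" "V \<in> borel_measurable M"
    and "distr M (borel \<Otimes>\<^sub>M borel) (\<lambda>\<omega>. (Z \<omega>, V \<omega>)) = unif \<Otimes>\<^sub>M (\<Pi>\<^sub>M k\<in>(UNIV::nat set). \<mu>)"
    and law: "distr M (measure_algebra borel \<Otimes>\<^sub>M (borel \<Otimes>\<^sub>M borel)) (\<lambda>\<omega>. (\<xi> \<omega>, Z \<omega>, V \<omega>)) =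
      distr M (measure_algebra borel) \<xi> \<Otimes>\<^sub>M (unif \<Otimes>\<^sub>M (\<Pi>\<^sub>M k\<in>(UNIV::nat set). \<mu>))"
    by (rule supports_uniforms_transfer[OF assms(1,2) prob_space_unif su PV sPV])
  (* for every \<open>n\<close>, a uniformly random order of \<open>n\<close> points as a function of one uniform variable *)
  have "\<exists>h. h \<in> borel \<rightarrow>\<^sub>M count_space UNIV \<and> (\<forall>u. h u \<in> bijections {..<n} {..<n}) \<and>
      (\<forall>f\<in>bijections {..<n} {..<n}. emeasure unif (h -` {f}) = 1 / of_nat (card (bijections {..<n} {..<n})))" for n :: nat
    by (rule unif_choice[OF finite_bijections bijections_nonempty, of n]) auto
  then obtain h where h: "\<And>n. h n \<in> borel \<rightarrow>\<^sub>M count_space UNIV" "\<And>n u. h n u \<in> bijections {..<n} {..<n::nat}"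
    "\<And>n f. f \<in> bijections {..<n} {..<n} \<Longrightarrow> emeasure unif (h n -` {f}) = 1 / of_nat (card (bijections {..<n} {..<n}))"
    by metis
  interpret randomized_graph_process M W \<xi> N S A B e d Z V \<mu> h K
    by (rule randomized_graph_process.intro[OF restricted_graph_process_axioms randomized_graph_process_axioms.intro])
       (rule \<mu>(1) \<mu>(2) ZV law h(1) h(2) | erule h(3) | rule ordered_points_law[OF \<nu> count \<mu>(2,3) cc] | assumption)+
  (* the new number of points is \<open>\<nu>(B)\<close>, which takes the value \<open>n\<close> with positive probability *)
  have "emeasure M {\<omega>\<in>space M. N' \<omega> = enat n} \<noteq> 0" if n: "n \<ge> 1" for n
  proof -
    have \<nu>B: "(\<lambda>\<omega>. emeasure (\<nu> \<omega>) B) \<in> borel_measurable M"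
      by (rule measurable_compose[OF \<nu> measurable_emeasure_measure_algebra[OF assms(5)]])
    have "emeasure M {\<omega>\<in>space M. N' \<omega> = enat n} = emeasure M {\<omega>\<in>space M. emeasure (\<nu> \<omega>) B = of_nat n}"
    proof (rule emeasure_eq_AE)
      show "AE \<omega> in M. \<omega> \<in> {\<omega>\<in>space M. N' \<omega> = enat n} \<longleftrightarrow> \<omega> \<in> {\<omega>\<in>space M. emeasure (\<nu> \<omega>) B = of_nat n}"
        using count fin AE_sorting[of 0]
      proof eventually_elim
        case (elim \<omega>)
        obtain \<kappa> where "sorted_by \<kappa> 0 \<omega>" using elim(3) by blast
        from sorted_byD(5)[OF this] have bij: "bij_betw \<kappa> {..<num (\<xi> \<omega>)} (inside \<omega>)"
          unfolding sorting_def by (rule conjunct1)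
        have "emeasure (\<nu> \<omega>) B = emeasure (count_space (indices (N \<omega>))) (inside \<omega>)"
          using elim(1) assms(5) by blast
        also have "\<dots> = of_nat (card (inside \<omega>))"
          by (rule emeasure_count_space_finite) (use elim(2) in auto)
        also have "card (inside \<omega>) = num (\<xi> \<omega>)" using bij_betw_same_card[OF bij] by simp
        finally have eq: "emeasure (\<nu> \<omega>) B = of_nat (num (\<xi> \<omega>))" .
        show ?case unfolding mem_Collect_eq eq N'_def of_nat_eq_iff by simp
      qed
      show "{\<omega>\<in>space M. N' \<omega> = enat n} \<in> sets M"
        using measurable_sets[OF N'_measurable, of "{enat n}"] by (simp add: vimage_def Int_def conj_commute)
      show "{\<omega>\<in>space M. emeasure (\<nu> \<omega>) B = of_nat n} \<in> sets M"
        using measurable_sets[OF \<nu>B, of "{of_nat n}"] by (simp add: vimage_def Int_def conj_commute)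
    qed
    then show ?thesis using pos[OF n] by (simp add: emeasure_eq_measure)
  qed
  then show ?thesis
    by (rule exchangeable_limit_of_iid_representation[OF assms(1,2) is_iid_representation])
qed

end
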